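(* The identities $$\mathfrak E_{n,B,l}(\mathbb D)=\mathfrak E_{n,B,r}(\mathbb D)=\mathfrak E_n(\mathbb D)\cap H_n^2(\mathbb D)$$ are valid; that is, the classes of $n\times n$ left Beurling-outer functions and of right Beurling-outer functions both coincide with the class of outer functions (in the sense of Smirnov) belonging to $H_n^2(\mathbb D)$.
   Context: $\mathbb D$ is the open unit disc, $\mathbb T$ the unit circle, $m$ normalized Lebesgue measure on $\mathbb T$, $\mathfrak M_n$ the complex $n\times n$ matrices with the operator norm induced by the Euclidean norm. Smirnov class: $\mathfrak N_n^+(\mathbb D)$ is the set of holomorphic $F:\mathbb D\to\mathfrak M_n$ such that for each $\epsilon>0$ there is $\delta>0$ with $\int_\Delta \ln^+\|F(rt)\|\,m(dt)<\epsilon$ for all $r\in[0,1)$ and all Borel $\Delta\subseteq\mathbb T$ with $m(\Delta)<\delta$. Such $F$ has radial boundary values $\underline F(t)=\lim_{r\to1-0}F(rt)$ for $m$-a.e. $t$. $H_n^\infty(\mathbb D)$ is the set of bounded holomorphic $F:\mathbb D\to\mathfrak M_n$; $H_n^2(\mathbb D)$ is the set of holomorphic $F:\mathbb D\to\mathfrak M_n$ with $\sup_{r\in[0,1)}\int_{\mathbb T}\|F(rt)\|^2\,m(dt)<\infty$. One has $H_n^\infty(\mathbb D)\subseteq H_n^2(\mathbb D)\subseteq\mathfrak N_n^+(\mathbb D)$. Outer: a scalar function $e:\mathbb D\to\mathbb C$ is outer if $e(z)=C\exp\{\int_{\mathbb T}\frac{t+z}{t-z}\ln[w(t)]\,m(dt)\}$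 with $|C|=1$ and $w:\mathbb T\to[0,\infty)$ such that $\ln w$ is $m$-integrable. $\mathfrak E_n(\mathbb D)$ is the set of $E\in\mathfrak N_n^+(\mathbb D)$ with $\det E$ outer. Beurling-outer: $E\in H_n^2(\mathbb D)$ is left (resp. right) Beurling-outer if there is a sequence $(F_k)_{k\in\mathbb N}$ in $H_n^\infty(\mathbb D)$ with $\lim_{k\to\infty}\int_{\mathbb T}\|\underline{F_k}(t)\underline E(t)-I_n\|^2\,m(dt)=0$ (resp. $\lim_{k\to\infty}\int_{\mathbb T}\|\underline E(t)\underline{F_k}(t)-I_n\|^2\,m(dt)=0$). The class of all such functions is $\mathfrak E_{n,B,l}(\mathbb D)$ (resp. $\mathfrak E_{n,B,r}(\mathbb D)$). *)

theory Defs
  imports "HOL-Analysis.Analysis"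
begin

text \<open>
  Functions on the open unit disc or on the unit circle are total functions on
  \<^typ>\<open>complex\<close>; every notion below depends only on the values on \<^term>\<open>ball 0 1\<close>
  or \<^term>\<open>sphere 0 1\<close>, respectively.
\<close>

definition circle_measure :: "complex measure" where
  "circle_measure =
     distr (uniform_measure lborel {0..<2 * pi}) (restrict_space borel (sphere 0 1)) cis"

lemma space_circle_measure: "space circle_measure = sphere 0 1"
  by (simp add: circle_measure_def space_restrict_space)

lemma sets_circle_measure: "sets circle_measure = sets (restrict_space borel (sphere 0 1))"
  by (simp add: circle_measure_def)

lemma emeasure_circle_measure: "emeasure circle_measure (sphere 0 1) = 1"
proof -
  have "cis \<in> borel_measurable borel"
    by (intro borel_measurable_continuous_onI continuous_intros)
  then have "cis \<in> borel_measurable (uniform_measure lborel {0..<2 * pi})"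
    by (simp cong: measurable_cong_sets)
  then have m: "cis \<in> measurable (uniform_measure lborel {0..<2 * pi})
      (restrict_space borel (sphere 0 1))"
    by (intro measurable_restrict_space2) auto
  have s: "sphere 0 1 \<in> sets (restrict_space borel (sphere 0 1 :: complex set))"
    by (simp add: sets_restrict_space_iff)
  show ?thesis
    by (simp add: circle_measure_def emeasure_distr[OF m s] emeasure_uniform_measure_1 vimage_def)
qed

text \<open>
  The library norm on \<^typ>\<open>complex^'n^'n\<close> is the Frobenius norm, so the operator
  norm has to be introduced separately.
\<close>

definition opnorm :: "complex^'n^'n \<Rightarrow> real" where
  "opnorm A = onorm (\<lambda>x. A *v x)"

definition ln_plus :: "real \<Rightarrow> real" where
  "ln_plus x = ln (max 1 x)"

definition matrix_holomorphic :: "(complex \<Rightarrow> complex^'n^'n) \<Rightarrow> bool" where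
  "matrix_holomorphic F \<longleftrightarrow> (\<forall>i j. (\<lambda>z. F z $ i $ j) holomorphic_on ball 0 1)"

text \<open>
  All integrals of nonnegative functions are taken in \<^typ>\<open>ennreal\<close>, so that they
  are never set to \<open>0\<close> for lack of integrability.
\<close>

definition smirnov_class :: "(complex \<Rightarrow> complex^'n^'n) set" where
  "smirnov_class = {F. matrix_holomorphic F \<and>
     (\<forall>\<epsilon>>0::real. \<exists>\<delta>>0::real. \<forall>r\<in>{0..<1::real}. \<forall>\<Delta>\<in>sets circle_measure.
        emeasure circle_measure \<Delta> < ennreal \<delta> \<longrightarrow>
        (\<integral>\<^sup>+t\<in>\<Delta>. ennreal (ln_plus (opnorm (F (of_real r * t)))) \<partial>circle_measure) < ennreal \<epsilon>)}"

definition hardy_inf :: "(complex \<Rightarrow> complex^'n^'n) set" where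
  "hardy_inf = {F. matrix_holomorphic F \<and> (\<exists>B. \<forall>z\<in>ball 0 1. opnorm (F z) \<le> B)}"

definition hardy_two :: "(complex \<Rightarrow> complex^'n^'n) set" where
  "hardy_two = {F. matrix_holomorphic F \<and>
     (SUP r\<in>{0..<1::real}. \<integral>\<^sup>+t. ennreal ((opnorm (F (of_real r * t)))\<^sup>2) \<partial>circle_measure) < \<infinity>}"

definition radial_boundary :: "(complex \<Rightarrow> complex^'n^'n) \<Rightarrow> complex \<Rightarrow> complex^'n^'n" where
  "radial_boundary F t = Lim (at_left 1) (\<lambda>r::real. F (of_real r * t))"

text \<open>
  Integrability of \<open>ln w\<close>, with \<open>ln 0 = - \<infinity>\<close>, forces \<open>w > 0\<close> almost everywhere; since
  \<^term>\<open>ln (0::real) = 0\<close> in the library, this is an explicit clause.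
\<close>

definition scalar_outer :: "(complex \<Rightarrow> complex) \<Rightarrow> bool" where
  "scalar_outer e \<longleftrightarrow> (\<exists>C w. cmod C = 1 \<and>
     (\<forall>t\<in>sphere 0 1. (w t :: real) \<ge> 0) \<and>
     (AE t in circle_measure. w t > 0) \<and>
     integrable circle_measure (\<lambda>t. ln (w t)) \<and>
     (\<forall>z\<in>ball 0 1. e z =
        C * exp (LINT t|circle_measure. (t + z) / (t - z) * of_real (ln (w t)))))"

definition outer_class :: "(complex \<Rightarrow> complex^'n^'n) set" where
  "outer_class = {E \<in> smirnov_class. scalar_outer (\<lambda>z. det (E z))}"

definition beurling_outer_left :: "(complex \<Rightarrow> complex^'n^'n) set" where
  "beurling_outer_left = {E \<in> hardy_two. \<exists>F :: nat \<Rightarrow> complex \<Rightarrow> complex^'n^'n.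
     (\<forall>k. F k \<in> hardy_inf) \<and>
     (\<lambda>k. \<integral>\<^sup>+t. ennreal ((opnorm
         (radial_boundary (F k) t ** radial_boundary E t - mat 1))\<^sup>2) \<partial>circle_measure)
       \<longlonglongrightarrow> 0}"

definition beurling_outer_right :: "(complex \<Rightarrow> complex^'n^'n) set" where
  "beurling_outer_right = {E \<in> hardy_two. \<exists>F :: nat \<Rightarrow> complex \<Rightarrow> complex^'n^'n.
     (\<forall>k. F k \<in> hardy_inf) \<and>
     (\<lambda>k. \<integral>\<^sup>+t. ennreal ((opnorm
         (radial_boundary E t ** radial_boundary (F k) t - mat 1))\<^sup>2) \<partial>circle_measure)
       \<longlonglongrightarrow> 0}"

end

theory Submission
  imports Defs "HOL-Complex_Analysis.Conformal_Mappings" "HOL-Real_Asymp.Real_Asymp"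
begin

text \<open>
  Write \<open>P[u]\<close> for the Poisson integral and let \<open>h = det E\<close>.

  If \<open>h\<close> is outer with weight \<open>w\<close>, take bounded outer functions \<open>\<phi>\<^sub>k\<close> with boundary modulus
  \<open>min 1 (k w / \<Prod>(1 + |E\<^sub>i\<^sub>j|))\<close>.
  Since \<open>|f| \<le> exp P[ln (1 + |f|)]\<close> for \<open>f\<close> in \<open>H\<^sup>2\<close>, the functions
  \<open>F\<^sub>k = \<phi>\<^sub>k E\<^sup>-\<^sup>1\<close> are bounded. Moreover \<open>F\<^sub>k E = E F\<^sub>k = \<phi>\<^sub>k I\<close>, and
  \<open>\<parallel>\<phi>\<^sub>k - 1\<parallel>\<^sup>2 \<le> 2 - 2 Re \<phi>\<^sub>k(0)\<close> tends to \<open>0\<close>.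

  Conversely, let \<open>G\<^sub>k\<close> be \<open>F\<^sub>k E\<close> or \<open>E F\<^sub>k\<close>, converging to \<open>I\<close> in \<open>L\<^sup>2\<close>. Then \<open>det G\<^sub>k(0) \<rightarrow> 1\<close>, whereas Jensen's
  inequality for \<open>det F\<^sub>k\<close> together with \<open>ln |det G\<^sub>k| \<le> \<Sum>|(G\<^sub>k - I)\<^sub>i\<^sub>j|\<close> yields
  \<open>ln |det F\<^sub>k(0)| \<le> o(1) - \<integral> ln |h| dm\<close>. Hence \<open>ln |h(0)| \<ge> \<integral> ln |h| dm\<close>, which is equality in Jensen's
  inequality, and the maximum principle shows that \<open>h\<close> is a unimodular multiple of the outer function
  with weight \<open>|h|\<close>.
\<close>

section \<open>The circle measure\<close>

text \<open>The determinant of a matrix with entries in \<open>H^2\<close> need not be in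
  \<open>H^2\<close>, so the \<open>L^2\<close> convergence on circles that the entries enjoy is
  lost for it. It is controlled through \<open>|det E| \<le> exp (sum of |E_ij|)\<close>, and
  Jensen's inequality is therefore proved for holomorphic functions with a majorant of this kind;
  the exponent converges in \<open>L^1\<close> along circles, which suffices for passing to the
  boundary. The product of the \<open>1 + |E_ij|\<close> enters the weights because it bounds every
  entry of the adjugate: the Poisson integral of its logarithm absorbs the growth of the adjugate,
  and the factor \<open>w\<close> absorbs the division by the determinant. Left and right never
  separate. In one direction the products are scalar matrices, in the other only determinants are
  compared, and both are insensitive to the order of the factors. That radial boundary values exist
  rests on a weak-type maximal inequality and on the fact that dilations approximate an
  \<open>H^2\<close> function uniformly over all circles.\<close>

lemma cis_measurable_circle:
  "cis \<in> measurable (uniform_measure lborel {0..<2 * pi}) (restrict_space borel (sphere 0 1))"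
proof -
  have "cis \<in> borel_measurable borel"
    by (intro borel_measurable_continuous_onI continuous_intros)
  then have "cis \<in> borel_measurable (uniform_measure lborel {0..<2 * pi})"
    by (simp cong: measurable_cong_sets)
  then show ?thesis
    by (intro measurable_restrict_space2) auto
qed

interpretation circle: finite_measure circle_measure
  by standard (simp add: space_circle_measure emeasure_circle_measure)

lemma measure_circle_space [simp]: "measure circle_measure (sphere 0 1) = 1"
  by (simp add: measure_def emeasure_circle_measure)

lemma AE_circle_sphere: "AE t in circle_measure. norm t = 1"
  by (rule AE_I2) (simp add: space_circle_measure)

lemma continuous_circle_measurable:
  fixes f :: "complex \<Rightarrow> 'b::topological_space"
  assumes "continuous_on (sphere 0 1) f"
  shows "f \<in> borel_measurable circle_measure"
  using borel_measurable_continuous_on_restrict[OF assms]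
  by (simp cong: measurable_cong_sets add: sets_circle_measure)

lemma bounded_circle_integrable:
  fixes f :: "complex \<Rightarrow> 'b::{banach, second_countable_topology}"
  assumes "f \<in> borel_measurable circle_measure" "\<And>t. norm t = 1 \<Longrightarrow> norm (f t) \<le> B"
  shows "integrable circle_measure f"
  using assms
  by (intro circle.integrable_const_bound[where B=B]) (auto intro!: AE_I2 simp: space_circle_measure)

lemma continuous_circle_integrable:
  fixes f :: "complex \<Rightarrow> 'b::{banach, second_countable_topology}"
  assumes "continuous_on (sphere 0 1) f"
  shows "integrable circle_measure f"
proof -
  have "bounded (f ` sphere 0 1)"
    by (intro compact_imp_bounded compact_continuous_image assms) auto
  then obtain B where "\<And>t. t \<in> sphere 0 1 \<Longrightarrow> norm (f t) \<le> B"
    unfolding bounded_iff by blast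
  then show ?thesis
    by (intro bounded_circle_integrable[where B=B] continuous_circle_measurable assms) auto
qed

lemma uniform_measure_circle_density:
  "uniform_measure lborel {0..<2 * pi} = density lborel (\<lambda>x. ennreal (indicator {0..<2 * pi} x / (2 * pi)))"
  unfolding uniform_measure_def
  by (intro density_cong AE_I2) (auto simp: divide_ennreal[symmetric] split: split_indicator)

lemma integral_circle_measure:
  fixes f :: "complex \<Rightarrow> complex"
  assumes "continuous_on (sphere 0 1) f"
  shows "(LINT t|circle_measure. f t) = integral {0..2*pi} (\<lambda>x. f (cis x)) / (2*pi)"
proof -
  have cis: "cis \<in> measurable lborel (restrict_space borel (sphere 0 1))"
    using cis_measurable_circle by (simp cong: measurable_cong_sets)
  have fm: "f \<in> borel_measurable (restrict_space borel (sphere 0 1))"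
    using continuous_circle_measurable[OF assms]
    by (simp cong: measurable_cong_sets add: sets_circle_measure)
  have fc: "(\<lambda>x. f (cis x)) \<in> borel_measurable lborel"
    using measurable_compose[OF cis fm] by simp
  have cont: "continuous_on {0..2*pi} (\<lambda>x. f (cis x))"
    by (intro continuous_on_compose2[OF assms] continuous_intros) auto
  have si: "set_integrable lborel {0..2*pi} (\<lambda>x. f (cis x))"
    by (intro borel_integrable_compact cont compact_Icc[unfolded atLeastAtMost_def] borel_integrable_atLeastAtMost' )
  have "(LINT t|circle_measure. f t) = (LINT x|uniform_measure lborel {0..<2 * pi}. f (cis x))"
    unfolding circle_measure_def by (rule integral_distr[OF cis_measurable_circle fm])
  also have "\<dots> = (LINT x|lborel. (indicator {0..<2 * pi} x / (2 * pi)) *\<^sub>R f (cis x))"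
    unfolding uniform_measure_circle_density by (rule integral_density[OF fc]) auto
  \<comment> \<open>The half-open interval parametrizes the circle once, the closed one is the
    domain of the Henstock-Kurzweil integral; they differ in the null set
    \<open>{2 * pi}\<close>.\<close>
  also have "\<dots> = (LINT x|lborel. (1 / (2 * pi)) *\<^sub>R (indicator {0..2 * pi} x *\<^sub>R f (cis x)))"
  proof (rule integral_cong_AE)
    show "AE x in lborel. (indicator {0..<2 * pi} x / (2 * pi)) *\<^sub>R f (cis x) =
        (1 / (2 * pi)) *\<^sub>R (indicator {0..2 * pi} x *\<^sub>R f (cis x))"
      using AE_lborel_singleton[of "2*pi"]
      by eventually_elim (auto split: split_indicator)
  qed (use fc in measurable)
  also have "\<dots> = (1 / (2 * pi)) *\<^sub>R (LINT x:{0..2*pi}|lborel. f (cis x))"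
    by (simp only: set_lebesgue_integral_def integral_scaleR_right)
  also have "(LINT x:{0..2*pi}|lborel. f (cis x)) = integral {0..2*pi} (\<lambda>x. f (cis x))"
    by (rule set_borel_integral_eq_integral(2)[OF si])
  finally show ?thesis by (simp add: scaleR_conv_of_real)
qed

text \<open>For \<open>n \<noteq> 0\<close> the antiderivative \<open>cis (n x) / (i n)\<close> has
  period \<open>2 * pi\<close>. This orthogonality yields the total mass of the Poisson kernel and
  Parseval's identity.\<close>

lemma circle_integral_powi:
  "(LINT t|circle_measure. t powi n) = (if n = 0 then 1 else 0)"
proof (cases "n = 0")
  case True
  then show ?thesis by (simp add: space_circle_measure)
next
  case False
  have "(LINT t|circle_measure. t powi n) = integral {0..2*pi} (\<lambda>x. cis x powi n) / (2*pi)"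
    by (intro integral_circle_measure continuous_intros) auto
  also have "((\<lambda>x. cis (of_int n * x)) has_integral
      cis (of_int n * (2*pi)) / (\<i> * of_int n) - cis (of_int n * 0) / (\<i> * of_int n)) {0..2*pi}"
  proof (rule fundamental_theorem_of_calculus)
    fix x :: real
    have "((\<lambda>z. exp (\<i> * of_int n * z) / (\<i> * of_int n)) has_field_derivative exp (\<i> * of_int n * of_real x))
        (at (of_real x))"
      using False by (auto intro!: derivative_eq_intros)
    then have "((\<lambda>x. exp (\<i> * of_int n * of_real x) / (\<i> * of_int n)) has_vector_derivative
        exp (\<i> * of_int n * of_real x)) (at x within {0..2*pi})"
      by (rule has_vector_derivative_real_field)
    then show "((\<lambda>x. cis (of_int n * x) / (\<i> * of_int n)) has_vector_derivative cis (of_int n * x))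
        (at x within {0..2*pi})"
      by (simp add: cis_conv_exp mult.assoc)
  qed simp
  then have "integral {0..2*pi} (\<lambda>x. cis x powi n) = 0"
    using cis_multiple_2pi[of "of_int n"] by (simp add: cis_power_int integral_unique mult_ac)
  finally show ?thesis using False by simp
qed

text \<open>Jordan's inequality, read off from the chord of the concave sine over
  \<open>[0, pi / 2]\<close> and reflected about \<open>pi / 2\<close>. It converts chord length
  into arc length in \<open>circle_measure_arc\<close>.\<close>

lemma abs_sin_lower:
  fixes y :: real
  assumes "\<bar>y\<bar> \<le> pi"
  shows "2 / pi * min \<bar>y\<bar> (pi - \<bar>y\<bar>) \<le> \<bar>sin y\<bar>"
proof -
  have jordan: "2 / pi * x \<le> sin x" if "0 \<le> x" "x \<le> pi / 2" for x :: real
  proof -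
    have "concave_on {0..pi} sin"
      by (rule f''_le0_imp_concave[where f'=cos and f''="\<lambda>x. - sin x"])
         (auto intro!: derivative_eq_intros sin_ge_zero)
    then have "sin ((1 - 2 / pi * x) *\<^sub>R 0 + (2 / pi * x) *\<^sub>R (pi / 2)) \<ge>
        (1 - 2 / pi * x) * sin 0 + (2 / pi * x) * sin (pi / 2)"
      using that by (intro concave_onD) (auto simp: field_simps)
    then show ?thesis by simp
  qed
  show ?thesis
  proof (cases "\<bar>y\<bar> \<le> pi / 2")
    case True
    then show ?thesis using jordan[of "\<bar>y\<bar>"] by (auto simp: min_def abs_if split: if_splits)
  next
    case False
    then show ?thesis using jordan[of "pi - \<bar>y\<bar>"] assms by (auto simp: min_def abs_if split: if_splits)
  qed
qed

lemma circle_measure_arc: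
  assumes "norm t = 1" "\<rho> > 0"
  shows "measure circle_measure (sphere 0 1 \<inter> ball t \<rho>) \<le> 2 * \<rho>"
proof -
  obtain \<alpha> where \<alpha>: "0 \<le> \<alpha>" "\<alpha> < 2 * pi" "t = cis \<alpha>"
    using Arg2pi[of t] assms(1) by (metis Arg2pi_eq is_Arg_def mult_1 of_real_1 cis_conv_exp) 
  \<comment> \<open>A chord shorter than \<open>\<rho>\<close> subtends an angle below
    \<open>c\<close>: its length is \<open>2 * |sin y|\<close> with \<open>y\<close> half the angle,
    and Jordan's inequality applies. Angles count modulo \<open>2 * pi\<close>, hence the three
    intervals of \<open>?U\<close>; their total length \<open>6 * c\<close> gives normalized measure
    at most \<open>3 / 2 * \<rho>\<close>.\<close>
  define c where "c = pi * \<rho> / 2"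
  have "c > 0" using assms by (simp add: c_def)
  let ?B = "sphere 0 1 \<inter> ball t \<rho>"
  let ?U = "{\<alpha> - c .. \<alpha> + c} \<union> {\<alpha> + 2 * pi - c .. \<alpha> + 2 * pi + c} \<union> {\<alpha> - 2 * pi - c .. \<alpha> - 2 * pi + c}"
  have sub: "cis -` ?B \<inter> {0..<2*pi} \<subseteq> ?U"
  proof
    fix x assume x: "x \<in> cis -` ?B \<inter> {0..<2*pi}"
    define y where "y = (x - \<alpha>) / 2"
    have "\<bar>y\<bar> \<le> pi" using x \<alpha> by (auto simp: y_def)
    have "cmod (cis \<alpha> - cis x) = 2 * \<bar>sin y\<bar>"
    proof -
      have "cis \<alpha> - cis x = - cis \<alpha> * (exp (\<i> * of_real (x - \<alpha>)) - 1)"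
        by (simp only: cis_conv_exp[symmetric]) (simp add: right_diff_distrib cis_mult)
      then show ?thesis using dist_exp_i_1[of "x - \<alpha>"] by (simp add: norm_mult y_def)
    qed
    then have "\<bar>sin y\<bar> < \<rho> / 2" using x \<alpha> by (simp add: dist_norm)
    then have "2 / pi * min \<bar>y\<bar> (pi - \<bar>y\<bar>) < \<rho> / 2" using abs_sin_lower[OF \<open>\<bar>y\<bar> \<le> pi\<close>] by simp
    then have "2 * min \<bar>y\<bar> (pi - \<bar>y\<bar>) < c" by (simp add: c_def field_simps)
    moreover have "x = \<alpha> + 2 * y" by (simp add: y_def field_simps)
    ultimately show "x \<in> ?U"
      using \<open>\<bar>y\<bar> \<le> pi\<close> unfolding Un_iff atLeastAtMost_iff min_def abs_if by (smt (verit))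
  qed
  have s: "?B \<in> sets (restrict_space borel (sphere 0 1))"
    by (simp add: sets_restrict_space_iff)
  have "emeasure circle_measure ?B = emeasure (uniform_measure lborel {0..<2*pi}) (cis -` ?B)"
    unfolding circle_measure_def by (subst emeasure_distr[OF cis_measurable_circle s]) simp
  also have "\<dots> = emeasure lborel ({0..<2*pi} \<inter> cis -` ?B) / emeasure lborel {0..<2*pi}"
    using measurable_sets[OF cis_measurable_circle s] by (intro emeasure_uniform_measure) auto
  also have "emeasure lborel ({0..<2*pi} \<inter> cis -` ?B) \<le> emeasure lborel ?U"
    using sub by (intro emeasure_mono) auto
  also have "emeasure lborel ?U \<le> ennreal (2*c) + ennreal (2*c) + ennreal (2*c)"
    using \<open>c > 0\<close> by (intro order_trans[OF emeasure_subadditive] add_mono) auto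
  finally have "emeasure circle_measure ?B \<le> ennreal (6 * c) / ennreal (2*pi)"
    using \<open>c > 0\<close> by (simp add: divide_right_mono_ennreal flip: ennreal_plus)
  also have "\<dots> = ennreal (3 / 2 * \<rho>)"
    using \<open>c > 0\<close> by (simp add: divide_ennreal) (simp add: c_def)
  finally have "measure circle_measure ?B \<le> 3 / 2 * \<rho>"
    using assms by (simp add: circle.emeasure_eq_measure)
  then show ?thesis using assms by simp
qed

section \<open>Herglotz and Poisson integrals\<close>

text \<open>Domination by \<open>norm (c n) * norm (u t)\<close> permits exchanging sum and
  integral. In the applications the factors \<open>e n\<close> are powers of \<open>t\<close> with
  positive or negative exponent.\<close>

lemma circle_integral_series:
  fixes c :: "nat \<Rightarrow> complex" and e :: "nat \<Rightarrow> complex \<Rightarrow> complex"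
  assumes u: "integrable circle_measure u" and e: "\<And>n. e n \<in> borel_measurable circle_measure"
    and e1: "\<And>n t. norm t = 1 \<Longrightarrow> norm (e n t) \<le> 1" and c: "summable (\<lambda>n. norm (c n))"
  shows "(\<lambda>n. c n * (LINT t|circle_measure. e n t * u t)) sums
    (LINT t|circle_measure. (\<Sum>n. c n * e n t) * u t)"
proof -
  have u': "u \<in> borel_measurable circle_measure"
    using u by auto
  have bnd: "norm (c n * (e n t * u t)) \<le> norm (c n) * norm (u t)" if "norm t = 1" for n t
    using e1[OF that, of n] by (auto simp: norm_mult intro!: mult_left_mono mult_left_le_one_le)
  have int: "integrable circle_measure (\<lambda>t. c n * (e n t * u t))" for n
  proof (rule Bochner_Integration.integrable_bound)
    show "integrable circle_measure (\<lambda>t. norm (c n) * norm (u t))"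
      using u by auto
    show "AE t in circle_measure. norm (c n * (e n t * u t)) \<le> norm (norm (c n) * norm (u t))"
      using AE_circle_sphere by eventually_elim (use bnd in auto)
  qed (use e u' in measurable)
  have s1: "AE t in circle_measure. summable (\<lambda>n. norm (c n * (e n t * u t)))"
    using AE_circle_sphere
  proof eventually_elim
    case (elim t)
    show ?case
      by (rule summable_comparison_test'[of "\<lambda>n. norm (c n) * norm (u t)" 0])
         (use bnd[OF elim] c in \<open>auto intro: summable_mult2\<close>)
  qed
  have s2: "summable (\<lambda>n. LINT t|circle_measure. norm (c n * (e n t * u t)))"
  proof (rule summable_comparison_test'[of "\<lambda>n. norm (c n) * (LINT t|circle_measure. norm (u t))" 0])
    fix n
    have "(LINT t|circle_measure. norm (c n * (e n t * u t))) \<le> (LINT t|circle_measure. norm (c n) * norm (u t))"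
      using bnd u by (intro integral_mono_AE integrable_norm int eventually_mono[OF AE_circle_sphere]) auto
    then show "norm (LINT t|circle_measure. norm (c n * (e n t * u t))) \<le> norm (c n) * (LINT t|circle_measure. norm (u t))"
      by (simp add: Bochner_Integration.integral_nonneg)
  qed (use c in \<open>auto intro: summable_mult2\<close>)
  have eq: "(LINT t|circle_measure. (\<Sum>n. c n * (e n t * u t))) = (LINT t|circle_measure. (\<Sum>n. c n * e n t) * u t)"
  proof (rule Bochner_Integration.integral_cong[OF refl])
    fix t assume "t \<in> space circle_measure"
    then have "norm t = 1" by (simp add: space_circle_measure)
    have "summable (\<lambda>n. norm (c n * e n t))"
      by (rule summable_comparison_test'[OF c, of 0])
         (use e1[OF \<open>norm t = 1\<close>] in \<open>auto simp: norm_mult intro!: mult_left_le\<close>)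
    then have "summable (\<lambda>n. c n * e n t)" by (rule summable_norm_cancel)
    from suminf_mult2[OF this, of "u t"]
    show "(\<Sum>n. c n * (e n t * u t)) = (\<Sum>n. c n * e n t) * u t"
      by (simp add: mult.assoc)
  qed
  have "(\<lambda>n. LINT t|circle_measure. c n * (e n t * u t)) sums (LINT t|circle_measure. (\<Sum>n. c n * (e n t * u t)))"
    by (rule sums_integral[OF int s1 s2])
  then show ?thesis unfolding eq by simp
qed

text \<open>The kernel is that of \<open>scalar_outer\<close>, so
  \<open>exp (herglotz (\<lambda>t. ln (w t)) z)\<close> is the outer function with weight
  \<open>w\<close>, and its modulus is the exponential of a Poisson integral.\<close>

definition herglotz :: "(complex \<Rightarrow> real) \<Rightarrow> complex \<Rightarrow> complex" where
  "herglotz u z = (LINT t|circle_measure. (t + z) / (t - z) * of_real (u t))"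

definition poisson_kernel :: "complex \<Rightarrow> complex \<Rightarrow> real" where
  "poisson_kernel z t = Re ((t + z) / (t - z))"

definition poisson :: "(complex \<Rightarrow> real) \<Rightarrow> complex \<Rightarrow> real" where
  "poisson u z = (LINT t|circle_measure. poisson_kernel z t * u t)"

text \<open>The kernel is \<open>2 / (1 - z / t) - 1\<close>, a geometric series; the subtracted 1
  is why the coefficient at \<open>n = 0\<close> is 1 and not 2.\<close>

lemma herglotz_kernel_sums:
  fixes z t :: complex
  assumes "norm z < 1" "norm t = 1"
  shows "(\<lambda>n. (if n = 0 then 1 else 2 * z ^ n) * t powi (- int n)) sums ((t + z) / (t - z))"
proof -
  have [simp]: "t \<noteq> 0" "t - z \<noteq> 0" using assms by auto
  have "norm (z / t) < 1" using assms by (simp add: norm_divide)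
  then have "(\<lambda>n. (z / t) ^ n) sums (1 / (1 - z / t))" by (rule geometric_sums)
  then have "(\<lambda>n. 2 * (z / t) ^ n - (if n = 0 then 1 else 0)) sums (2 * (1 / (1 - z / t)) - 1)"
    by (intro sums_diff sums_mult) (use sums_single[of 0 "\<lambda>_. 1::complex"] in simp_all)
  moreover have "2 * (1 / (1 - z / t)) - 1 = (t + z) / (t - z)"
  proof -
    have "1 - z / t = (t - z) / t" by (simp add: diff_divide_distrib)
    moreover have "t \<noteq> z" using \<open>t - z \<noteq> 0\<close> by auto
    ultimately show ?thesis by (simp add: divide_simps)
  qed
  moreover have "2 * (z / t) ^ n - (if n = 0 then 1 else 0) = (if n = 0 then 1 else 2 * z ^ n) * t powi (- int n)" for n
    by (simp add: power_int_minus power_divide field_simps)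
  ultimately show ?thesis by simp
qed

lemma powi_circle_measurable: "(\<lambda>t. t powi n) \<in> borel_measurable circle_measure"
  by (rule continuous_circle_measurable) (intro continuous_intros; auto)

text \<open>Termwise integration exhibits \<open>herglotz u\<close> as a power series in
  \<open>z\<close>, so that holomorphy follows without differentiating under the integral.\<close>

lemma herglotz_sums:
  assumes u: "integrable circle_measure u" and z: "norm z < 1"
  shows "(\<lambda>n. (if n = 0 then 1 else 2) * (LINT t|circle_measure. t powi (- int n) * of_real (u t)) * z ^ n)
    sums herglotz u z"
proof -
  let ?c = "\<lambda>n. if n = 0 then 1 else 2 * z ^ n"
  have "summable (\<lambda>n. norm z ^ n)" using z by (intro summable_geometric) auto
  then have "summable (\<lambda>n. 2 * norm z ^ n)" by (rule summable_mult)
  then have "summable (\<lambda>n. norm (?c n))"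
    by (rule summable_comparison_test'[where N=0]) (auto simp: norm_mult norm_power)
  moreover have "integrable circle_measure (\<lambda>t. of_real (u t) :: complex)" using u by simp
  ultimately have "(\<lambda>n. ?c n * (LINT t|circle_measure. t powi (- int n) * of_real (u t))) sums
    (LINT t|circle_measure. (\<Sum>n. ?c n * t powi (- int n)) * of_real (u t))"
    by (intro circle_integral_series powi_circle_measurable) (auto simp: norm_power_int)
  moreover have "(LINT t|circle_measure. (\<Sum>n. ?c n * t powi (- int n)) * of_real (u t)) = herglotz u z"
    unfolding herglotz_def
    by (intro Bochner_Integration.integral_cong refl arg_cong2[where f="(*)"] sums_unique[symmetric] herglotz_kernel_sums z)
       (auto simp: space_circle_measure)
  ultimately show ?thesis by (simp add: if_distrib if_distribR mult_ac cong: if_cong)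
qed

lemma herglotz_holomorphic:
  assumes "integrable circle_measure u"
  shows "herglotz u holomorphic_on ball 0 1"
  by (rule power_series_holomorphic) (use herglotz_sums[OF assms] in simp)

text \<open>By orthogonality only the constant term survives. The real part says that the Poisson
  kernel has total mass one.\<close>

lemma herglotz_one:
  assumes "norm z < 1"
  shows "herglotz (\<lambda>_. 1) z = 1"
proof -
  have "(\<lambda>n. (if n = 0 then 1 else 2) * (LINT t|circle_measure. t powi (- int n) * of_real 1) * z ^ n)
      sums herglotz (\<lambda>_. 1) z"
    by (rule herglotz_sums) (use assms in simp_all)
  moreover have "(\<lambda>n. (if n = 0 then 1 else 2) * (LINT t|circle_measure. t powi (- int n) * of_real 1) * z ^ n) =
      (\<lambda>n. if n = 0 then 1 else 0)"
    by (auto simp: circle_integral_powi)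
  ultimately show ?thesis
    using sums_unique2 sums_single[of 0 "\<lambda>_. 1::complex"] by fastforce
qed

lemma herglotz_kernel_continuous:
  fixes z :: complex
  assumes "norm z < 1"
  shows "continuous_on (sphere 0 1) (\<lambda>t. (t + z) / (t - z))"
  using assms by (intro continuous_intros) auto

lemma herglotz_kernel_bound:
  fixes z t :: complex
  assumes "norm z < 1" "norm t = 1"
  shows "norm ((t + z) / (t - z)) \<le> 2 / (1 - norm z)"
proof -
  have "norm (t + z) \<le> 2" using norm_triangle_ineq[of t z] assms by simp
  moreover have "1 - norm z \<le> norm (t - z)" using norm_triangle_ineq2[of t z] assms by simp
  ultimately show ?thesis using assms by (auto simp: norm_divide intro!: frac_le)
qed

lemma poisson_kernel_bound:
  fixes z t :: complex
  assumes "norm z < 1" "norm t = 1"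
  shows "\<bar>poisson_kernel z t\<bar> \<le> 2 / (1 - norm z)"
  using herglotz_kernel_bound[OF assms] abs_Re_le_cmod[of "(t + z) / (t - z)"]
  unfolding poisson_kernel_def by linarith

lemma poisson_kernel_eq:
  fixes z t :: complex
  assumes "norm z < 1" "norm t = 1"
  shows "poisson_kernel z t = (1 - (norm z)\<^sup>2) / (norm (t - z))\<^sup>2"
proof -
  have t: "(Re t)\<^sup>2 + (Im t)\<^sup>2 = 1" using assms(2) by (simp add: cmod_power2[symmetric])
  have "Re (t + z) * Re (t - z) + Im (t + z) * Im (t - z) = 1 - ((Re z)\<^sup>2 + (Im z)\<^sup>2)"
    using t by (simp add: power2_eq_square algebra_simps)
  then show ?thesis
    by (simp add: poisson_kernel_def Re_divide cmod_power2 add_divide_distrib[symmetric])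
qed

lemma poisson_kernel_nonneg:
  fixes z t :: complex
  assumes "norm z < 1" "norm t = 1"
  shows "0 \<le> poisson_kernel z t"
  using assms by (simp add: poisson_kernel_eq power_le_one)

lemma herglotz_integrand_integrable:
  assumes "integrable circle_measure u" "norm z < 1"
  shows "integrable circle_measure (\<lambda>t. (t + z) / (t - z) * of_real (u t))"
proof (rule Bochner_Integration.integrable_bound)
  show "integrable circle_measure (\<lambda>t. 2 / (1 - norm z) * norm (u t))"
    using assms by auto
  have "u \<in> borel_measurable circle_measure" using assms by auto
  then show "(\<lambda>t. (t + z) / (t - z) * of_real (u t)) \<in> borel_measurable circle_measure"
    using continuous_circle_measurable[OF herglotz_kernel_continuous[OF assms(2)]] by measurable
  show "AE t in circle_measure. norm ((t + z) / (t - z) * of_real (u t)) \<le> norm (2 / (1 - norm z) * norm (u t))"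
    using AE_circle_sphere
  proof eventually_elim
    case (elim t)
    show ?case using mult_right_mono[OF herglotz_kernel_bound[OF assms(2) elim], of "norm (u t)"] assms
      by (simp add: norm_mult del: times_divide_eq_left)
  qed
qed

lemma poisson_integrable:
  assumes "integrable circle_measure u" "norm z < 1"
  shows "integrable circle_measure (\<lambda>t. poisson_kernel z t * u t)"
  using integrable_Re[OF herglotz_integrand_integrable[OF assms]]
  by (simp add: poisson_kernel_def del: times_divide_eq_left)

lemma Re_herglotz:
  assumes "integrable circle_measure u" "norm z < 1"
  shows "Re (herglotz u z) = poisson u z"
  using integral_Re[OF herglotz_integrand_integrable[OF assms]]
  by (simp add: herglotz_def poisson_def poisson_kernel_def del: times_divide_eq_left)

lemma poisson_const:
  assumes "norm z < 1"
  shows "poisson (\<lambda>_. c) z = c"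
proof -
  have "poisson (\<lambda>_. 1) z = 1"
    using Re_herglotz[of "\<lambda>_. 1" z] herglotz_one[OF assms] assms by simp
  then show ?thesis by (simp add: poisson_def)
qed

lemma poisson_zero: "poisson u 0 = (LINT t|circle_measure. u t)"
  unfolding poisson_def by (intro Bochner_Integration.integral_cong) (auto simp: space_circle_measure poisson_kernel_def)

lemma herglotz_zero: "herglotz u 0 = of_real (LINT t|circle_measure. u t)"
  unfolding herglotz_def integral_complex_of_real[symmetric]
  by (intro Bochner_Integration.integral_cong) (auto simp: space_circle_measure)

lemma poisson_add:
  assumes "integrable circle_measure u" "integrable circle_measure v" "norm z < 1"
  shows "poisson (\<lambda>t. u t + v t) z = poisson u z + poisson v z"
  using poisson_integrable[OF assms(1,3)] poisson_integrable[OF assms(2,3)]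
  by (simp add: poisson_def distrib_left)

lemma poisson_diff:
  assumes "integrable circle_measure u" "integrable circle_measure v" "norm z < 1"
  shows "poisson (\<lambda>t. u t - v t) z = poisson u z - poisson v z"
  using poisson_integrable[OF assms(1,3)] poisson_integrable[OF assms(2,3)]
  by (simp add: poisson_def right_diff_distrib)

lemma poisson_mono:
  assumes "integrable circle_measure u" "integrable circle_measure v" "norm z < 1"
    "AE t in circle_measure. u t \<le> v t"
  shows "poisson u z \<le> poisson v z"
  unfolding poisson_def
proof (intro integral_mono_AE poisson_integrable assms(1-3))
  show "AE t in circle_measure. poisson_kernel z t * u t \<le> poisson_kernel z t * v t"
    using AE_circle_sphere assms(4)
    by eventually_elim (use assms(3) in \<open>auto intro!: mult_left_mono poisson_kernel_nonneg\<close>)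
qed

lemma poisson_nonneg:
  assumes "integrable circle_measure u" "norm z < 1" "AE t in circle_measure. 0 \<le> u t"
  shows "0 \<le> poisson u z"
  using poisson_mono[of "\<lambda>_. 0" u z] assms by (simp add: poisson_const)

text \<open>The Poisson kernel is an approximate identity: nonnegative, of mass one, and of size
  \<open>1 - r\<close> away from \<open>t\<close>. Uniformity in \<open>t\<close> is what the
  maximum principle below asks for.\<close>

lemma poisson_approx:
  assumes u: "continuous_on (sphere 0 1) u" and "\<epsilon> > 0"
  obtains R where "0 \<le> R" "R < 1"
    "\<And>r (t :: complex). R \<le> r \<Longrightarrow> r < 1 \<Longrightarrow> norm t = 1 \<Longrightarrow> \<bar>poisson u (of_real r * t) - u t\<bar> \<le> \<epsilon>"
proof -
  have "uniformly_continuous_on (sphere 0 1) u"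
    by (rule compact_uniformly_continuous[OF u]) auto
  then obtain \<delta> where "\<delta> > 0" and \<delta>: "\<And>t \<tau>. norm t = 1 \<Longrightarrow> norm \<tau> = 1 \<Longrightarrow> dist \<tau> t < \<delta> \<Longrightarrow> dist (u \<tau>) (u t) < \<epsilon> / 2"
    unfolding uniformly_continuous_on_def using \<open>\<epsilon> > 0\<close> by (metis half_gt_zero mem_sphere_0)
  have "bounded (u ` sphere 0 1)"
    by (intro compact_imp_bounded compact_continuous_image u) auto
  then obtain M where "M > 0" and M: "\<And>t. norm t = 1 \<Longrightarrow> \<bar>u t\<bar> \<le> M"
    unfolding bounded_pos by (auto simp: image_iff)
  \<comment> \<open>The bound 1/2 makes the radius positive. The bound \<open>\<delta> / 2\<close>
    keeps \<open>r t\<close> at distance at least \<open>\<delta> / 2\<close> from every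
    \<open>\<tau>\<close> outside the \<open>\<delta>\<close>-ball of \<open>t\<close>; there the
    kernel is at most \<open>2 * (1 - r) / (\<delta> / 2)^2\<close> and \<open>u\<close> varies by
    at most \<open>2 * M\<close>, which the third bound makes at most
    \<open>\<epsilon> / 2\<close>.\<close>
  define \<eta> where "\<eta> = min (min (1/2) (\<delta> / 2)) (\<epsilon> * \<delta>\<^sup>2 / (32 * M))"
  have "\<eta> > 0" using \<open>\<delta> > 0\<close> \<open>\<epsilon> > 0\<close> \<open>M > 0\<close> by (simp add: \<eta>_def)
  show thesis
  proof (rule that[of "1 - \<eta>"])
    fix r and t :: complex assume r: "1 - \<eta> \<le> r" "r < 1" and t: "norm t = 1"
    let ?z = "of_real r * t :: complex"
    have "1 - r \<le> \<epsilon> * \<delta>\<^sup>2 / (32 * M)" using r by (simp add: \<eta>_def)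
    then have r0: "0 \<le> r" "1 - r \<le> \<delta> / 2" "16 * M * (1 - r) / \<delta>\<^sup>2 \<le> \<epsilon> / 2"
      using r \<open>M > 0\<close> \<open>\<delta> > 0\<close> by (auto simp: \<eta>_def field_simps)
    have z: "norm ?z < 1" using r r0 t by (simp add: norm_mult)
    have ui: "integrable circle_measure u" by (rule continuous_circle_integrable[OF u])
    have di: "integrable circle_measure (\<lambda>\<tau>. u \<tau> - u t)" using ui by auto
    have bnd: "\<bar>poisson_kernel ?z \<tau> * (u \<tau> - u t)\<bar> \<le> poisson_kernel ?z \<tau> * (\<epsilon> / 2) + 16 * M * (1 - r) / \<delta>\<^sup>2"
      if \<tau>: "norm \<tau> = 1" for \<tau>
    proof (cases "dist \<tau> t < \<delta>")
      case True
      have "\<bar>poisson_kernel ?z \<tau> * (u \<tau> - u t)\<bar> = poisson_kernel ?z \<tau> * \<bar>u \<tau> - u t\<bar>"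
        using poisson_kernel_nonneg[OF z \<tau>] by (simp add: abs_mult)
      also have "\<dots> \<le> poisson_kernel ?z \<tau> * (\<epsilon> / 2)"
        using \<delta>[OF t \<tau> True] poisson_kernel_nonneg[OF z \<tau>] by (intro mult_left_mono) (auto simp: dist_real_def)
      finally show ?thesis using \<open>M > 0\<close> r by (smt (verit) divide_nonneg_nonneg mult_nonneg_nonneg zero_le_power2)
    next
      case False
      have "norm (\<tau> - t) \<le> norm (\<tau> - ?z) + norm (?z - t)"
        using norm_triangle_ineq[of "\<tau> - ?z" "?z - t"] by simp
      also have "norm (?z - t) = 1 - r"
      proof -
        have "?z - t = of_real (r - 1) * t" by (simp add: algebra_simps)
        then show ?thesis using t r by (simp only: norm_mult norm_of_real) simp
      qed
      finally have "\<delta> / 2 \<le> norm (\<tau> - ?z)" using False r0 by (simp add: dist_norm)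
      then have "(\<delta> / 2)\<^sup>2 \<le> (norm (\<tau> - ?z))\<^sup>2" using \<open>\<delta> > 0\<close> by (intro power_mono) auto
      moreover have "1 - (norm ?z)\<^sup>2 \<le> 2 * (1 - r)" "0 \<le> 1 - (norm ?z)\<^sup>2"
      proof -
        have "norm ?z = r" using t r0 by (simp add: norm_mult)
        moreover have "1 - r\<^sup>2 = (1 + r) * (1 - r)" by (simp add: power2_eq_square algebra_simps)
        moreover have "(1 + r) * (1 - r) \<le> 2 * (1 - r)" "0 \<le> (1 + r) * (1 - r)"
          using r r0 mult_right_mono[of "1 + r" 2 "1 - r"] by auto
        ultimately show "1 - (norm ?z)\<^sup>2 \<le> 2 * (1 - r)" "0 \<le> 1 - (norm ?z)\<^sup>2" by simp_all
      qed
      ultimately have "poisson_kernel ?z \<tau> \<le> 2 * (1 - r) / (\<delta> / 2)\<^sup>2"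
        unfolding poisson_kernel_eq[OF z \<tau>] using \<open>\<delta> > 0\<close> r by (intro frac_le) auto
      moreover have "\<bar>u \<tau> - u t\<bar> \<le> 2 * M" using M[OF t] M[OF \<tau>] by linarith
      ultimately have "poisson_kernel ?z \<tau> * \<bar>u \<tau> - u t\<bar> \<le> 2 * (1 - r) / (\<delta> / 2)\<^sup>2 * (2 * M)"
        using poisson_kernel_nonneg[OF z \<tau>] \<open>\<delta> > 0\<close> r by (intro mult_mono) auto
      also have "\<dots> = 16 * M * (1 - r) / \<delta>\<^sup>2" by (simp add: power_divide)
      also have "\<dots> \<le> poisson_kernel ?z \<tau> * (\<epsilon> / 2) + 16 * M * (1 - r) / \<delta>\<^sup>2"
        using poisson_kernel_nonneg[OF z \<tau>] \<open>\<epsilon> > 0\<close> by simp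
      finally show ?thesis using poisson_kernel_nonneg[OF z \<tau>] by (simp add: abs_mult)
    qed
    have "poisson u ?z - u t = (LINT \<tau>|circle_measure. poisson_kernel ?z \<tau> * (u \<tau> - u t))"
      using poisson_diff[OF ui, of "\<lambda>_. u t" ?z] poisson_const[OF z] z by (simp add: poisson_def)
    also have "\<bar>\<dots>\<bar> \<le> (LINT \<tau>|circle_measure. \<bar>poisson_kernel ?z \<tau> * (u \<tau> - u t)\<bar>)"
      by (rule integral_abs_bound)
    also have "\<dots> \<le> (LINT \<tau>|circle_measure. poisson_kernel ?z \<tau> * (\<epsilon> / 2) + 16 * M * (1 - r) / \<delta>\<^sup>2)"
      using poisson_integrable[OF di z] poisson_integrable[OF _ z, of "\<lambda>_. \<epsilon> / 2"]
      by (intro integral_mono_AE eventually_mono[OF AE_circle_sphere bnd]) auto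
    also have "\<dots> = poisson (\<lambda>_. \<epsilon> / 2) ?z + 16 * M * (1 - r) / \<delta>\<^sup>2"
      using poisson_integrable[OF _ z, of "\<lambda>_. \<epsilon> / 2"] by (subst Bochner_Integration.integral_add) (auto simp: poisson_def space_circle_measure)
    also have "\<dots> \<le> \<epsilon>" using r0 poisson_const[OF z] by simp
    finally show "\<bar>poisson u ?z - u t\<bar> \<le> \<epsilon>" .
  qed (use \<open>\<eta> > 0\<close> in \<open>auto simp: \<eta>_def\<close>)
qed

section \<open>Maximum principle against a Poisson majorant\<close>

text \<open>
  The maximum principle is applied to \<open>f exp (- herglotz u (s z))\<close>, which is continuous up to the
  circle for \<open>s < 1\<close>; this replaces Jensen's formula and needs no information on the zeros of \<open>f\<close>.
\<close>
lemma norm_le_exp_poisson: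
  assumes hol: "f holomorphic_on ball 0 1" and cont: "continuous_on (cball 0 1) f"
    and u: "continuous_on (sphere 0 1) u" and le: "\<And>t. norm t = 1 \<Longrightarrow> norm (f t) \<le> exp (u t)"
    and z: "norm z < 1"
  shows "norm (f z) \<le> exp (poisson u z)"
proof -
  have ui: "integrable circle_measure u" by (rule continuous_circle_integrable[OF u])
  have hh: "herglotz u holomorphic_on ball 0 1" by (rule herglotz_holomorphic[OF ui])
  then have hc: "continuous_on (ball 0 1) (herglotz u)" by (rule holomorphic_on_imp_continuous_on)
  \<comment> \<open>The slack \<open>\<epsilon>\<close> pays for replacing \<open>u t\<close> by its
    Poisson integral at \<open>s t\<close> on the circle. It is removed only after \<open>s\<close>
    has tended to 1.\<close>
  have main: "norm (f z) \<le> exp (\<epsilon> + poisson u z)" if "\<epsilon> > 0" for \<epsilon>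
  proof -
    obtain R where R: "0 \<le> R" "R < 1"
      "\<And>r t. R \<le> r \<Longrightarrow> r < 1 \<Longrightarrow> norm t = 1 \<Longrightarrow> \<bar>poisson u (of_real r * t) - u t\<bar> \<le> \<epsilon>"
      using poisson_approx[OF u \<open>\<epsilon> > 0\<close>] by blast
    have step: "norm (f z) \<le> exp (\<epsilon> + poisson u (of_real s * z))" if s: "R \<le> s" "s < 1" for s
    proof -
      define g where "g = (\<lambda>w. f w * exp (- herglotz u (of_real s * w)))"
      have sub: "(\<lambda>w. of_real s * w) ` cball 0 1 \<subseteq> ball (0::complex) 1"
      proof (clarsimp simp: image_subset_iff simp del: norm_mult)
        fix w :: complex assume "norm w \<le> 1"
        then have "norm (of_real s * w) \<le> s * 1"
          unfolding norm_mult norm_of_real using s R by (intro mult_mono) auto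
        then show "norm (of_real s * w) < 1" using s by simp
      qed
      have "norm (g z) \<le> exp \<epsilon>"
      proof (rule maximum_modulus_frontier[where S="cball 0 1" and f=g and \<xi>=z])
        show "g holomorphic_on interior (cball 0 1)"
          unfolding g_def interior_cball using sub
          by (intro holomorphic_intros hol holomorphic_on_compose_gen[OF _ hh, unfolded o_def])
             (auto simp: image_subset_iff simp del: norm_mult)
        show "continuous_on (closure (cball 0 1)) g"
          unfolding g_def closure_closed[OF closed_cball] using sub
          by (intro continuous_intros cont continuous_on_compose2[OF hc]) auto
        fix t :: complex assume "t \<in> frontier (cball 0 1)"
        then have t: "norm t = 1" by simp
        have st: "norm (of_real s * t) < 1" using t s R by (simp add: norm_mult)
        have "norm (g t) = norm (f t) * exp (- poisson u (of_real s * t))"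
          by (simp add: g_def norm_mult Re_herglotz[OF ui st])
        also have "\<dots> \<le> exp (u t) * exp (- poisson u (of_real s * t))"
          by (intro mult_right_mono le t) auto
        also have "\<dots> \<le> exp \<epsilon>" using R(3)[OF s t] by (simp flip: exp_add)
        finally show "norm (g t) \<le> exp \<epsilon>" .
      qed (use z in auto)
      moreover have sz: "norm (of_real s * z) < 1" using z s R sub by (auto simp: image_subset_iff)
      have "norm (f z) = norm (g z) * exp (poisson u (of_real s * z))"
        by (simp add: g_def norm_mult Re_herglotz[OF ui sz] flip: exp_add)
      ultimately show "norm (f z) \<le> exp (\<epsilon> + poisson u (of_real s * z))"
        by (simp add: exp_add)
    qed
    have "isCont (herglotz u) z"
      using hc z by (auto simp: continuous_on_eq_continuous_at)
    moreover have "((\<lambda>s. of_real s * z) \<longlongrightarrow> of_real 1 * z) (at_left (1::real))"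
      by (intro tendsto_intros)
    ultimately have "((\<lambda>s. herglotz u (of_real s * z)) \<longlongrightarrow> herglotz u z) (at_left 1)"
      by (intro isCont_tendsto_compose[of z "herglotz u"]) auto
    then have lim: "((\<lambda>s. exp (\<epsilon> + Re (herglotz u (of_real s * z)))) \<longlongrightarrow> exp (\<epsilon> + Re (herglotz u z))) (at_left 1)"
      by (intro tendsto_intros)
    have "\<forall>\<^sub>F s in at_left 1. norm (f z) \<le> exp (\<epsilon> + Re (herglotz u (of_real s * z)))"
      using eventually_at_left_real[OF R(2)]
    proof eventually_elim
      case (elim s)
      then have "R \<le> s" "s < 1" by auto
      have "norm (of_real s * z) \<le> 1 * norm z"
        unfolding norm_mult norm_of_real using elim R by (intro mult_right_mono) auto
      then have "norm (of_real s * z) < 1" using z by linarith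
      then show ?case using step[OF \<open>R \<le> s\<close> \<open>s < 1\<close>] Re_herglotz[OF ui] by simp
    qed
    from tendsto_lowerbound[OF lim this trivial_limit_at_left_real] show ?thesis
      using Re_herglotz[OF ui z] by simp
  qed
  have lim: "((\<lambda>\<epsilon>. exp (\<epsilon> + poisson u z)) \<longlongrightarrow> exp (0 + poisson u z)) (at_right 0)"
    by (intro tendsto_intros)
  have "\<forall>\<^sub>F \<epsilon> in at_right 0. norm (f z) \<le> exp (\<epsilon> + poisson u z)"
    using eventually_at_right_less by eventually_elim (rule main)
  from tendsto_lowerbound[OF lim this trivial_limit_at_right_real] show ?thesis by simp
qed

text \<open>Apply \<open>norm_le_exp_poisson\<close> to \<open>exp f\<close>, whose modulus on the
  circle is exactly \<open>exp (Re f)\<close>.\<close>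

lemma Re_le_poisson:
  assumes hol: "f holomorphic_on ball 0 1" and cont: "continuous_on (cball 0 1) f" and z: "norm z < 1"
  shows "Re (f z) \<le> poisson (\<lambda>t. Re (f t)) z"
proof -
  have "norm (exp (f z)) \<le> exp (poisson (\<lambda>t. Re (f t)) z)"
    by (rule norm_le_exp_poisson)
       (use z in \<open>auto intro!: holomorphic_intros hol continuous_intros cont continuous_on_subset[OF cont]\<close>)
  then show ?thesis by simp
qed

text \<open>Multiplication by the phase \<open>c\<close> makes the value at \<open>z\<close> real
  and nonnegative, while on the circle real parts never exceed moduli.\<close>

lemma norm_le_poisson_norm:
  assumes hol: "f holomorphic_on ball 0 1" and cont: "continuous_on (cball 0 1) f" and z: "norm z < 1"
  shows "norm (f z) \<le> poisson (\<lambda>t. norm (f t)) z"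
proof -
  define c where "c = cnj (sgn (f z))"
  have c: "norm c \<le> 1" by (simp add: c_def norm_sgn)
  have conts: "continuous_on (sphere 0 1) f" by (rule continuous_on_subset[OF cont]) auto
  have "norm (f z) = Re (c * f z)"
  proof (cases "f z = 0")
    case False
    have "c * f z = cnj (f z) * f z / of_real (norm (f z))"
      by (simp add: c_def sgn_div_norm scaleR_conv_of_real divide_inverse)
    also have "cnj (f z) * f z = of_real ((norm (f z))\<^sup>2)"
      by (simp only: complex_norm_square mult.commute)
    finally show ?thesis using False by (simp add: power2_eq_square)
  qed simp
  also have "\<dots> \<le> poisson (\<lambda>t. Re (c * f t)) z"
    by (rule Re_le_poisson) (auto intro!: holomorphic_intros hol continuous_intros cont z)
  also have "\<dots> \<le> poisson (\<lambda>t. norm (f t)) z"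
  proof (intro poisson_mono AE_I2 z continuous_circle_integrable continuous_intros conts)
    fix t
    have "Re (c * f t) \<le> norm c * norm (f t)" using complex_Re_le_cmod[of "c * f t"] by (simp add: norm_mult)
    also have "\<dots> \<le> norm (f t)" using c by (simp add: mult_left_le_one_le)
    finally show "Re (c * f t) \<le> norm (f t)" .
  qed
  finally show ?thesis .
qed

text \<open>The inequality \<open>Re_le_poisson\<close> at 0, applied to \<open>c * f\<close> for
  \<open>c\<close> equal to 1, -1, i and -i, gives both inequalities for the real and for the
  imaginary part.\<close>

lemma circle_mean_value:
  assumes hol: "f holomorphic_on ball 0 1" and cont: "continuous_on (cball 0 1) f"
  shows "(LINT t|circle_measure. f t) = f 0"
proof -
  have conts: "continuous_on (sphere 0 1) f" by (rule continuous_on_subset[OF cont]) auto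
  have fi: "integrable circle_measure f" by (rule continuous_circle_integrable[OF conts])
  have *: "Re (c * f 0) \<le> Re (c * (LINT t|circle_measure. f t))" for c
  proof -
    have "Re (c * f 0) \<le> poisson (\<lambda>t. Re (c * f t)) 0"
      by (rule Re_le_poisson) (auto intro!: holomorphic_intros hol continuous_intros cont)
    also have "\<dots> = Re (LINT t|circle_measure. c * f t)"
      unfolding poisson_zero by (rule integral_Re) (use fi in simp)
    also have "(LINT t|circle_measure. c * f t) = c * (LINT t|circle_measure. f t)"
      by (rule integral_mult_right_zero)
    finally show ?thesis .
  qed
  show ?thesis
    by (rule complex_eqI) (use *[of 1] *[of "-1"] *[of \<i>] *[of "-\<i>"] in auto)
qed

section \<open>Scalar Hardy functions and their radial limits\<close>

lemma parseval_circle: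
  fixes c :: "nat \<Rightarrow> complex"
  assumes c: "summable (\<lambda>n. norm (c n))"
  shows "(\<lambda>n. (norm (c n))\<^sup>2) sums (LINT t|circle_measure. (norm (\<Sum>n. c n * t ^ n))\<^sup>2)"
proof -
  define h where "h = (\<lambda>t. \<Sum>n. c n * t ^ n)"
  have bnd: "norm (c n * t ^ n) \<le> norm (c n)" if "norm t \<le> 1" for n t
    using that by (simp add: norm_mult norm_power mult_left_le power_le_one)
  have cont: "continuous_on (sphere 0 1) h"
    unfolding h_def
  proof (rule uniform_limit_theorem[OF _ Weierstrass_m_test[OF _ c]])
    show "\<forall>\<^sub>F n in sequentially. continuous_on (sphere 0 1) (\<lambda>t. \<Sum>i<n. c i * t ^ i)"
      by (intro always_eventually allI continuous_intros)
  qed (auto intro: bnd)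
  \<comment> \<open>Orthogonality gives the Fourier coefficients of \<open>h\<close>; integrating
    the series of \<open>h\<close> once more, against \<open>cnj h\<close>, then produces the sum of
    squares.\<close>
  have coeff: "(LINT t|circle_measure. t powi (- int n) * h t) = c n" for n
  proof -
    have "(\<lambda>m. c m * (LINT t|circle_measure. t ^ m * t powi (- int n))) sums
        (LINT t|circle_measure. (\<Sum>m. c m * t ^ m) * t powi (- int n))"
      by (intro circle_integral_series c continuous_circle_integrable continuous_circle_measurable continuous_intros)
         (auto simp: norm_power)
    moreover have "(LINT t|circle_measure. t ^ m * t powi (- int n)) = (if m = n then 1 else 0)" for m
    proof -
      have "(LINT t|circle_measure. t ^ m * t powi (- int n)) = (LINT t|circle_measure. t powi (int m - int n))"
      proof (intro Bochner_Integration.integral_cong refl)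
        fix t assume "t \<in> space circle_measure"
        then have "t \<noteq> 0" by (auto simp: space_circle_measure)
        then show "t ^ m * t powi (- int n) = t powi (int m - int n)"
          by (simp add: power_int_diff power_int_minus divide_inverse)
      qed
      then show ?thesis by (simp add: circle_integral_powi)
    qed
    ultimately have "(\<lambda>m. if m = n then c m else 0) sums (LINT t|circle_measure. h t * t powi (- int n))"
      by (simp add: h_def if_distrib cong: if_cong)
    then show ?thesis
      using sums_unique2[OF _ sums_single[of n c]] by (simp add: mult.commute)
  qed
  have "(\<lambda>n. c n * (LINT t|circle_measure. t ^ n * cnj (h t))) sums (LINT t|circle_measure. (\<Sum>n. c n * t ^ n) * cnj (h t))"
    by (intro circle_integral_series c continuous_circle_integrable continuous_circle_measurable continuous_intros cont)
       (auto simp: norm_power)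
  moreover have "(LINT t|circle_measure. t ^ n * cnj (h t)) = cnj (c n)" for n
  proof -
    have "(LINT t|circle_measure. t ^ n * cnj (h t)) = (LINT t|circle_measure. cnj (t powi (- int n) * h t))"
    proof (intro Bochner_Integration.integral_cong refl)
      fix t assume "t \<in> space circle_measure"
      then have "norm t = 1" by (simp add: space_circle_measure)
      then have "t * cnj t = 1" by (simp add: complex_norm_square[symmetric])
      then have "inverse (cnj t) = t" by (metis inverse_unique mult.commute)
      then show "t ^ n * cnj (h t) = cnj (t powi (- int n) * h t)"
        by (simp add: power_int_minus flip: power_inverse)
    qed
    also have "\<dots> = cnj (LINT t|circle_measure. t powi (- int n) * h t)"
      by (rule Bochner_Integration.integral_cnj)
    finally show ?thesis by (simp add: coeff)
  qed
  ultimately have "(\<lambda>n. of_real ((norm (c n))\<^sup>2)) sums (LINT t|circle_measure. h t * cnj (h t))"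
    unfolding h_def by (simp only: complex_norm_square)
  also have "(LINT t|circle_measure. h t * cnj (h t)) = of_real (LINT t|circle_measure. (norm (h t))\<^sup>2)"
    by (simp only: complex_norm_square[symmetric] integral_complex_of_real)
  finally show ?thesis unfolding sums_of_real_iff h_def .
qed

text \<open>A real-valued integral is safe here: a holomorphic \<open>f\<close> is continuous on
  each circle of radius \<open>r < 1\<close>, so the integral is never a default value.\<close>

definition hardy2 :: "(complex \<Rightarrow> complex) \<Rightarrow> bool" where
  "hardy2 f \<longleftrightarrow> f holomorphic_on ball 0 1 \<and>
     (\<exists>B. \<forall>r\<in>{0..<1}. (LINT t|circle_measure. (norm (f (of_real r * t)))\<^sup>2) \<le> B)"

lemma dilation_cball:
  fixes z :: complex
  assumes "0 \<le> r" "r < 1" "norm z \<le> 1"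
  shows "norm (of_real r * z) < 1"
proof -
  have "norm (of_real r * z) \<le> r * 1"
    unfolding norm_mult norm_of_real using assms by (intro mult_mono) auto
  then show ?thesis using assms by simp
qed

lemma dilation_holomorphic:
  assumes "f holomorphic_on ball 0 1" "0 \<le> r" "r < 1"
  shows "(\<lambda>z. f (of_real r * z)) holomorphic_on ball 0 1"
  using dilation_cball[OF assms(2,3)]
  by (intro holomorphic_on_compose_gen[OF _ assms(1), unfolded o_def] holomorphic_intros)
     (auto simp: image_subset_iff simp del: norm_mult)

lemma dilation_continuous:
  assumes "f holomorphic_on ball 0 1" "0 \<le> r" "r < 1"
  shows "continuous_on (cball 0 1) (\<lambda>z. f (of_real r * z))"
  using dilation_cball[OF assms(2,3)]
  by (intro continuous_on_compose2[OF holomorphic_on_imp_continuous_on[OF assms(1)]] continuous_intros)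
     (auto simp del: norm_mult)

lemma dilation_continuous_sphere:
  assumes "f holomorphic_on ball 0 1" "0 \<le> r" "r < 1"
  shows "continuous_on (sphere 0 1) (\<lambda>z. f (of_real r * z))"
  by (rule continuous_on_subset[OF dilation_continuous[OF assms]]) auto

lemma parseval_holomorphic:
  assumes f: "f holomorphic_on ball 0 1" and r: "0 \<le> r" "r < 1"
  shows "(\<lambda>n. (norm ((deriv ^^ n) f 0 / fact n * of_real r ^ n))\<^sup>2) sums
    (LINT t|circle_measure. (norm (f (of_real r * t)))\<^sup>2)"
proof -
  let ?a = "\<lambda>n. (deriv ^^ n) f 0 / fact n"
  have ps: "(\<lambda>n. ?a n * w ^ n) sums f w" if "norm w < 1" for w
    using holomorphic_power_series[OF f, of w] that by simp
  \<comment> \<open>Convergence at a radius strictly larger than \<open>r\<close> gives the absolute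
    convergence at \<open>r\<close> that \<open>parseval_circle\<close> requires.\<close>
  obtain s where s: "r < s" "s < 1" using r dense by blast
  have "summable (\<lambda>n. ?a n * of_real s ^ n)"
    by (rule sums_summable[OF ps]) (use s r in auto)
  then have "summable (\<lambda>n. norm (?a n * of_real r ^ n))"
    by (rule powser_insidea) (use s r in auto)
  then have "(\<lambda>n. (norm (?a n * of_real r ^ n))\<^sup>2) sums
      (LINT t|circle_measure. (norm (\<Sum>n. ?a n * of_real r ^ n * t ^ n))\<^sup>2)"
    by (rule parseval_circle)
  moreover have "(LINT t|circle_measure. (norm (\<Sum>n. ?a n * of_real r ^ n * t ^ n))\<^sup>2) =
      (LINT t|circle_measure. (norm (f (of_real r * t)))\<^sup>2)"
  proof (intro Bochner_Integration.integral_cong refl)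
    fix t assume "t \<in> space circle_measure"
    then have "norm (of_real r * t) < 1" using r by (simp add: space_circle_measure norm_mult)
    from sums_unique[OF ps[OF this]]
    show "(norm (\<Sum>n. ?a n * of_real r ^ n * t ^ n))\<^sup>2 = (norm (f (of_real r * t)))\<^sup>2"
      by (simp add: power_mult_distrib mult.assoc)
  qed
  ultimately show ?thesis by simp
qed

text \<open>Parseval bounds every partial sum by \<open>B\<close> for each \<open>r < 1\<close>; a
  finite sum is continuous in \<open>r\<close>, so \<open>r\<close> may tend to 1.\<close>

lemma hardy2_coeff_summable:
  assumes "hardy2 f"
  shows "summable (\<lambda>n. (norm ((deriv ^^ n) f 0 / fact n))\<^sup>2)"
proof -
  let ?a = "\<lambda>n. (deriv ^^ n) f 0 / fact n"
  obtain B where f: "f holomorphic_on ball 0 1"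
    and "\<forall>r\<in>{0..<1}. (LINT t|circle_measure. (norm (f (of_real r * t)))\<^sup>2) \<le> B"
    using assms unfolding hardy2_def by blast
  then have B: "(LINT t|circle_measure. (norm (f (of_real r * t)))\<^sup>2) \<le> B" if "0 \<le> r" "r < 1" for r
    using that by auto
  show ?thesis
  proof (rule summableI_nonneg_bounded[where x=B])
    fix N
    have "(\<Sum>n<N. (norm (?a n * of_real r ^ n))\<^sup>2) \<le> B" if r: "0 \<le> r" "r < 1" for r
    proof -
      have "(\<Sum>n<N. (norm (?a n * of_real r ^ n))\<^sup>2) \<le> (\<Sum>n. (norm (?a n * of_real r ^ n))\<^sup>2)"
        by (rule sum_le_suminf[OF sums_summable[OF parseval_holomorphic[OF f r]]]) auto
      then show ?thesis using B[OF r] sums_unique[OF parseval_holomorphic[OF f r]] by linarith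
    qed
    with eventually_at_left_real[of 0 1, OF zero_less_one] have ev: "\<forall>\<^sub>F r in at_left 1. (\<Sum>n<N. (norm (?a n * of_real r ^ n))\<^sup>2) \<le> B"
      by (auto elim!: eventually_mono)
    have "((\<lambda>r. \<Sum>n<N. (norm (?a n * of_real r ^ n))\<^sup>2) \<longlongrightarrow> (\<Sum>n<N. (norm (?a n * of_real 1 ^ n))\<^sup>2)) (at_left 1)"
      by (intro tendsto_intros)
    from tendsto_upperbound[OF this ev trivial_limit_at_left_real]
    show "(\<Sum>n<N. (norm (?a n))\<^sup>2) \<le> B" by simp
  qed auto
qed

text \<open>By Parseval the integral is the sum of \<open>|a_n|^2 (1 - \<rho>^n)^2 r^(2 n)\<close>,
  and dropping the power of \<open>r\<close> gives a bound for all circles at once. Uniformity in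
  \<open>r\<close> is what lets the maximal inequality act on the error.\<close>

lemma hardy2_dilation_approx:
  assumes "hardy2 f" and "\<epsilon> > 0"
  obtains \<rho> where "0 \<le> \<rho>" "\<rho> < 1"
    "\<And>r. 0 \<le> r \<Longrightarrow> r < 1 \<Longrightarrow>
      (LINT t|circle_measure. (norm (f (of_real r * t) - f (of_real \<rho> * (of_real r * t))))\<^sup>2) \<le> \<epsilon>"
proof -
  let ?a = "\<lambda>n. (deriv ^^ n) f 0 / fact n"
  have f: "f holomorphic_on ball 0 1" using assms by (auto simp: hardy2_def)
  have sm: "summable (\<lambda>n. (norm (?a n))\<^sup>2)" by (rule hardy2_coeff_summable[OF assms(1)])
  \<comment> \<open>Beyond \<open>N\<close> the tail is small whatever \<open>\<rho>\<close> is; the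
    finitely many remaining terms vanish as \<open>\<rho>\<close> tends to 1.\<close>
  obtain N where N: "(\<Sum>n. (norm (?a (n + N)))\<^sup>2) < \<epsilon> / 2"
  proof -
    obtain N where "\<forall>n\<ge>N. norm (\<Sum>i. (norm (?a (i + n)))\<^sup>2) < \<epsilon> / 2"
      using suminf_exist_split[OF _ sm, of "\<epsilon> / 2"] \<open>\<epsilon> > 0\<close> by auto
    then have "norm (\<Sum>i. (norm (?a (i + N)))\<^sup>2) < \<epsilon> / 2" by blast
    then have "(\<Sum>i. (norm (?a (i + N)))\<^sup>2) < \<epsilon> / 2" by (simp only: real_norm_def abs_less_iff)
    then show ?thesis by (rule that)
  qed
  have "((\<lambda>\<rho>. \<Sum>n<N. (norm (?a n))\<^sup>2 * (1 - \<rho> ^ n)\<^sup>2) \<longlongrightarrow> (\<Sum>n<N. (norm (?a n))\<^sup>2 * (1 - 1 ^ n)\<^sup>2)) (at_left (1::real))"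
    by (intro tendsto_intros)
  then have "\<forall>\<^sub>F \<rho> in at_left 1. (\<Sum>n<N. (norm (?a n))\<^sup>2 * (1 - \<rho> ^ n)\<^sup>2) < \<epsilon> / 2"
    using \<open>\<epsilon> > 0\<close> by (intro order_tendstoD(2)) auto
  then have "\<forall>\<^sub>F \<rho> in at_left 1. (\<Sum>n<N. (norm (?a n))\<^sup>2 * (1 - \<rho> ^ n)\<^sup>2) < \<epsilon> / 2 \<and> \<rho> \<in> {0<..<1::real}"
    using eventually_at_left_real[of 0 1, OF zero_less_one] by eventually_elim auto
  from eventually_happens'[OF trivial_limit_at_left_real this] obtain \<rho> :: real where \<rho>: "(\<Sum>n<N. (norm (?a n))\<^sup>2 * (1 - \<rho> ^ n)\<^sup>2) < \<epsilon> / 2" "0 < \<rho>" "\<rho> < 1"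
    by (elim exE conjE) simp
  show thesis
  proof (rule that[of \<rho>])
    fix r :: real assume r: "0 \<le> r" "r < 1"
    define g where "g = (\<lambda>z. f z - f (of_real \<rho> * z))"
    have ps: "(\<lambda>n. ?a n * w ^ n) sums f w" if "norm w < 1" for w
      using holomorphic_power_series[OF f, of w] that by simp
    have "summable (\<lambda>n. norm (?a n * (1 - of_real \<rho> ^ n) * of_real r ^ n))"
    proof -
      obtain s where s: "r < s" "s < 1" using r dense by blast
      have "summable (\<lambda>n. ?a n * of_real s ^ n)"
        by (rule sums_summable[OF ps]) (use s r in auto)
      then have "summable (\<lambda>n. norm (?a n * of_real r ^ n))"
        by (rule powser_insidea) (use s r in auto)
      then show ?thesis
      proof (rule summable_comparison_test'[where N=0])
        fix n
        have "norm (1 - of_real \<rho> ^ n :: complex) = \<bar>1 - \<rho> ^ n\<bar>"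
          by (metis norm_of_real of_real_1 of_real_diff of_real_power)
        also have "\<dots> \<le> 1" using \<rho> by (auto simp: power_le_one)
        finally have "norm (1 - of_real \<rho> ^ n :: complex) * norm (?a n * of_real r ^ n) \<le> norm (?a n * of_real r ^ n)"
          by (intro mult_left_le_one_le) auto
        then show "norm (norm (?a n * (1 - of_real \<rho> ^ n) * of_real r ^ n)) \<le> norm (?a n * of_real r ^ n)"
          by (simp only: norm_mult mult_ac real_norm_def abs_mult abs_norm_cancel)
      qed
    qed
    then have P: "(\<lambda>n. (norm (?a n * (1 - of_real \<rho> ^ n) * of_real r ^ n))\<^sup>2) sums
        (LINT t|circle_measure. (norm (\<Sum>n. ?a n * (1 - of_real \<rho> ^ n) * of_real r ^ n * t ^ n))\<^sup>2)"
      by (rule parseval_circle)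
    have eq: "(LINT t|circle_measure. (norm (\<Sum>n. ?a n * (1 - of_real \<rho> ^ n) * of_real r ^ n * t ^ n))\<^sup>2) =
        (LINT t|circle_measure. (norm (g (of_real r * t)))\<^sup>2)"
    proof (intro Bochner_Integration.integral_cong refl)
      fix t assume "t \<in> space circle_measure"
      then have rt: "norm (of_real r * t) < 1" using r by (simp add: space_circle_measure norm_mult)
      have rrt: "norm (of_real \<rho> * (of_real r * t)) < 1"
        using dilation_cball[of \<rho> "of_real r * t"] rt \<rho> by simp
      have "(\<lambda>n. ?a n * (of_real r * t) ^ n - ?a n * (of_real \<rho> * (of_real r * t)) ^ n) sums g (of_real r * t)"
        unfolding g_def by (intro sums_diff ps rt rrt)
      moreover have "?a n * (of_real r * t) ^ n - ?a n * (of_real \<rho> * (of_real r * t)) ^ n =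
          ?a n * (1 - of_real \<rho> ^ n) * of_real r ^ n * t ^ n" for n
        by (simp add: power_mult_distrib algebra_simps diff_divide_distrib)
      ultimately have "(\<lambda>n. ?a n * (1 - of_real \<rho> ^ n) * of_real r ^ n * t ^ n) sums g (of_real r * t)" by simp
      from sums_unique[OF this]
      show "(norm (\<Sum>n. ?a n * (1 - of_real \<rho> ^ n) * of_real r ^ n * t ^ n))\<^sup>2 = (norm (g (of_real r * t)))\<^sup>2"
        by simp
    qed
    have le: "(norm (?a n * (1 - of_real \<rho> ^ n) * of_real r ^ n))\<^sup>2 \<le> (norm (?a n))\<^sup>2 * (1 - \<rho> ^ n)\<^sup>2" for n
    proof -
      have "norm (1 - of_real \<rho> ^ n :: complex) = \<bar>1 - \<rho> ^ n\<bar>"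
        by (metis norm_of_real of_real_1 of_real_diff of_real_power)
      then have "norm (?a n * (1 - of_real \<rho> ^ n) * of_real r ^ n) \<le> norm (?a n) * \<bar>1 - \<rho> ^ n\<bar>"
        unfolding norm_mult norm_power norm_of_real using r
        by (simp only: norm_mult, intro mult_left_le) (auto simp: power_le_one norm_mult)
      then have "(norm (?a n * (1 - of_real \<rho> ^ n) * of_real r ^ n))\<^sup>2 \<le> (norm (?a n) * \<bar>1 - \<rho> ^ n\<bar>)\<^sup>2"
        by (intro power_mono) auto
      then show ?thesis by (simp add: power_mult_distrib)
    qed
    have le2: "(norm (?a n))\<^sup>2 * (1 - \<rho> ^ n)\<^sup>2 \<le> (norm (?a n))\<^sup>2" for n
    proof -
      have "(1 - \<rho> ^ n)\<^sup>2 \<le> 1" using \<rho> by (intro power_le_one) (auto simp: power_le_one)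
      then show ?thesis by (intro mult_left_le) auto
    qed
    have sm2: "summable (\<lambda>n. (norm (?a n))\<^sup>2 * (1 - \<rho> ^ n)\<^sup>2)"
      by (rule summable_comparison_test'[OF sm, of 0]) (use le2 in auto)
    have "(LINT t|circle_measure. (norm (g (of_real r * t)))\<^sup>2) = (\<Sum>n. (norm (?a n * (1 - of_real \<rho> ^ n) * of_real r ^ n))\<^sup>2)"
      using sums_unique[OF P] eq by simp
    also have "\<dots> \<le> (\<Sum>n. (norm (?a n))\<^sup>2 * (1 - \<rho> ^ n)\<^sup>2)"
      by (intro suminf_le le sm2 sums_summable[OF P])
    also have "\<dots> = (\<Sum>n. (norm (?a (n + N)))\<^sup>2 * (1 - \<rho> ^ (n + N))\<^sup>2) + (\<Sum>n<N. (norm (?a n))\<^sup>2 * (1 - \<rho> ^ n)\<^sup>2)"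
      by (rule suminf_split_initial_segment[OF sm2])
    also have "(\<Sum>n. (norm (?a (n + N)))\<^sup>2 * (1 - \<rho> ^ (n + N))\<^sup>2) \<le> (\<Sum>n. (norm (?a (n + N)))\<^sup>2)"
      by (intro suminf_le le2 summable_ignore_initial_segment[OF sm2] summable_ignore_initial_segment[OF sm])
    finally show "(LINT t|circle_measure. (norm (f (of_real r * t) - f (of_real \<rho> * (of_real r * t))))\<^sup>2) \<le> \<epsilon>"
      using N \<rho> by (simp add: g_def)
  qed (use \<rho> in auto)
qed

section \<open>The weak-type inequality for radial maximal functions\<close>

lemma poisson_kernel_dyadic_bound:
  fixes t \<tau> :: complex
  assumes t: "norm t = 1" "norm \<tau> = 1" and r: "0 \<le> r" "r < 1" and N: "2 < 2 ^ (N + 1) * (1 - r)"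
  shows "poisson_kernel (of_real r * t) \<tau> \<le>
    (\<Sum>j\<le>N. 8 / (4 ^ j * (1 - r)) * indicator (ball t (2 ^ (j + 1) * (1 - r))) \<tau>)"
proof -
  define d where "d = 1 - r"
  have d: "0 < d" "d \<le> 1" using r by (auto simp: d_def)
  let ?z = "of_real r * t :: complex"
  have nz: "norm ?z = r" using t r by (simp add: norm_mult)
  have z: "norm ?z < 1" using nz r by simp
  have tz: "norm (t - ?z) = d"
  proof -
    have "t - ?z = of_real d * t" by (simp add: d_def algebra_simps)
    then show ?thesis using t d by (simp only: norm_mult norm_of_real abs_of_pos mult_1_right)
  qed
  have low1: "d \<le> norm (\<tau> - ?z)"
    using norm_triangle_ineq2[of \<tau> ?z] t nz by (simp add: d_def)
  have low2: "norm (\<tau> - t) \<le> 2 * norm (\<tau> - ?z)"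
    using norm_triangle_ineq[of "\<tau> - ?z" "?z - t"] low1 tz by (simp add: norm_minus_commute)
  have num: "1 - (norm ?z)\<^sup>2 \<le> 2 * d" "0 \<le> 1 - (norm ?z)\<^sup>2"
  proof -
    have "1 - r\<^sup>2 = (1 + r) * d" by (simp add: d_def power2_eq_square algebra_simps)
    moreover have "(1 + r) * d \<le> 2 * d" "0 \<le> (1 + r) * d"
      using r d mult_right_mono[of "1 + r" 2 d] by auto
    ultimately show "1 - (norm ?z)\<^sup>2 \<le> 2 * d" "0 \<le> 1 - (norm ?z)\<^sup>2" by (simp_all only: nz)
  qed
  have K: "poisson_kernel ?z \<tau> \<le> 2 * d / m\<^sup>2" if "0 < m" "m \<le> norm (\<tau> - ?z)" for m
    unfolding poisson_kernel_eq[OF z t(2)] using num that d by (intro frac_le power_mono) auto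
  \<comment> \<open>The dyadic shell around \<open>t\<close> that contains \<open>\<tau>\<close>; it
    exists with \<open>j \<le> N\<close> because the circle has diameter 2. For
    \<open>j = Suc k\<close> the distance from \<open>\<tau>\<close> to \<open>r t\<close> is at
    least \<open>2^k d\<close>, and the kernel is at most
    \<open>2 / (4^k d) = 8 / (4^j d)\<close>.\<close>
  define j where "j = (LEAST j. dist \<tau> t < 2 ^ (j + 1) * d)"
  have "dist \<tau> t \<le> 2" using norm_triangle_ineq4[of \<tau> t] t by (simp add: dist_norm)
  then have ex: "dist \<tau> t < 2 ^ (N + 1) * d" using N by (simp add: d_def)
  have jN: "j \<le> N" unfolding j_def by (rule Least_le) (rule ex)
  have j: "dist \<tau> t < 2 ^ (j + 1) * d" unfolding j_def by (rule LeastI[where P="\<lambda>j. dist \<tau> t < 2 ^ (j + 1) * d"]) (rule ex)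
  have "poisson_kernel ?z \<tau> \<le> 8 / (4 ^ j * d)"
  proof (cases j)
    case 0
    have "poisson_kernel ?z \<tau> \<le> 2 * d / d\<^sup>2" by (rule K[OF d(1) low1])
    also have "\<dots> \<le> 8 / d" using d by (simp add: power2_eq_square divide_simps)
    finally show ?thesis using 0 by simp
  next
    case (Suc k)
    have "\<not> dist \<tau> t < 2 ^ (k + 1) * d"
      using not_less_Least[of k "\<lambda>j. dist \<tau> t < 2 ^ (j + 1) * d"] Suc by (simp add: j_def)
    then have "2 ^ k * d \<le> norm (\<tau> - ?z)" using low2 by (simp add: dist_norm)
    then have "poisson_kernel ?z \<tau> \<le> 2 * d / (2 ^ k * d)\<^sup>2" using d by (intro K) auto
    also have "(2 ^ k * d)\<^sup>2 = 4 ^ k * d * d"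
      by (simp add: power_mult_distrib power2_eq_square flip: power_mult_distrib)
    also have "2 * d / (4 ^ k * d * d) = 8 / (4 ^ j * d)" using d Suc by simp
    finally show ?thesis .
  qed
  also have "\<dots> = 8 / (4 ^ j * d) * indicator (ball t (2 ^ (j + 1) * d)) \<tau>"
    using j by (simp add: dist_commute)
  also have "\<dots> \<le> (\<Sum>j\<le>N. 8 / (4 ^ j * d) * indicator (ball t (2 ^ (j + 1) * d)) \<tau>)"
    using jN d by (intro member_le_sum) auto
  finally show ?thesis by (simp add: d_def)
qed

lemma ball_circle_indicator_measurable: "(\<lambda>\<tau>. indicator (ball t \<rho>) \<tau> :: real) \<in> borel_measurable circle_measure"
proof -
  have "(indicator (ball t \<rho>) :: complex \<Rightarrow> real) \<in> borel_measurable borel"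
    by (intro borel_measurable_indicator) simp
  then show ?thesis
    unfolding measurable_cong_sets[OF sets_circle_measure refl] by (rule measurable_restrict_space1)
qed

lemma ball_circle_integrable:
  fixes v :: "complex \<Rightarrow> real"
  assumes "integrable circle_measure v"
  shows "integrable circle_measure (\<lambda>\<tau>. indicator (ball t \<rho>) \<tau> * v \<tau>)"
proof (rule Bochner_Integration.integrable_bound[OF assms])
  show "(\<lambda>\<tau>. indicator (ball t \<rho>) \<tau> * v \<tau>) \<in> borel_measurable circle_measure"
    using borel_measurable_integrable[OF assms] ball_circle_indicator_measurable by measurable
qed (auto split: split_indicator)

text \<open>The dyadic weights \<open>8 / (4^j (1 - r))\<close> meet ball masses of at most
  \<open>\<kappa> 2^(j+1) (1 - r)\<close>. The products form a geometric series with first term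
  \<open>16 * \<kappa>\<close> and ratio 1/2.\<close>

lemma poisson_ball_bound:
  fixes t :: complex
  assumes v: "integrable circle_measure v" "\<And>\<tau>. norm \<tau> = 1 \<Longrightarrow> 0 \<le> v \<tau>"
    and t: "norm t = 1" and r: "0 \<le> r" "r < 1" and "0 \<le> \<kappa>"
    and \<kappa>: "\<And>\<rho>. \<rho> > 0 \<Longrightarrow> (LINT \<tau>|circle_measure. indicator (ball t \<rho>) \<tau> * v \<tau>) \<le> \<kappa> * \<rho>"
  shows "poisson v (of_real r * t) \<le> 32 * \<kappa>"
proof -
  obtain N0 :: nat where "2 / (1 - r) < 2 ^ N0" using real_arch_pow[of 2] by auto
  then have "2 / (1 - r) < 2 ^ (N0 + 1)" by (rule less_le_trans) simp
  then obtain N where N: "2 < 2 ^ (N + 1) * (1 - r)" using r by (auto simp: field_simps)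
  have z: "norm (of_real r * t) < 1" using t r by (simp add: norm_mult)
  let ?c = "\<lambda>j. 8 / (4 ^ j * (1 - r))" and ?B = "\<lambda>j. ball t (2 ^ (j + 1) * (1 - r))"
  have "poisson v (of_real r * t) \<le> (LINT \<tau>|circle_measure. (\<Sum>j\<le>N. ?c j * (indicator (?B j) \<tau> * v \<tau>)))"
    unfolding poisson_def
  proof (intro integral_mono_AE poisson_integrable v z Bochner_Integration.integrable_sum integrable_mult_right ball_circle_integrable)
    show "AE \<tau> in circle_measure. poisson_kernel (of_real r * t) \<tau> * v \<tau> \<le> (\<Sum>j\<le>N. ?c j * (indicator (?B j) \<tau> * v \<tau>))"
      using AE_circle_sphere
    proof eventually_elim
      case (elim \<tau>)
      show ?case
        using mult_right_mono[OF poisson_kernel_dyadic_bound[OF t elim r N] v(2)[OF elim]]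
        by (simp add: sum_distrib_right mult.assoc)
    qed
  qed
  also have "\<dots> = (\<Sum>j\<le>N. ?c j * (LINT \<tau>|circle_measure. indicator (?B j) \<tau> * v \<tau>))"
    by (subst Bochner_Integration.integral_sum) (auto intro!: ball_circle_integrable v)
  also have "\<dots> \<le> (\<Sum>j\<le>N. ?c j * (\<kappa> * (2 ^ (j + 1) * (1 - r))))"
    using r by (intro sum_mono mult_left_mono \<kappa>) auto
  also have "\<dots> = (\<Sum>j\<le>N. 16 * \<kappa> * (1 / 2) ^ j)"
  proof (intro sum.cong refl)
    fix j :: nat
    have "(4::real) ^ j = 2 ^ j * 2 ^ j" by (simp flip: power_mult_distrib)
    then show "?c j * (\<kappa> * (2 ^ (j + 1) * (1 - r))) = 16 * \<kappa> * (1 / 2) ^ j"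
      using r by (simp add: field_simps)
  qed
  also have "\<dots> = 16 * \<kappa> * (\<Sum>j\<le>N. (1 / 2) ^ j)" by (simp add: sum_distrib_left)
  also have "\<dots> \<le> 16 * \<kappa> * 2"
    using \<open>0 \<le> \<kappa>\<close> by (intro mult_left_mono) (auto simp: sum_gp0)
  finally show ?thesis by simp
qed

text \<open>A Vitali covering argument, as for the Hardy-Littlewood maximal function. The constant
  320 is 32 from \<open>poisson_ball_bound\<close>, times 5 from enlarging the selected balls, times
  2 from \<open>circle_measure_arc\<close>.\<close>

lemma poisson_weak_type:
  assumes v: "integrable circle_measure v" "\<And>\<tau>. norm \<tau> = 1 \<Longrightarrow> 0 \<le> v \<tau>"
    and "\<mu> > 0" and A: "A \<in> sets circle_measure"
    and big: "\<And>t. t \<in> A \<Longrightarrow> \<exists>r\<in>{0..<1}. \<mu> < poisson v (of_real r * t)"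
  shows "measure circle_measure A \<le> 320 / \<mu> * (LINT \<tau>|circle_measure. v \<tau>)"
proof -
  let ?I = "\<lambda>t \<rho>. LINT \<tau>|circle_measure. indicator (ball t \<rho>) \<tau> * v \<tau>"
  define T where "T = (LINT \<tau>|circle_measure. v \<tau>)"
  have As: "norm t = 1" if "t \<in> A" for t
    using sets.sets_into_space[OF A] that by (auto simp: space_circle_measure)
  have IT: "?I t \<rho> \<le> T" for t \<rho>
    unfolding T_def
  proof (intro integral_mono_AE ball_circle_integrable v)
    show "AE \<tau> in circle_measure. indicator (ball t \<rho>) \<tau> * v \<tau> \<le> v \<tau>"
      using AE_circle_sphere by eventually_elim (use v(2) in \<open>auto split: split_indicator\<close>)
  qed
  \<comment> \<open>If every ball around \<open>t\<close> had small mass,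
    \<open>poisson_ball_bound\<close> with \<open>\<kappa> = \<mu> / 32\<close> would keep the
    Poisson integral at most \<open>\<mu>\<close> along the whole radius.\<close>
  have "\<exists>\<rho>>0. \<mu> / 32 * \<rho> < ?I t \<rho>" if "t \<in> A" for t
  proof (rule ccontr)
    assume "\<not> ?thesis"
    then have "?I t \<rho> \<le> \<mu> / 32 * \<rho>" if "\<rho> > 0" for \<rho>
      using that by (meson not_less)
    then have "poisson v (of_real r * t) \<le> 32 * (\<mu> / 32)" if "0 \<le> r" "r < 1" for r
      using v \<open>\<mu> > 0\<close> As[OF \<open>t \<in> A\<close>] that by (intro poisson_ball_bound) auto
    then show False using big[OF \<open>t \<in> A\<close>] by force
  qed
  then obtain \<rho> where \<rho>: "\<And>t. t \<in> A \<Longrightarrow> 0 < \<rho> t" "\<And>t. t \<in> A \<Longrightarrow> \<mu> / 32 * \<rho> t < ?I t (\<rho> t)"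
    by metis
  \<comment> \<open>Vitali's lemma asks for bounded radii; the total mass \<open>T\<close> supplies
    the bound.\<close>
  have \<rho>B: "\<rho> t \<le> 32 * T / \<mu>" if "t \<in> A" for t
    using \<rho>(2)[OF that] IT[of t "\<rho> t"] \<open>\<mu> > 0\<close> by (simp add: field_simps)
  have "A \<subseteq> (\<Union>t\<in>A. ball t (\<rho> t))" using \<rho>(1) by auto
  then obtain C where C: "countable C" "C \<subseteq> A"
    "pairwise (\<lambda>i j. disjnt (ball i (\<rho> i)) (ball j (\<rho> j))) C"
    "A \<subseteq> (\<Union>i\<in>C. ball i (5 * \<rho> i))"
    using Vitali_covering_lemma_balls[where S=A and K=A and a="\<lambda>t. t" and r=\<rho> and B="32 * T / \<mu>"] \<rho>(1) \<rho>B by auto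
  \<comment> \<open>The selected centres are numbered by naturals, with the empty set and 0 outside
    the range \<open>J\<close>, so that finite and infinite families are treated by the same
    series.\<close>
  define e where "e = to_nat_on C"
  have inj: "inj_on e C" unfolding e_def by (rule inj_on_to_nat_on[OF C(1)])
  define p where "p = the_inv_into C e"
  have pe: "p (e i) = i" if "i \<in> C" for i unfolding p_def by (rule the_inv_into_f_f[OF inj that])
  define J where "J = e ` C"
  have pJ: "p n \<in> C" if "n \<in> J" for n using that pe by (auto simp: J_def)
  have pinj: "p n \<noteq> p m" if "n \<in> J" "m \<in> J" "n \<noteq> m" for n m using that pe by (auto simp: J_def)
  define X where "X = (\<lambda>n. if n \<in> J then ball (p n) (\<rho> (p n)) else {})"
  define Y where "Y = (\<lambda>n. if n \<in> J then sphere 0 1 \<inter> ball (p n) (5 * \<rho> (p n)) else {})"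
  define c where "c = (\<lambda>n. if n \<in> J then \<rho> (p n) else 0)"
  have c0: "0 \<le> c n" for n using \<rho>(1) pJ C(2) by (fastforce simp: c_def intro: less_imp_le)
  have Ym: "Y n \<in> sets circle_measure" for n
    by (auto simp: Y_def sets_circle_measure sets_restrict_space)
  have Yc: "measure circle_measure (Y n) \<le> 10 * c n" for n
  proof (cases "n \<in> J")
    case True
    then have "p n \<in> A" using pJ C(2) by auto
    from circle_measure_arc[of "p n" "5 * \<rho> (p n)"] As[OF this] \<rho>(1)[OF this] True
    show ?thesis by (simp add: Y_def c_def)
  qed (simp add: Y_def c_def)
  have dis: "disjoint_family X"
  proof (unfold disjoint_family_on_def, intro ballI impI)
    fix n m :: nat assume "n \<noteq> m"
    then show "X n \<inter> X m = {}"
      using C(3) pJ pinj unfolding X_def pairwise_def disjnt_def by auto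
  qed
  have cI: "\<mu> / 32 * c n \<le> (LINT \<tau>|circle_measure. indicator (X n) \<tau> * v \<tau>)" for n
    using \<rho>(2)[of "p n"] pJ C(2) by (auto simp: c_def X_def intro: less_imp_le)
  \<comment> \<open>The unenlarged balls are disjoint, so their masses add up to at most
    \<open>T\<close>, and each radius is controlled by the mass of its ball.\<close>
  have psum: "(\<Sum>n<m. c n) \<le> 32 / \<mu> * T" for m
  proof -
    have intX: "integrable circle_measure (\<lambda>\<tau>. indicator (X n) \<tau> * v \<tau>)" for n
      by (auto simp: X_def intro: ball_circle_integrable v)
    have "\<mu> / 32 * (\<Sum>n<m. c n) \<le> (\<Sum>n<m. LINT \<tau>|circle_measure. indicator (X n) \<tau> * v \<tau>)"
      unfolding sum_distrib_left by (intro sum_mono cI)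
    also have "\<dots> = (LINT \<tau>|circle_measure. (\<Sum>n<m. indicator (X n) \<tau> * v \<tau>))"
      by (rule Bochner_Integration.integral_sum[symmetric]) (rule intX)
    also have "\<dots> \<le> T"
      unfolding T_def
    proof (intro integral_mono_AE v Bochner_Integration.integrable_sum intX)
      show "AE \<tau> in circle_measure. (\<Sum>n<m. indicator (X n) \<tau> * v \<tau>) \<le> v \<tau>"
        using AE_circle_sphere
      proof eventually_elim
        case (elim \<tau>)
        have "(\<Sum>n<m. indicator (X n) \<tau>) = (indicator (\<Union>n<m. X n) \<tau> :: real)"
          by (rule indicator_UN_disjoint[symmetric]) (use dis in \<open>auto intro: disjoint_family_on_mono\<close>)
        then have "(\<Sum>n<m. indicator (X n) \<tau> * v \<tau>) = indicator (\<Union>n<m. X n) \<tau> * v \<tau>"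
          by (simp flip: sum_distrib_right)
        then show ?case using v(2)[OF elim] by (auto split: split_indicator)
      qed
    qed
    finally show ?thesis using \<open>\<mu> > 0\<close> by (simp add: field_simps)
  qed
  have sc: "summable c" by (rule summableI_nonneg_bounded[OF c0 psum])
  then have sY: "summable (\<lambda>n. measure circle_measure (Y n))"
    using Yc by (intro summable_comparison_test'[OF summable_mult[OF sc, of 10], of 0]) auto
  have "A \<subseteq> (\<Union>n. Y n)"
  proof
    fix x assume "x \<in> A"
    then obtain i where "i \<in> C" "x \<in> ball i (5 * \<rho> i)" using C(4) by auto
    then have "x \<in> Y (e i)" using As[OF \<open>x \<in> A\<close>] pe by (auto simp: Y_def J_def)
    then show "x \<in> (\<Union>n. Y n)" by blast
  qed
  then have "measure circle_measure A \<le> measure circle_measure (\<Union>n. Y n)"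
    using Ym by (intro circle.finite_measure_mono) auto
  also have "\<dots> \<le> (\<Sum>n. measure circle_measure (Y n))"
    using Ym sY by (intro circle.finite_measure_subadditive_countably) auto
  also have "\<dots> \<le> (\<Sum>n. 10 * c n)" by (intro suminf_le Yc sY summable_mult sc)
  also have "\<dots> = 10 * (\<Sum>n. c n)" by (rule suminf_mult[OF sc])
  also have "\<dots> \<le> 10 * (32 / \<mu> * T)"
    by (intro mult_left_mono suminf_le_const sc psum) auto
  finally show ?thesis by (simp add: T_def)
qed

text \<open>The shift by 2 makes even the first radius strictly positive. A sequence of radii is
  what Fatou's lemma can work with.\<close>

definition radius_seq :: "nat \<Rightarrow> real" where
  "radius_seq n = 1 - 1 / real (n + 2)"

lemma radius_seq_bounds [simp]: "0 < radius_seq n" "0 \<le> radius_seq n" "radius_seq n < 1" "radius_seq n \<le> 1"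
  by (auto simp: radius_seq_def field_simps)

lemma radius_seq_lim: "radius_seq \<longlonglongrightarrow> 1"
  unfolding radius_seq_def by real_asymp

lemma radius_seq_at_left: "filterlim radius_seq (at_left 1) sequentially"
  unfolding filterlim_at using radius_seq_lim by (auto intro!: always_eventually simp: less_imp_neq)

text \<open>The union over \<open>r\<close> is uncountable, but each superlevel set is relatively
  open in the circle, hence so is their union.\<close>

lemma circle_sup_set_measurable:
  fixes g :: "complex \<Rightarrow> complex"
  assumes g: "g holomorphic_on ball 0 1" and "s \<le> 1"
  shows "{t. norm t = 1 \<and> (\<exists>r\<in>{0..<s}. \<mu> < norm (g (of_real r * t)))} \<in> sets circle_measure"
proof -
  have "openin (top_of_set (sphere 0 1)) (\<Union>r\<in>{0..<s}. sphere 0 1 \<inter> (\<lambda>t. norm (g (of_real r * t))) -` {\<mu><..})"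
  proof (intro openin_Union ballI)
    fix S assume "S \<in> (\<lambda>r. sphere 0 1 \<inter> (\<lambda>t. norm (g (of_real r * t))) -` {\<mu><..}) ` {0..<s}"
    then obtain r where r: "0 \<le> r" "r < s" "S = sphere 0 1 \<inter> (\<lambda>t. norm (g (of_real r * t))) -` {\<mu><..}"
      by auto
    show "openin (top_of_set (sphere 0 1)) S"
      unfolding r(3) using r \<open>s \<le> 1\<close>
      by (intro continuous_openin_preimage_gen continuous_intros dilation_continuous_sphere g) auto
  qed
  then obtain T where "open T" "(\<Union>r\<in>{0..<s}. sphere 0 1 \<inter> (\<lambda>t. norm (g (of_real r * t))) -` {\<mu><..}) = sphere 0 1 \<inter> T"
    unfolding openin_open by auto
  moreover have "{t. norm t = 1 \<and> (\<exists>r\<in>{0..<s}. \<mu> < norm (g (of_real r * t)))} =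
      (\<Union>r\<in>{0..<s}. sphere 0 1 \<inter> (\<lambda>t. norm (g (of_real r * t))) -` {\<mu><..})"
    by auto
  ultimately show ?thesis by (auto simp: sets_circle_measure sets_restrict_space)
qed

text \<open>As the modulus of the holomorphic function \<open>g^2\<close>, \<open>|g|^2\<close> is
  dominated by a Poisson integral of its values on a circle, and the weak-type inequality applies
  with threshold \<open>\<mu>^2\<close>. Radii \<open>s < 1\<close> provide continuity up to the
  circle; the sets \<open>W s\<close> then increase to the full one.\<close>

lemma radial_maximal_bound:
  fixes g :: "complex \<Rightarrow> complex"
  assumes g: "g holomorphic_on ball 0 1" and "\<mu> > 0"
    and B: "\<And>r. 0 \<le> r \<Longrightarrow> r < 1 \<Longrightarrow> (LINT t|circle_measure. (norm (g (of_real r * t)))\<^sup>2) \<le> B"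
  shows "measure circle_measure {t. norm t = 1 \<and> (\<exists>r\<in>{0..<1}. \<mu> < norm (g (of_real r * t)))} \<le> 320 / \<mu>\<^sup>2 * B"
proof -
  define W where "W = (\<lambda>s. {t. norm t = 1 \<and> (\<exists>r\<in>{0..<s}. \<mu> < norm (g (of_real r * t)))})"
  have Wm: "W s \<in> sets circle_measure" if "s \<le> 1" for s
    unfolding W_def by (rule circle_sup_set_measurable[OF g that])
  have Ws: "measure circle_measure (W s) \<le> 320 / \<mu>\<^sup>2 * B" if s: "0 < s" "s < 1" for s
  proof -
    define v where "v = (\<lambda>t. norm ((g (of_real s * t))\<^sup>2))"
    have vi: "integrable circle_measure v"
      unfolding v_def using s by (intro continuous_circle_integrable continuous_intros dilation_continuous_sphere g) auto
    have "measure circle_measure (W s) \<le> 320 / \<mu>\<^sup>2 * (LINT \<tau>|circle_measure. v \<tau>)"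
    proof (rule poisson_weak_type[OF vi])
      fix t assume "t \<in> W s"
      then obtain r where t: "norm t = 1" and r: "0 \<le> r" "r < s" "\<mu> < norm (g (of_real r * t))"
        by (auto simp: W_def)
      \<comment> \<open>After dilation by \<open>s\<close>, the point \<open>r t\<close> is the
        image of \<open>q t\<close>, which lies inside the unit disc.\<close>
      define q where "q = r / s"
      have q: "0 \<le> q" "q < 1" "s * q = r" using r s by (auto simp: q_def)
      have nq: "norm (of_real q * t) < 1" using q t by (simp add: norm_mult)
      have "\<mu>\<^sup>2 < (norm (g (of_real r * t)))\<^sup>2" using r \<open>\<mu> > 0\<close> by (intro power_strict_mono) auto
      also have "\<dots> = norm ((g (of_real s * (of_real q * t)))\<^sup>2)"
        using q by (simp add: norm_power mult.assoc[symmetric] flip: of_real_mult)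
      also have "\<dots> \<le> poisson v (of_real q * t)"
        unfolding v_def using s
        by (intro norm_le_poisson_norm[where f="\<lambda>z. (g (of_real s * z))\<^sup>2"] holomorphic_intros continuous_intros
            dilation_holomorphic dilation_continuous g nq) auto
      finally show "\<exists>r\<in>{0..<1}. \<mu>\<^sup>2 < poisson v (of_real r * t)" using q by force
    qed (use \<open>\<mu> > 0\<close> Wm s in \<open>auto simp: v_def\<close>)
    also have "(LINT \<tau>|circle_measure. v \<tau>) \<le> B" using B[of s] s by (simp add: v_def norm_power)
    finally show ?thesis by (simp add: divide_right_mono)
  qed
  have "incseq (\<lambda>n. W (radius_seq n))"
  proof (rule incseq_SucI)
    fix n
    have "radius_seq n \<le> radius_seq (Suc n)" by (simp add: radius_seq_def field_simps)
    then show "W (radius_seq n) \<subseteq> W (radius_seq (Suc n))" by (fastforce simp: W_def)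
  qed
  then have lim: "(\<lambda>n. measure circle_measure (W (radius_seq n))) \<longlonglongrightarrow> measure circle_measure (\<Union>n. W (radius_seq n))"
    using Wm[OF less_imp_le[OF radius_seq_bounds(3)]] by (intro circle.finite_Lim_measure_incseq) auto
  have "(\<Union>n. W (radius_seq n)) = W 1"
  proof (intro equalityI subsetI)
    fix t assume "t \<in> W 1"
    then obtain r where t: "norm t = 1" and r: "0 \<le> r" "r < 1" "\<mu> < norm (g (of_real r * t))" by (auto simp: W_def)
    obtain n where "inverse (real (Suc n)) < 1 - r" using reals_Archimedean[of "1 - r"] r by auto
    moreover have "1 / real (n + 2) \<le> inverse (real (Suc n))" by (simp add: field_simps)
    ultimately have "r < radius_seq n" by (simp add: radius_seq_def)
    then have "t \<in> W (radius_seq n)" using r t by (auto simp: W_def)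
    then show "t \<in> (\<Union>n. W (radius_seq n))" by blast
  next
    fix t assume "t \<in> (\<Union>n. W (radius_seq n))"
    then obtain n r where "norm t = 1" "0 \<le> r" "r < radius_seq n" "\<mu> < norm (g (of_real r * t))" by (auto simp: W_def)
    moreover from this have "r < 1" using less_trans radius_seq_bounds(3) by blast
    ultimately show "t \<in> W 1" by (auto simp: W_def)
  qed
  moreover have "measure circle_measure (\<Union>n. W (radius_seq n)) \<le> 320 / \<mu>\<^sup>2 * B"
    by (rule LIMSEQ_le_const2[OF lim]) (use Ws in auto)
  ultimately show ?thesis by (simp add: W_def)
qed

text \<open>Split \<open>f\<close> into a dilation, which is continuous up to the circle, and an
  error \<open>g j\<close>. By the maximal inequality the set of \<open>t\<close> whose radius meets
  a large value of \<open>g j\<close> is small, so almost every \<open>t\<close> avoids it for some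
  \<open>j\<close>, and then \<open>f\<close> oscillates little near the end of that radius.\<close>

lemma hardy2_radial_limit:
  assumes "hardy2 f"
  shows "AE t in circle_measure. \<exists>L. ((\<lambda>r. f (of_real r * t)) \<longlongrightarrow> L) (at_left 1)"
proof -
  have f: "f holomorphic_on ball 0 1" using assms by (simp add: hardy2_def)
  define e where "e = (\<lambda>j. 1 / (real j + 1))"
  have e0: "0 < e j" for j by (simp add: e_def)
  have "\<exists>\<rho>. 0 \<le> \<rho> \<and> \<rho> < 1 \<and> (\<forall>r. 0 \<le> r \<longrightarrow> r < 1 \<longrightarrow>
      (LINT t|circle_measure. (norm (f (of_real r * t) - f (of_real \<rho> * (of_real r * t))))\<^sup>2) \<le> e j)" for j
    by (rule hardy2_dilation_approx[OF assms e0[of j]]) blast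
  then obtain \<rho> where \<rho>: "\<And>j. 0 \<le> \<rho> j" "\<And>j. \<rho> j < 1"
    and small: "\<And>j r. 0 \<le> r \<Longrightarrow> r < 1 \<Longrightarrow>
      (LINT t|circle_measure. (norm (f (of_real r * t) - f (of_real (\<rho> j) * (of_real r * t))))\<^sup>2) \<le> e j"
    by metis
  define g where "g = (\<lambda>j z. f z - f (of_real (\<rho> j) * z))"
  have g: "g j holomorphic_on ball 0 1" for j
    unfolding g_def by (intro holomorphic_intros f dilation_holomorphic \<rho>)
  define U where "U = (\<lambda>k j. {t. norm t = 1 \<and> (\<exists>r\<in>{0..<1}. 1 / (real k + 1) < norm (g j (of_real r * t)))})"
  have Um: "U k j \<in> sets circle_measure" for k j
    unfolding U_def by (rule circle_sup_set_measurable[OF g order_refl])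
  have Ub: "measure circle_measure (U k j) \<le> 320 / (1 / (real k + 1))\<^sup>2 * e j" for k j
    unfolding U_def by (rule radial_maximal_bound[OF g]) (use small in \<open>auto simp: g_def\<close>)
  \<comment> \<open>For fixed \<open>k\<close> the measure bound is a constant times
    \<open>e j\<close> and tends to 0. A point is exceptional only if it lies in
    \<open>U k j\<close> for every \<open>j\<close>.\<close>
  have null: "(\<Inter>j. U k j) \<in> null_sets circle_measure" for k
  proof -
    have lim: "(\<lambda>j. 320 / (1 / (real k + 1))\<^sup>2 * e j) \<longlonglongrightarrow> 320 / (1 / (real k + 1))\<^sup>2 * 0"
      unfolding e_def by (intro tendsto_mult_left) real_asymp
    have bound: "measure circle_measure (\<Inter>j. U k j) \<le> 320 / (1 / (real k + 1))\<^sup>2 * e i" for i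
      by (rule order_trans[OF circle.finite_measure_mono Ub[of k i]]) (use Um in auto)
    have "measure circle_measure (\<Inter>j. U k j) \<le> 320 / (1 / (real k + 1))\<^sup>2 * 0"
      by (rule LIMSEQ_le_const[OF lim]) (use bound in blast)
    then have "measure circle_measure (\<Inter>j. U k j) = 0" by (simp add: measure_le_0_iff)
    then show ?thesis using Um by (auto simp: null_sets_def circle.emeasure_eq_measure)
  qed
  have "AE t in circle_measure. \<forall>k. t \<notin> (\<Inter>j. U k j)"
    unfolding AE_all_countable using AE_not_in[OF null] by blast
  then show ?thesis
    using AE_circle_sphere
  proof eventually_elim
    case (elim t)
    have cauchy: "\<exists>R. 0 \<le> R \<and> R < 1 \<and> (\<forall>r s. R \<le> r \<longrightarrow> r < 1 \<longrightarrow> R \<le> s \<longrightarrow> s < 1 \<longrightarrow> norm (f (of_real r * t) - f (of_real s * t)) < \<epsilon>)"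
      if "\<epsilon> > 0" for \<epsilon>
    proof -
      have "0 < \<epsilon> / 3" using \<open>\<epsilon> > 0\<close> by simp
      from reals_Archimedean[OF this] obtain k where "inverse (real (Suc k)) < \<epsilon> / 3" by blast
      then have k: "1 / (real k + 1) < \<epsilon> / 3"
        by (simp only: of_nat_Suc inverse_eq_divide add.commute[of 1])
      \<comment> \<open>Two thirds of \<open>\<epsilon>\<close> are spent on the error at the two
        radii, one third on the uniform continuity of the dilation.\<close>
      obtain j where "t \<notin> U k j" using elim(1) by blast
      have gb: "norm (g j (of_real r * t)) < \<epsilon> / 3" if "0 \<le> r" "r < 1" for r
      proof (rule ccontr)
        assume "\<not> ?thesis"
        then have "1 / (real k + 1) < norm (g j (of_real r * t))" using k by linarith
        then have "\<exists>r\<in>{0..<1}. 1 / (real k + 1) < norm (g j (of_real r * t))"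
          using that by (intro bexI[of _ r]) auto
        then have "t \<in> U k j" unfolding U_def using elim(2) by blast
        then show False using \<open>t \<notin> U k j\<close> by blast
      qed
      have "continuous_on (cball 0 1) (\<lambda>z. f (of_real (\<rho> j) * z))"
        by (rule dilation_continuous[OF f \<rho>])
      then have "uniformly_continuous_on (cball 0 1) (\<lambda>z. f (of_real (\<rho> j) * z))"
        by (rule compact_uniformly_continuous) auto
      moreover have "0 < \<epsilon> / 3" using \<open>\<epsilon> > 0\<close> by simp
      ultimately obtain d where "d > 0" and d: "\<And>z w. z \<in> cball 0 1 \<Longrightarrow> w \<in> cball 0 1 \<Longrightarrow> dist w z < d \<Longrightarrow>
          dist (f (of_real (\<rho> j) * w)) (f (of_real (\<rho> j) * z)) < \<epsilon> / 3"
        by (rule uniformly_continuous_onE) blast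
      define R where "R = max 0 (1 - d / 2)"
      have "norm (f (of_real r * t) - f (of_real s * t)) < \<epsilon>"
        if rs: "R \<le> r" "r < 1" "R \<le> s" "s < 1" for r s
      proof -
        have r0: "0 \<le> r" "0 \<le> s" "\<bar>r - s\<bar> < d" using rs \<open>d > 0\<close> by (auto simp: R_def)
        have "of_real r * t - of_real s * t = of_real (r - s) * t" by (simp add: algebra_simps)
        then have "dist (of_real r * t) (of_real s * t) = \<bar>r - s\<bar>"
          using elim(2) by (simp only: dist_norm norm_mult norm_of_real mult_1_right)
        then have 1: "dist (f (of_real (\<rho> j) * (of_real r * t))) (f (of_real (\<rho> j) * (of_real s * t))) < \<epsilon> / 3"
          using r0 rs elim(2) by (intro d) (auto simp: norm_mult)
        have eq: "f (of_real r * t) - f (of_real s * t) = g j (of_real r * t) - g j (of_real s * t) +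
            (f (of_real (\<rho> j) * (of_real r * t)) - f (of_real (\<rho> j) * (of_real s * t)))"
          by (simp add: g_def)
        have 2: "norm (g j (of_real r * t)) < \<epsilon> / 3" "norm (g j (of_real s * t)) < \<epsilon> / 3"
          using gb r0 rs by auto
        show ?thesis
          unfolding eq using 1 2 norm_triangle_ineq4[of "g j (of_real r * t)" "g j (of_real s * t)"]
            norm_triangle_ineq[of "g j (of_real r * t) - g j (of_real s * t)" "f (of_real (\<rho> j) * (of_real r * t)) - f (of_real (\<rho> j) * (of_real s * t))"]
          unfolding dist_norm by linarith
      qed
      moreover have "0 \<le> R" "R < 1" using \<open>d > 0\<close> by (auto simp: R_def)
      ultimately show ?thesis by blast
    qed
    show ?case
    \<comment> \<open>The Cauchy condition concerns a real parameter: the limit is produced along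
      \<open>radius_seq\<close> and then shown to attract all radii.\<close>
    proof (intro exI[of _ "lim (\<lambda>n. f (of_real (radius_seq n) * t))"])
      have ev: "\<forall>\<^sub>F n in sequentially. R \<le> radius_seq n \<and> radius_seq n < 1" if "R < 1" for R
        using order_tendstoD(1)[OF radius_seq_lim that] by eventually_elim auto
      have "Cauchy (\<lambda>n. f (of_real (radius_seq n) * t))"
      proof (rule metric_CauchyI)
        fix \<epsilon> :: real assume "\<epsilon> > 0"
        from cauchy[OF this] obtain R where R: "R < 1" "\<And>r s. R \<le> r \<Longrightarrow> r < 1 \<Longrightarrow> R \<le> s \<Longrightarrow> s < 1 \<Longrightarrow> norm (f (of_real r * t) - f (of_real s * t)) < \<epsilon>"
          by blast
        obtain N where "\<And>n. n \<ge> N \<Longrightarrow> R \<le> radius_seq n \<and> radius_seq n < 1"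
          using ev[OF R(1)] unfolding eventually_sequentially by blast
        then show "\<exists>N. \<forall>m\<ge>N. \<forall>n\<ge>N. dist (f (of_real (radius_seq m) * t)) (f (of_real (radius_seq n) * t)) < \<epsilon>"
          unfolding dist_norm using R(2) by blast
      qed
      then have L: "(\<lambda>n. f (of_real (radius_seq n) * t)) \<longlonglongrightarrow> lim (\<lambda>n. f (of_real (radius_seq n) * t))"
        by (simp add: Cauchy_convergent_iff convergent_LIMSEQ_iff)
      show "((\<lambda>r. f (of_real r * t)) \<longlongrightarrow> lim (\<lambda>n. f (of_real (radius_seq n) * t))) (at_left 1)"
      proof (rule tendstoI)
        fix \<epsilon> :: real assume "\<epsilon> > 0"
        then have "\<epsilon> / 2 > 0" by simp
        from cauchy[OF this] obtain R where R: "0 \<le> R" "R < 1" "\<And>r s. R \<le> r \<Longrightarrow> r < 1 \<Longrightarrow> R \<le> s \<Longrightarrow> s < 1 \<Longrightarrow> norm (f (of_real r * t) - f (of_real s * t)) < \<epsilon> / 2"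
          by blast
        show "\<forall>\<^sub>F r in at_left 1. dist (f (of_real r * t)) (lim (\<lambda>n. f (of_real (radius_seq n) * t))) < \<epsilon>"
          using eventually_at_left_real[OF R(2)]
        proof eventually_elim
          case (elim r)
          have "(\<lambda>n. norm (f (of_real r * t) - f (of_real (radius_seq n) * t))) \<longlonglongrightarrow>
              norm (f (of_real r * t) - lim (\<lambda>n. f (of_real (radius_seq n) * t)))"
            by (intro tendsto_intros L)
          moreover have "\<forall>\<^sub>F n in sequentially. norm (f (of_real r * t) - f (of_real (radius_seq n) * t)) \<le> \<epsilon> / 2"
            using ev[OF R(2)] by eventually_elim (use R(3) elim in \<open>auto intro: less_imp_le\<close>)
          ultimately have "norm (f (of_real r * t) - lim (\<lambda>n. f (of_real (radius_seq n) * t))) \<le> \<epsilon> / 2"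
            by (rule tendsto_upperbound) simp
          then show ?case using \<open>\<epsilon> > 0\<close> by (simp add: dist_norm)
        qed
      qed
    qed
  qed
qed

section \<open>Boundary functions and L^1 convergence towards them\<close>

text \<open>
  Taking the limit along a fixed sequence of radii makes \<open>bdry f\<close> Borel measurable everywhere, junk
  values included.
\<close>
definition bdry :: "(complex \<Rightarrow> complex) \<Rightarrow> complex \<Rightarrow> complex" where
  "bdry f t = lim (\<lambda>n. f (of_real (radius_seq n) * t))"

lemma dilation_measurable:
  assumes "f holomorphic_on ball 0 1"
  shows "(\<lambda>t. f (of_real (radius_seq n) * t)) \<in> borel_measurable circle_measure"
  by (intro continuous_circle_measurable dilation_continuous_sphere assms) auto

lemma bdry_measurable:
  assumes "f holomorphic_on ball 0 1"
  shows "bdry f \<in> borel_measurable circle_measure"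
  unfolding bdry_def by (intro borel_measurable_lim_metric dilation_measurable assms)

lemma radial_limit_bdry:
  assumes "((\<lambda>r. f (of_real r * t)) \<longlongrightarrow> L) (at_left 1)"
  shows "bdry f t = L"
  unfolding bdry_def by (rule limI) (rule filterlim_compose[OF assms radius_seq_at_left])

lemma hardy2_bdry_radial:
  assumes "hardy2 f"
  shows "AE t in circle_measure. ((\<lambda>r. f (of_real r * t)) \<longlongrightarrow> bdry f t) (at_left 1)"
  using hardy2_radial_limit[OF assms] by eventually_elim (auto dest: radial_limit_bdry)

lemma hardy2_bdry_lim:
  assumes "hardy2 f"
  shows "AE t in circle_measure. (\<lambda>n. f (of_real (radius_seq n) * t)) \<longlonglongrightarrow> bdry f t"
  using hardy2_bdry_radial[OF assms]
  by eventually_elim (rule filterlim_compose[OF _ radius_seq_at_left])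

text \<open>Turns bounds along a sequence of circles into integrability on the boundary. The detour
  through \<open>ennreal\<close> prevents a divergent integral from being read as 0.\<close>

lemma circle_fatou:
  fixes u :: "nat \<Rightarrow> complex \<Rightarrow> real"
  assumes m: "\<And>n. integrable circle_measure (u n)" "U \<in> borel_measurable circle_measure"
    and nonneg: "\<And>n. AE t in circle_measure. 0 \<le> u n t"
    and lim: "AE t in circle_measure. (\<lambda>n. u n t) \<longlonglongrightarrow> U t"
    and B: "\<forall>\<^sub>F n in sequentially. (LINT t|circle_measure. u n t) \<le> B"
  shows "integrable circle_measure U" "(LINT t|circle_measure. U t) \<le> B"
proof -
  have nn: "AE t in circle_measure. \<forall>n. 0 \<le> u n t"
    using nonneg by (simp add: AE_all_countable)
  have U0: "AE t in circle_measure. 0 \<le> U t"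
    using nn lim by eventually_elim (auto intro: LIMSEQ_le_const)
  have B0: "0 \<le> B"
  proof -
    obtain n where "(LINT t|circle_measure. u n t) \<le> B"
      using eventually_happens'[OF _ B] by auto
    then show ?thesis using integral_nonneg_AE[OF nonneg[of n]] by linarith
  qed
  have "(\<integral>\<^sup>+t. ennreal (U t) \<partial>circle_measure) = (\<integral>\<^sup>+t. liminf (\<lambda>n. ennreal (u n t)) \<partial>circle_measure)"
  proof (rule nn_integral_cong_AE)
    show "AE t in circle_measure. ennreal (U t) = liminf (\<lambda>n. ennreal (u n t))"
      using lim by eventually_elim (auto intro!: lim_imp_Liminf[symmetric] tendsto_ennrealI)
  qed
  also have "\<dots> \<le> liminf (\<lambda>n. \<integral>\<^sup>+t. ennreal (u n t) \<partial>circle_measure)"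
    using m by (intro nn_integral_liminf) auto
  also have "\<dots> = liminf (\<lambda>n. ennreal (LINT t|circle_measure. u n t))"
    using m nonneg by (simp add: nn_integral_eq_integral)
  also have "\<dots> \<le> liminf (\<lambda>n. ennreal B)"
    using B by (intro Liminf_mono) (auto elim!: eventually_mono intro: ennreal_leI)
  also have "\<dots> = ennreal B" by (simp add: Liminf_const)
  finally have le: "(\<integral>\<^sup>+t. ennreal (U t) \<partial>circle_measure) \<le> ennreal B" .
  show int: "integrable circle_measure U"
    by (rule integrableI_nonneg[OF m(2) U0]) (use le in \<open>auto intro: le_less_trans\<close>)
  show "(LINT t|circle_measure. U t) \<le> B"
    using le nn_integral_eq_integral[OF int U0] B0 by simp
qed

text \<open>
  Fatou's lemma for \<open>A n - u n\<close>: a varying majorant suffices, so no maximal function is needed to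
  pass to the limit in integrals of logarithms.
\<close>
lemma circle_integral_lower_limit:
  fixes u A :: "nat \<Rightarrow> complex \<Rightarrow> real"
  assumes u: "\<And>n. integrable circle_measure (u n)" "integrable circle_measure U"
    and A: "\<And>n. integrable circle_measure (A n)" "integrable circle_measure A'"
    and le: "\<And>n. AE t in circle_measure. u n t \<le> A n t"
    and ulim: "AE t in circle_measure. (\<lambda>n. u n t) \<longlonglongrightarrow> U t"
    and Alim: "AE t in circle_measure. (\<lambda>n. A n t) \<longlonglongrightarrow> A' t"
    and Aint: "(\<lambda>n. LINT t|circle_measure. A n t) \<longlonglongrightarrow> (LINT t|circle_measure. A' t)"
    and l: "\<forall>\<^sub>F n in sequentially. l \<le> (LINT t|circle_measure. u n t)"
  shows "l \<le> (LINT t|circle_measure. U t)"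
proof (rule field_le_epsilon)
  fix e :: real assume "e > 0"
  \<comment> \<open>The slack \<open>e\<close> is there because \<open>circle_fatou\<close> wants
    one fixed bound, while the integrals of \<open>A n\<close> merely converge.\<close>
  have "(LINT t|circle_measure. A' t - U t) \<le> (LINT t|circle_measure. A' t) + e - l"
  proof (rule circle_fatou(2))
    show "AE t in circle_measure. (\<lambda>n. A n t - u n t) \<longlonglongrightarrow> A' t - U t"
      using ulim Alim by eventually_elim (intro tendsto_intros)
    have "\<forall>\<^sub>F n in sequentially. (LINT t|circle_measure. A n t) < (LINT t|circle_measure. A' t) + e"
      using Aint \<open>e > 0\<close> by (intro order_tendstoD(2)) auto
    with l show "\<forall>\<^sub>F n in sequentially. (LINT t|circle_measure. A n t - u n t) \<le> (LINT t|circle_measure. A' t) + e - l"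
      by eventually_elim (use u A in simp)
    show "AE t in circle_measure. 0 \<le> A n t - u n t" for n
      using le[of n] by eventually_elim simp
  qed (use u A in auto)
  then show "l \<le> (LINT t|circle_measure. U t) + e"
    using u A by simp
qed

lemma hardy2_holomorphic: "hardy2 f \<Longrightarrow> f holomorphic_on ball 0 1"
  by (simp add: hardy2_def)

lemma hardy2_bdry_square:
  assumes "f holomorphic_on ball 0 1" "hardy2 f"
    and B: "\<And>r. 0 \<le> r \<Longrightarrow> r < 1 \<Longrightarrow> (LINT t|circle_measure. (norm (f (of_real r * t)))\<^sup>2) \<le> B"
  shows "integrable circle_measure (\<lambda>t. (norm (bdry f t))\<^sup>2)" "(LINT t|circle_measure. (norm (bdry f t))\<^sup>2) \<le> B"
proof -
  let ?u = "\<lambda>n t. (norm (f (of_real (radius_seq n) * t)))\<^sup>2"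
  have 1: "integrable circle_measure (?u n)" for n
    by (intro continuous_circle_integrable continuous_intros dilation_continuous_sphere assms) auto
  have 2: "(\<lambda>t. (norm (bdry f t))\<^sup>2) \<in> borel_measurable circle_measure"
    using bdry_measurable[OF assms(1)] by measurable
  have 3: "AE t in circle_measure. (\<lambda>n. ?u n t) \<longlonglongrightarrow> (norm (bdry f t))\<^sup>2"
    using hardy2_bdry_lim[OF assms(2)] by eventually_elim (intro tendsto_intros)
  have 4: "\<forall>\<^sub>F n in sequentially. (LINT t|circle_measure. ?u n t) \<le> B"
    by (intro always_eventually allI B) auto
  show "integrable circle_measure (\<lambda>t. (norm (bdry f t))\<^sup>2)" "(LINT t|circle_measure. (norm (bdry f t))\<^sup>2) \<le> B"
    using circle_fatou[OF 1 2 _ 3 4] by auto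
qed

text \<open>Either \<open>x \<le> e\<close>, or \<open>x \<le> x^2 / e\<close>. With
  \<open>e\<close> free this takes the place of the Cauchy-Schwarz inequality in passing from
  \<open>L^2\<close> to \<open>L^1\<close> bounds.\<close>

lemma le_add_square_divide:
  fixes x e :: real
  assumes "e > 0"
  shows "x \<le> e + x\<^sup>2 / e"
proof -
  have "0 \<le> (x - e)\<^sup>2 + e * x \<or> x < 0" using assms by (cases "x < 0") auto
  then have "x * e \<le> e\<^sup>2 + x\<^sup>2"
  proof
    assume "x < 0"
    then have "x * e \<le> 0" using assms by (simp add: mult_nonpos_nonneg)
    then show ?thesis by (smt (verit) zero_le_power2)
  qed (simp add: power2_eq_square algebra_simps)
  then show ?thesis using assms by (simp add: field_simps power2_eq_square)
qed

lemma integrable_of_square: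
  fixes g :: "complex \<Rightarrow> complex"
  assumes "g \<in> borel_measurable circle_measure" "integrable circle_measure (\<lambda>t. (norm (g t))\<^sup>2)"
  shows "integrable circle_measure g"
proof (rule Bochner_Integration.integrable_bound)
  show "integrable circle_measure (\<lambda>t. 1 + (norm (g t))\<^sup>2)" using assms by auto
  show "AE t in circle_measure. norm (g t) \<le> norm (1 + (norm (g t))\<^sup>2)"
    using le_add_square_divide[of 1] by (intro AE_I2) auto
qed (use assms in auto)

lemma integral_norm_le_of_square:
  fixes g :: "complex \<Rightarrow> complex"
  assumes "g \<in> borel_measurable circle_measure" "integrable circle_measure (\<lambda>t. (norm (g t))\<^sup>2)"
    and "e > 0" "(LINT t|circle_measure. (norm (g t))\<^sup>2) \<le> e\<^sup>2"
  shows "(LINT t|circle_measure. norm (g t)) \<le> 2 * e"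
proof -
  have "(LINT t|circle_measure. norm (g t)) \<le> (LINT t|circle_measure. e + (norm (g t))\<^sup>2 / e)"
    using assms le_add_square_divide[OF \<open>e > 0\<close>]
    by (intro integral_mono integrable_norm integrable_of_square) auto
  also have "\<dots> = e + (LINT t|circle_measure. (norm (g t))\<^sup>2) / e"
    using assms by (subst Bochner_Integration.integral_add) (auto simp: space_circle_measure)
  also have "\<dots> \<le> e + e\<^sup>2 / e" using assms by (intro add_left_mono divide_right_mono) auto
  finally show ?thesis using \<open>e > 0\<close> by (simp add: power2_eq_square)
qed

lemma hardy2_bdry_integrable:
  assumes "hardy2 f"
  shows "integrable circle_measure (bdry f)" "integrable circle_measure (\<lambda>t. (norm (bdry f t))\<^sup>2)"
proof -
  obtain B where B: "\<forall>r\<in>{0..<1}. (LINT t|circle_measure. (norm (f (of_real r * t)))\<^sup>2) \<le> B"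
    using assms unfolding hardy2_def by blast
  show "integrable circle_measure (\<lambda>t. (norm (bdry f t))\<^sup>2)"
    by (rule hardy2_bdry_square(1)[OF hardy2_holomorphic[OF assms] assms, of B]) (use B in auto)
  then show "integrable circle_measure (bdry f)"
    by (intro integrable_of_square bdry_measurable hardy2_holomorphic assms)
qed

text \<open>Three comparisons: \<open>f\<close> with a dilation on the circle of radius
  \<open>radius_seq n\<close>, the dilation there with the dilation on the unit circle, and the
  latter with \<open>bdry f\<close>. Fatou's lemma carries the first estimate to the boundary, where
  it becomes the third.\<close>

lemma hardy2_L1_limit:
  assumes "hardy2 f"
  shows "(\<lambda>n. LINT t|circle_measure. norm (f (of_real (radius_seq n) * t) - bdry f t)) \<longlonglongrightarrow> 0"
proof (rule LIMSEQ_I)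
  fix \<epsilon> :: real assume "\<epsilon> > 0"
  \<comment> \<open>The three comparisons cost \<open>2 * e\<close>, \<open>e\<close> and
    \<open>2 * e\<close>.\<close>
  define e where "e = \<epsilon> / 6"
  have "e > 0" using \<open>\<epsilon> > 0\<close> by (simp add: e_def)
  have f: "f holomorphic_on ball 0 1" by (rule hardy2_holomorphic[OF assms])
  obtain \<rho> where \<rho>: "0 \<le> \<rho>" "\<rho> < 1"
    and small: "\<And>r. 0 \<le> r \<Longrightarrow> r < 1 \<Longrightarrow>
      (LINT t|circle_measure. (norm (f (of_real r * t) - f (of_real \<rho> * (of_real r * t))))\<^sup>2) \<le> e\<^sup>2"
    using hardy2_dilation_approx[OF assms, of "e\<^sup>2"] \<open>e > 0\<close> by auto
  let ?F = "\<lambda>n t. f (of_real (radius_seq n) * t)" and ?G = "\<lambda>n t. f (of_real \<rho> * (of_real (radius_seq n) * t))"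
    and ?H = "\<lambda>t. f (of_real \<rho> * t)"
  have cF: "continuous_on (sphere 0 1) (?F n)" for n
    by (intro dilation_continuous_sphere f) auto
  have contH: "continuous_on (cball 0 1) ?H" by (rule dilation_continuous[OF f \<rho>])
  then have cH: "continuous_on (sphere 0 1) ?H" by (rule continuous_on_subset) auto
  have cG: "continuous_on (sphere 0 1) (?G n)" for n
    by (intro continuous_on_compose2[OF contH] continuous_intros) (auto simp: norm_mult intro: less_imp_le)
  have mb: "bdry f \<in> borel_measurable circle_measure" by (rule bdry_measurable[OF f])
  have mH: "?H \<in> borel_measurable circle_measure" by (rule continuous_circle_measurable[OF cH])
  have limG: "(\<lambda>n. ?G n t) \<longlonglongrightarrow> ?H t" if "norm t = 1" for t
  proof -
    have "(\<lambda>n. of_real (radius_seq n) * t) \<longlonglongrightarrow> of_real 1 * t"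
      by (intro tendsto_intros radius_seq_lim)
    then show ?thesis
      using that by (intro continuous_on_tendsto_compose[OF contH, of "\<lambda>n. of_real (radius_seq n) * t" t])
        (auto simp: norm_mult intro: less_imp_le)
  qed
  have limFG: "AE t in circle_measure. (\<lambda>n. (norm (?F n t - ?G n t))\<^sup>2) \<longlonglongrightarrow> (norm (bdry f t - ?H t))\<^sup>2"
    using hardy2_bdry_lim[OF assms] AE_circle_sphere
    by eventually_elim (intro tendsto_intros limG)
  have bH: "integrable circle_measure (\<lambda>t. (norm (bdry f t - ?H t))\<^sup>2)"
    "(LINT t|circle_measure. (norm (bdry f t - ?H t))\<^sup>2) \<le> e\<^sup>2"
  proof -
    have 1: "integrable circle_measure (\<lambda>t. (norm (?F n t - ?G n t))\<^sup>2)" for n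
      by (intro continuous_circle_integrable continuous_intros cF cG)
    have 2: "(\<lambda>t. (norm (bdry f t - ?H t))\<^sup>2) \<in> borel_measurable circle_measure"
      using mb mH by measurable
    have 4: "\<forall>\<^sub>F n in sequentially. (LINT t|circle_measure. (norm (?F n t - ?G n t))\<^sup>2) \<le> e\<^sup>2"
      by (intro always_eventually allI small) auto
    show "integrable circle_measure (\<lambda>t. (norm (bdry f t - ?H t))\<^sup>2)"
      "(LINT t|circle_measure. (norm (bdry f t - ?H t))\<^sup>2) \<le> e\<^sup>2"
      using circle_fatou[OF 1 2 _ limFG 4] by auto
  qed
  have h1: "(LINT t|circle_measure. norm (bdry f t - ?H t)) \<le> 2 * e"
    using mb mH bH \<open>e > 0\<close> by (intro integral_norm_le_of_square) auto
  have h2: "(LINT t|circle_measure. norm (?F n t - ?G n t)) \<le> 2 * e" for n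
    using \<open>e > 0\<close> small[of "radius_seq n"]
    by (intro integral_norm_le_of_square continuous_circle_measurable continuous_circle_integrable continuous_intros cF cG) auto
  have h3: "\<forall>\<^sub>F n in sequentially. (LINT t|circle_measure. norm (?G n t - ?H t)) \<le> e"
  proof -
    have "uniformly_continuous_on (cball 0 1) ?H"
      by (rule compact_uniformly_continuous[OF contH]) auto
    from this[unfolded uniformly_continuous_on_def, rule_format, OF \<open>e > 0\<close>]
    obtain d where "d > 0" and d: "\<And>z w. z \<in> cball 0 1 \<Longrightarrow> w \<in> cball 0 1 \<Longrightarrow> dist w z < d \<Longrightarrow> dist (?H w) (?H z) < e"
      by blast
    have "\<forall>\<^sub>F n in sequentially. 1 - d < radius_seq n"
      using radius_seq_lim \<open>d > 0\<close> by (intro order_tendstoD(1)) auto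
    then show ?thesis
    proof eventually_elim
      case (elim n)
      have "norm (?G n t - ?H t) \<le> e" if t: "norm t = 1" for t
      proof -
        have "t - of_real (radius_seq n) * t = of_real (1 - radius_seq n) * t" by (simp add: algebra_simps)
        then have "dist (of_real (radius_seq n) * t) t = 1 - radius_seq n"
          using t by (simp only: dist_norm norm_minus_commute norm_mult norm_of_real) simp
        then show ?thesis
          using d[of t "of_real (radius_seq n) * t"] t elim by (auto simp: norm_mult dist_norm intro: less_imp_le)
      qed
      then have "(LINT t|circle_measure. norm (?G n t - ?H t)) \<le> (LINT t|circle_measure. e)"
        by (intro integral_mono_AE continuous_circle_integrable continuous_intros cG cH eventually_mono[OF AE_circle_sphere]) auto
      then show ?case by (simp add: space_circle_measure)
    qed
  qed
  have "\<forall>\<^sub>F n in sequentially. norm ((LINT t|circle_measure. norm (?F n t - bdry f t)) - 0) < \<epsilon>"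
    using h3
  proof eventually_elim
    case (elim n)
    have iFG: "integrable circle_measure (\<lambda>t. norm (?F n t - ?G n t))"
      and iGH: "integrable circle_measure (\<lambda>t. norm (?G n t - ?H t))"
      by (intro continuous_circle_integrable continuous_intros cF cG cH)+
    have iHb: "integrable circle_measure (\<lambda>t. norm (bdry f t - ?H t))"
      and iFb: "integrable circle_measure (\<lambda>t. norm (?F n t - bdry f t))"
      by (intro integrable_norm Bochner_Integration.integrable_diff hardy2_bdry_integrable(1)[OF assms]
          continuous_circle_integrable[OF cH] continuous_circle_integrable[OF cF])+
    have "(LINT t|circle_measure. norm (?F n t - bdry f t)) \<le>
        (LINT t|circle_measure. norm (?F n t - ?G n t) + norm (?G n t - ?H t) + norm (bdry f t - ?H t))"
    proof (intro integral_mono iFb Bochner_Integration.integrable_add iFG iGH iHb)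
      fix t
      show "norm (?F n t - bdry f t) \<le> norm (?F n t - ?G n t) + norm (?G n t - ?H t) + norm (bdry f t - ?H t)"
        using norm_triangle_ineq4[of "(?F n t - ?G n t) + (?G n t - ?H t)" "bdry f t - ?H t"]
          norm_triangle_ineq[of "?F n t - ?G n t" "?G n t - ?H t"] by simp
    qed
    also have "\<dots> = (LINT t|circle_measure. norm (?F n t - ?G n t)) + (LINT t|circle_measure. norm (?G n t - ?H t)) +
        (LINT t|circle_measure. norm (bdry f t - ?H t))"
      using iFG iGH iHb by simp
    also have "\<dots> \<le> 5 * e" using h1 h2[of n] elim by linarith
    also have "\<dots> < \<epsilon>" using \<open>\<epsilon> > 0\<close> by (simp add: e_def)
    finally show ?case by simp
  qed
  then show "\<exists>N. \<forall>n\<ge>N. norm ((LINT t|circle_measure. norm (?F n t - bdry f t)) - 0) < \<epsilon>"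
    by (simp add: eventually_sequentially)
qed

section \<open>The boundary Jensen inequality\<close>

text \<open>The shift \<open>\<delta>\<close> bounds the logarithm from below; from above,
  \<open>\<delta> + a \<le> 2 * exp s \<le> exp (1 + s)\<close>.\<close>

lemma ln_shift_bounds:
  fixes \<delta> a s :: real
  assumes "0 < \<delta>" "\<delta> \<le> 1" "0 \<le> a" "a \<le> exp s" "0 \<le> s"
  shows "ln (\<delta> + a) \<le> 1 + s" "ln \<delta> \<le> ln (\<delta> + a)" "\<bar>ln (\<delta> + a)\<bar> \<le> \<bar>ln \<delta>\<bar> + 1 + s"
proof -
  have "1 \<le> exp s" using assms by simp
  have "\<delta> + a \<le> 2 * exp s" using assms \<open>1 \<le> exp s\<close> by linarith
  also have "\<dots> \<le> exp 1 * exp s" using exp_ge_add_one_self[of 1] by (intro mult_right_mono) auto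
  also have "\<dots> = exp (1 + s)" by (simp add: exp_add)
  finally have "ln (\<delta> + a) \<le> ln (exp (1 + s))" using assms by (subst ln_le_cancel_iff) auto
  then show 1: "ln (\<delta> + a) \<le> 1 + s" by simp
  show 2: "ln \<delta> \<le> ln (\<delta> + a)" using assms by simp
  show "\<bar>ln (\<delta> + a)\<bar> \<le> \<bar>ln \<delta>\<bar> + 1 + s" using 1 2 assms by linarith
qed

text \<open>Meant for \<open>h = det F\<close> with the entries of \<open>F\<close> as the
  \<open>f i\<close>: then \<open>h\<close> may fail to be in \<open>H^2\<close>, but
  \<open>ln |h|\<close> has a majorant that converges in \<open>L^1\<close>. A singleton
  \<open>I\<close> covers a scalar \<open>H^2\<close> function.\<close>

context
  fixes I :: "'i set" and f :: "'i \<Rightarrow> complex \<Rightarrow> complex" and h H :: "complex \<Rightarrow> complex"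
  assumes I: "finite I" and f: "\<And>i. i \<in> I \<Longrightarrow> hardy2 (f i)" and h: "h holomorphic_on ball 0 1"
    and le: "\<And>z. norm z < 1 \<Longrightarrow> norm (h z) \<le> exp (\<Sum>i\<in>I. norm (f i z))"
    and H: "AE t in circle_measure. (\<lambda>n. h (of_real (radius_seq n) * t)) \<longlonglongrightarrow> H t"
    and Hm: "H \<in> borel_measurable circle_measure"
begin

lemma majorant_integrable: "integrable circle_measure (\<lambda>t. \<Sum>i\<in>I. norm (bdry (f i) t))"
  by (intro Bochner_Integration.integrable_sum integrable_norm hardy2_bdry_integrable f)

lemma majorant_lim:
  "AE t in circle_measure. (\<lambda>n. \<Sum>i\<in>I. norm (f i (of_real (radius_seq n) * t))) \<longlonglongrightarrow> (\<Sum>i\<in>I. norm (bdry (f i) t))"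
proof -
  have "AE t in circle_measure. \<forall>i\<in>I. (\<lambda>n. f i (of_real (radius_seq n) * t)) \<longlonglongrightarrow> bdry (f i) t"
    by (rule AE_finite_allI[OF I]) (rule hardy2_bdry_lim[OF f])
  then show ?thesis by eventually_elim (intro tendsto_intros, auto)
qed

lemma boundary_majorant: "AE t in circle_measure. norm (H t) \<le> exp (\<Sum>i\<in>I. norm (bdry (f i) t))"
  using majorant_lim H AE_circle_sphere
proof eventually_elim
  case (elim t)
  show ?case
  proof (rule LIMSEQ_le[OF tendsto_norm[OF elim(2)] tendsto_exp[OF elim(1)]])
    show "\<exists>N. \<forall>n\<ge>N. norm (h (of_real (radius_seq n) * t)) \<le> exp (\<Sum>i\<in>I. norm (f i (of_real (radius_seq n) * t)))"
      using elim(3) by (intro exI[of _ 0] allI impI le) (simp add: norm_mult)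
  qed
qed

lemma log_boundary_integrable:
  assumes "0 < \<delta>" "\<delta> \<le> 1"
  shows "integrable circle_measure (\<lambda>t. ln (\<delta> + norm (H t)))"
proof (rule Bochner_Integration.integrable_bound)
  show "integrable circle_measure (\<lambda>t. \<bar>ln \<delta>\<bar> + 1 + (\<Sum>i\<in>I. norm (bdry (f i) t)))"
    using majorant_integrable by simp
  show "AE t in circle_measure. norm (ln (\<delta> + norm (H t))) \<le> norm (\<bar>ln \<delta>\<bar> + 1 + (\<Sum>i\<in>I. norm (bdry (f i) t)))"
    using boundary_majorant
  proof eventually_elim
    case (elim t)
    have "0 \<le> (\<Sum>i\<in>I. norm (bdry (f i) t))" by (intro sum_nonneg) auto
    with ln_shift_bounds(3)[OF assms _ elim] show ?case by simp
  qed
qed (use Hm in measurable)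

text \<open>The inequality \<open>norm_le_exp_poisson\<close> on smaller circles, with
  \<open>\<delta>\<close> keeping the logarithm continuous, followed by a limit of Poisson
  integrals. The varying majorant is 1 plus the sum of the moduli of the \<open>f i\<close>; its
  integrals converge by \<open>hardy2_L1_limit\<close>.\<close>

lemma norm_le_exp_poisson_log:
  assumes \<delta>: "0 < \<delta>" "\<delta> \<le> 1" and z: "norm z < 1"
  shows "norm (h z) \<le> exp (poisson (\<lambda>t. ln (\<delta> + norm (H t))) z)"
proof (rule ccontr)
  define U where "U = (\<lambda>t. ln (\<delta> + norm (H t)))"
  assume "\<not> ?thesis"
  then have "exp (poisson U z) < norm (h z)" by (simp add: U_def)
  \<comment> \<open>By continuity at \<open>z\<close>, \<open>|h|\<close> stays above
    \<open>c\<close> at \<open>radius_seq n * z\<close> for large \<open>n\<close>; this gives the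
    eventual lower bound \<open>ln c\<close>, whose survival in the limit is contradictory.\<close>
  then obtain c where c: "exp (poisson U z) < c" "c < norm (h z)" using dense by blast
  have c0: "0 < c" using c(1) exp_gt_zero less_trans by blast
  let ?u = "\<lambda>n t. ln (\<delta> + norm (h (of_real (radius_seq n) * t)))"
  let ?S = "\<lambda>n t. \<Sum>i\<in>I. norm (f i (of_real (radius_seq n) * t))" and ?S' = "\<lambda>t. \<Sum>i\<in>I. norm (bdry (f i) t)"
  have cu: "continuous_on (sphere 0 1) (?u n)" for n
    using \<delta> by (intro continuous_intros dilation_continuous_sphere h) (auto simp: add_pos_nonneg less_imp_neq[symmetric])
  have ui: "integrable circle_measure (?u n)" for n by (rule continuous_circle_integrable[OF cu])
  have Ui: "integrable circle_measure U" unfolding U_def by (rule log_boundary_integrable[OF \<delta>])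
  have Si: "integrable circle_measure (\<lambda>t. 1 + ?S n t)" for n
    by (intro continuous_circle_integrable continuous_intros dilation_continuous_sphere hardy2_holomorphic f) auto
  have S'i: "integrable circle_measure (\<lambda>t. 1 + ?S' t)" using majorant_integrable by simp
  have "ln c \<le> (LINT t|circle_measure. poisson_kernel z t * U t)"
  proof (rule circle_integral_lower_limit[where A="\<lambda>n t. poisson_kernel z t * (1 + ?S n t)" and A'="\<lambda>t. poisson_kernel z t * (1 + ?S' t)"
        and u="\<lambda>n t. poisson_kernel z t * ?u n t"])
    show "AE t in circle_measure. poisson_kernel z t * ?u n t \<le> poisson_kernel z t * (1 + ?S n t)" for n
      using AE_circle_sphere
    proof eventually_elim
      case (elim t)
      have "?u n t \<le> 1 + ?S n t"
        using elim by (intro ln_shift_bounds \<delta> le sum_nonneg) (auto simp: norm_mult)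
      then show ?case by (intro mult_left_mono poisson_kernel_nonneg z elim)
    qed
    show "AE t in circle_measure. (\<lambda>n. poisson_kernel z t * ?u n t) \<longlonglongrightarrow> poisson_kernel z t * U t"
      using H
    proof eventually_elim
      case (elim t)
      have "\<delta> + norm (H t) \<noteq> 0" using \<delta> by (smt (verit) norm_ge_zero)
      then show ?case unfolding U_def by (intro tendsto_intros elim)
    qed
    show "AE t in circle_measure. (\<lambda>n. poisson_kernel z t * (1 + ?S n t)) \<longlonglongrightarrow> poisson_kernel z t * (1 + ?S' t)"
      using majorant_lim by eventually_elim (intro tendsto_mult tendsto_add tendsto_const)
    show "(\<lambda>n. LINT t|circle_measure. poisson_kernel z t * (1 + ?S n t)) \<longlonglongrightarrow> (LINT t|circle_measure. poisson_kernel z t * (1 + ?S' t))"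
    proof (rule Lim_null_comparison[THEN LIM_zero_cancel])
      \<comment> \<open>A bound for the Poisson kernel at the fixed \<open>z\<close>; it reduces the
        convergence to \<open>L^1\<close> convergence of each \<open>f i\<close>.\<close>
      let ?K = "2 / (1 - norm z)"
      let ?D = "\<lambda>n i. LINT t|circle_measure. norm (f i (of_real (radius_seq n) * t) - bdry (f i) t)"
      have Di: "integrable circle_measure (\<lambda>t. norm (f i (of_real (radius_seq n) * t) - bdry (f i) t))" if "i \<in> I" for i n
        by (intro integrable_norm Bochner_Integration.integrable_diff hardy2_bdry_integrable f that
            continuous_circle_integrable dilation_continuous_sphere hardy2_holomorphic) auto
      show "(\<lambda>n. ?K * (\<Sum>i\<in>I. ?D n i)) \<longlonglongrightarrow> 0"
        by (intro tendsto_mult_right_zero tendsto_null_sum hardy2_L1_limit f)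
      show "\<forall>\<^sub>F n in sequentially. norm ((LINT t|circle_measure. poisson_kernel z t * (1 + ?S n t)) -
          (LINT t|circle_measure. poisson_kernel z t * (1 + ?S' t))) \<le> ?K * (\<Sum>i\<in>I. ?D n i)"
      proof (intro always_eventually allI)
        fix n
        let ?E = "\<lambda>t. \<Sum>i\<in>I. norm (f i (of_real (radius_seq n) * t) - bdry (f i) t)"
        have Ei: "integrable circle_measure ?E" by (intro Bochner_Integration.integrable_sum Di)
        have "(LINT t|circle_measure. poisson_kernel z t * (1 + ?S n t)) - (LINT t|circle_measure. poisson_kernel z t * (1 + ?S' t)) =
            (LINT t|circle_measure. poisson_kernel z t * (1 + ?S n t) - poisson_kernel z t * (1 + ?S' t))"
          by (rule Bochner_Integration.integral_diff[symmetric]) (intro poisson_integrable Si S'i z)+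
        also have "norm \<dots> \<le> (LINT t|circle_measure. norm (poisson_kernel z t * (1 + ?S n t) - poisson_kernel z t * (1 + ?S' t)))"
          by (rule integral_norm_bound)
        also have "\<dots> \<le> (LINT t|circle_measure. ?K * ?E t)"
        proof (intro integral_mono_AE integrable_norm Bochner_Integration.integrable_diff poisson_integrable Si S'i z integrable_mult_right Ei)
          show "AE t in circle_measure. norm (poisson_kernel z t * (1 + ?S n t) - poisson_kernel z t * (1 + ?S' t)) \<le> ?K * ?E t"
            using AE_circle_sphere
          proof eventually_elim
            case (elim t)
            have "\<bar>?S n t - ?S' t\<bar> \<le> (\<Sum>i\<in>I. \<bar>norm (f i (of_real (radius_seq n) * t)) - norm (bdry (f i) t)\<bar>)"
              by (simp add: sum_subtractf[symmetric])
            also have "\<dots> \<le> ?E t" by (intro sum_mono norm_triangle_ineq3)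
            finally have "\<bar>poisson_kernel z t\<bar> * \<bar>?S n t - ?S' t\<bar> \<le> ?K * ?E t"
              by (intro mult_mono poisson_kernel_bound z elim) (use z in auto)
            then show ?case by (simp only: real_norm_def right_diff_distrib[symmetric] abs_mult) simp
          qed
        qed
        also have "\<dots> = ?K * (\<Sum>i\<in>I. ?D n i)"
          using Di by (simp add: Bochner_Integration.integral_sum)
        finally show "norm ((LINT t|circle_measure. poisson_kernel z t * (1 + ?S n t)) -
          (LINT t|circle_measure. poisson_kernel z t * (1 + ?S' t))) \<le> ?K * (\<Sum>i\<in>I. ?D n i)" .
      qed
    qed
    show "\<forall>\<^sub>F n in sequentially. ln c \<le> (LINT t|circle_measure. poisson_kernel z t * ?u n t)"
    proof -
      have "isCont h z" using holomorphic_on_imp_continuous_on[OF h] z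
        by (auto simp: continuous_on_eq_continuous_at)
      moreover have "(\<lambda>n. of_real (radius_seq n) * z) \<longlonglongrightarrow> of_real 1 * z"
        by (intro tendsto_intros radius_seq_lim)
      ultimately have "(\<lambda>n. h (of_real (radius_seq n) * z)) \<longlonglongrightarrow> h z"
        by (intro isCont_tendsto_compose[of z h]) auto
      then have "\<forall>\<^sub>F n in sequentially. c < norm (h (of_real (radius_seq n) * z))"
        using c(2) by (intro order_tendstoD(1)[OF tendsto_norm])
      then show ?thesis
      proof eventually_elim
        case (elim n)
        have "norm (h (of_real (radius_seq n) * z)) \<le> exp (poisson (?u n) z)"
        proof (rule norm_le_exp_poisson[OF _ _ cu _ z])
          show "(\<lambda>z. h (of_real (radius_seq n) * z)) holomorphic_on ball 0 1"
            by (rule dilation_holomorphic[OF h]) auto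
          show "continuous_on (cball 0 1) (\<lambda>z. h (of_real (radius_seq n) * z))"
            by (rule dilation_continuous[OF h]) auto
          fix t :: complex
          have "0 < \<delta> + norm (h (of_real (radius_seq n) * t))" using \<delta> by (simp add: add_pos_nonneg)
          then show "norm (h (of_real (radius_seq n) * t)) \<le> exp (?u n t)" using \<delta> by simp
        qed
        with elim have "c \<le> exp (poisson (?u n) z)" by linarith
        then have "ln c \<le> ln (exp (poisson (?u n) z))" using c0 by (subst ln_le_cancel_iff) auto
        then show ?case by (simp add: poisson_def)
      qed
    qed
  qed (intro poisson_integrable ui Ui Si S'i z)+
  then have "c \<le> exp (poisson U z)"
    using c0 by (simp add: poisson_def) (metis exp_le_cancel_iff exp_ln)
  then show False using c(1) by simp
qed

text \<open>The shift now tends to 0. Because \<open>h 0 \<noteq> 0\<close>, the integrals of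
  \<open>u k\<close> stay above \<open>ln |h 0|\<close>; this lower bound forces the zeros of
  \<open>H\<close> to be negligible and, by Fatou's lemma, \<open>ln |H|\<close> to be
  integrable.\<close>

lemma jensen_boundary:
  assumes h0: "h 0 \<noteq> 0"
  shows "AE t in circle_measure. H t \<noteq> 0" "integrable circle_measure (\<lambda>t. ln (norm (H t)))"
    "norm z < 1 \<Longrightarrow> norm (h z) \<le> exp (poisson (\<lambda>t. ln (norm (H t))) z)"
proof -
  let ?S = "\<lambda>t. \<Sum>i\<in>I. norm (bdry (f i) t)"
  define d where "d = (\<lambda>k. 1 / (real k + 1))"
  define u where "u = (\<lambda>k t. ln (d k + norm (H t)))"
  have d: "0 < d k" "d k \<le> 1" for k by (auto simp: d_def)
  have d0: "d \<longlonglongrightarrow> 0" unfolding d_def by real_asymp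
  have ui: "integrable circle_measure (u k)" for k
    unfolding u_def by (rule log_boundary_integrable[OF d])
  have Si: "integrable circle_measure (\<lambda>t. 1 + ?S t)" using majorant_integrable by simp
  have uS: "AE t in circle_measure. u k t \<le> 1 + ?S t" for k
    using boundary_majorant by eventually_elim (auto simp: u_def intro!: ln_shift_bounds d sum_nonneg)
  define l where "l = ln (norm (h 0))"
  have ul: "l \<le> (LINT t|circle_measure. u k t)" for k
  proof -
    have "norm (h 0) \<le> exp (LINT t|circle_measure. u k t)"
      using norm_le_exp_poisson_log[OF d, of 0 k] by (simp add: u_def poisson_zero)
    then have "ln (norm (h 0)) \<le> ln (exp (LINT t|circle_measure. u k t))"
      using h0 by (subst ln_le_cancel_iff) auto
    then show ?thesis by (simp add: l_def)
  qed
  define Z where "Z = {t \<in> space circle_measure. H t = 0}"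
  have Zm: "Z \<in> sets circle_measure" unfolding Z_def using Hm by measurable
  \<comment> \<open>On \<open>Z\<close> the shifted logarithm equals \<open>- ln (k + 1)\<close>; if
    \<open>Z\<close> had positive measure, the integrals would eventually fall below
    \<open>l\<close>.\<close>
  have Zb: "measure circle_measure Z * ln (real k + 1) \<le> (LINT t|circle_measure. 1 + ?S t) - l" for k
  proof -
    have iZ: "integrable circle_measure (\<lambda>t. indicator Z t * ln (real k + 1))"
      using Zm by (intro integrable_mult_left) (auto simp: less_top[symmetric])
    have "l \<le> (LINT t|circle_measure. u k t)" by (rule ul)
    also have "\<dots> \<le> (LINT t|circle_measure. (1 + ?S t) - indicator Z t * ln (real k + 1))"
    proof (intro integral_mono_AE ui Bochner_Integration.integrable_diff Si iZ)
      show "AE t in circle_measure. u k t \<le> (1 + ?S t) - indicator Z t * ln (real k + 1)"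
        using uS[of k]
      proof eventually_elim
        case (elim t)
        have "0 \<le> ?S t" by (intro sum_nonneg) auto
        then show ?case using elim by (auto simp: Z_def u_def d_def ln_div split: split_indicator)
      qed
    qed
    also have "\<dots> = (LINT t|circle_measure. 1 + ?S t) - measure circle_measure Z * ln (real k + 1)"
      using Si iZ Zm by (subst Bochner_Integration.integral_diff) auto
    finally show ?thesis by simp
  qed
  have "measure circle_measure Z = 0"
  proof (rule ccontr)
    assume "measure circle_measure Z \<noteq> 0"
    then have pos: "0 < measure circle_measure Z" using measure_nonneg[of circle_measure Z] by linarith
    have "filterlim (\<lambda>k. ln (real k + 1)) at_top sequentially" by real_asymp
    then have "\<forall>\<^sub>F k in sequentially. ((LINT t|circle_measure. 1 + ?S t) - l) / measure circle_measure Z < ln (real k + 1)"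
      by (simp add: filterlim_at_top_dense)
    then obtain k where "((LINT t|circle_measure. 1 + ?S t) - l) / measure circle_measure Z < ln (real k + 1)"
      using eventually_happens'[OF sequentially_bot] by blast
    then show False using Zb[of k] pos by (simp add: field_simps)
  qed
  then have "Z \<in> null_sets circle_measure" using Zm by (auto simp: null_sets_def circle.emeasure_eq_measure)
  from AE_not_in[OF this] show nz: "AE t in circle_measure. H t \<noteq> 0"
    using AE_space by eventually_elim (auto simp: Z_def)
  have ulim: "AE t in circle_measure. (\<lambda>k. u k t) \<longlonglongrightarrow> ln (norm (H t))"
    using nz
  proof eventually_elim
    case (elim t)
    have "(\<lambda>k. ln (d k + norm (H t))) \<longlonglongrightarrow> ln (0 + norm (H t))"
      using elim by (intro tendsto_intros d0) auto
    then show ?case by (simp add: u_def)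
  qed
  have lm: "(\<lambda>t. ln (norm (H t))) \<in> borel_measurable circle_measure" using Hm by measurable
  have "integrable circle_measure (\<lambda>t. (1 + ?S t) - ln (norm (H t)))"
  proof (rule circle_fatou(1))
    show "integrable circle_measure (\<lambda>t. (1 + ?S t) - u k t)" for k
      by (intro Bochner_Integration.integrable_diff Si ui)
    show "(\<lambda>t. (1 + ?S t) - ln (norm (H t))) \<in> borel_measurable circle_measure"
      using borel_measurable_integrable[OF Si] lm by measurable
    show "AE t in circle_measure. 0 \<le> (1 + ?S t) - u k t" for k
      using uS[of k] by eventually_elim simp
    show "AE t in circle_measure. (\<lambda>k. (1 + ?S t) - u k t) \<longlonglongrightarrow> (1 + ?S t) - ln (norm (H t))"
      using ulim by eventually_elim (intro tendsto_intros)
    show "\<forall>\<^sub>F k in sequentially. (LINT t|circle_measure. (1 + ?S t) - u k t) \<le> (LINT t|circle_measure. 1 + ?S t) - l"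
      using ul by (intro always_eventually allI) (subst Bochner_Integration.integral_diff[OF Si ui], simp)
  qed
  from Bochner_Integration.integrable_diff[OF Si this]
  show li: "integrable circle_measure (\<lambda>t. ln (norm (H t)))" by simp
  assume z: "norm z < 1"
  have "(\<lambda>k. poisson (u k) z) \<longlonglongrightarrow> poisson (\<lambda>t. ln (norm (H t))) z"
    unfolding poisson_def
  proof (rule integral_dominated_convergence)
    \<comment> \<open>\<open>u k\<close> lies between \<open>ln |H|\<close>, as the shift is
      positive, and \<open>1 + ?S\<close>, so one function dominates all of them.\<close>
    show "integrable circle_measure (\<lambda>t. poisson_kernel z t * (\<bar>ln (norm (H t))\<bar> + (1 + ?S t)))"
      by (intro poisson_integrable z Bochner_Integration.integrable_add integrable_abs li Si)
    show "AE t in circle_measure. (\<lambda>k. poisson_kernel z t * u k t) \<longlonglongrightarrow> poisson_kernel z t * ln (norm (H t))"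
      using ulim by eventually_elim (intro tendsto_intros)
    show "AE t in circle_measure. norm (poisson_kernel z t * u k t) \<le> poisson_kernel z t * (\<bar>ln (norm (H t))\<bar> + (1 + ?S t))" for k
      using uS[of k] AE_circle_sphere nz
    proof eventually_elim
      case (elim t)
      have "ln (norm (H t)) \<le> u k t"
        unfolding u_def using elim d[of k] by (subst ln_le_cancel_iff) (auto intro: add_pos_nonneg)
      moreover have "0 \<le> ?S t" by (intro sum_nonneg) auto
      ultimately have "\<bar>u k t\<bar> \<le> \<bar>ln (norm (H t))\<bar> + (1 + ?S t)" using elim by linarith
      then show ?case
        using poisson_kernel_nonneg[OF z elim(2)] by (simp only: real_norm_def abs_mult abs_of_nonneg mult_left_mono)
    qed
    show "(\<lambda>t. poisson_kernel z t * ln (norm (H t))) \<in> borel_measurable circle_measure"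
      using poisson_integrable[OF li z] by simp
    show "(\<lambda>t. poisson_kernel z t * u k t) \<in> borel_measurable circle_measure" for k
      using poisson_integrable[OF ui z] by simp
  qed
  then have "(\<lambda>k. exp (poisson (u k) z)) \<longlonglongrightarrow> exp (poisson (\<lambda>t. ln (norm (H t))) z)" by (intro tendsto_intros)
  then show "norm (h z) \<le> exp (poisson (\<lambda>t. ln (norm (H t))) z)"
    by (rule LIMSEQ_le_const) (use norm_le_exp_poisson_log[OF d z] in \<open>auto simp: u_def\<close>)
qed

end

section \<open>Matrix-valued functions\<close>

text \<open>A sum over pairs, so that it matches the exponent of the Jensen majorant with the set of
  all index pairs as \<open>I\<close>.\<close>

definition entry_sum :: "complex^'n^'n \<Rightarrow> real" where
  "entry_sum A = (\<Sum>p\<in>UNIV. norm (A $ fst p $ snd p))"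

lemma entry_sum_alt: "entry_sum A = (\<Sum>i\<in>UNIV. \<Sum>j\<in>UNIV. norm (A $ i $ j))"
  unfolding entry_sum_def by (simp add: sum.cartesian_product case_prod_beta UNIV_Times_UNIV)

lemma entry_sum_nonneg: "0 \<le> entry_sum A"
  unfolding entry_sum_def by (intro sum_nonneg) auto

text \<open>An entry is a coordinate of the image of a unit vector. Together with
  \<open>opnorm_le_entry_sum\<close> this reduces the matrix analysis to scalar entries.\<close>

lemma norm_entry_le_opnorm:
  fixes A :: "complex^'n^'n"
  shows "norm (A $ i $ j) \<le> opnorm A"
proof -
  have "A $ i $ j = (A *v axis j 1) $ i"
    by (simp add: matrix_vector_mult_def axis_def if_distrib cong: if_cong)
  then have "norm (A $ i $ j) \<le> norm (A *v axis j 1)" by (simp only: Finite_Cartesian_Product.norm_nth_le)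
  also have "\<dots> \<le> onorm ((*v) A) * norm (axis j 1 :: complex^'n)"
    by (rule onorm) simp
  also have "norm (axis j 1 :: complex^'n) = 1"
    by (simp add: norm_vec_def L2_set_def axis_def if_distrib if_distribR cong: if_cong)
  finally show ?thesis by (simp add: opnorm_def)
qed

lemma opnorm_nonneg: "0 \<le> opnorm (A :: complex^'n^'n)"
  unfolding opnorm_def by (rule onorm_pos_le) simp

lemma opnorm_le_entry_sum: "opnorm (A :: complex^'n^'n) \<le> entry_sum A"
  unfolding opnorm_def
proof (rule onorm_bound[OF entry_sum_nonneg])
  fix x :: "complex^'n"
  have "norm (A *v x) \<le> (\<Sum>i\<in>UNIV. norm ((A *v x) $ i))"
    unfolding norm_vec_def by (rule L2_set_le_sum) simp
  also have "\<dots> \<le> (\<Sum>i\<in>UNIV. \<Sum>j\<in>UNIV. norm (A $ i $ j) * norm x)"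
  proof (rule sum_mono)
    fix i
    have "norm ((A *v x) $ i) \<le> (\<Sum>j\<in>UNIV. norm (A $ i $ j * x $ j))"
      by (simp add: matrix_vector_mult_def norm_sum)
    also have "\<dots> \<le> (\<Sum>j\<in>UNIV. norm (A $ i $ j) * norm x)"
      by (intro sum_mono) (simp add: norm_mult mult_left_mono Finite_Cartesian_Product.norm_nth_le)
    finally show "norm ((A *v x) $ i) \<le> (\<Sum>j\<in>UNIV. norm (A $ i $ j) * norm x)" .
  qed
  finally show "norm (A *v x) \<le> entry_sum A * norm x"
    by (simp add: entry_sum_alt sum_distrib_right)
qed

lemma opnorm_scaled_identity: "opnorm (\<chi> i j. if i = j then c else 0 :: complex^'n^'n) = norm c"
proof -
  have eq: "(\<chi> i j. if i = j then c else 0) *v x = c *s x" for x :: "complex^'n"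
    by (simp add: vec_eq_iff matrix_vector_mult_def if_distrib if_distribR cong: if_cong)
  have nm: "norm (c *s x) = norm c * norm x" for x :: "complex^'n"
    by (simp add: norm_vec_def norm_mult L2_set_right_distrib)
  show ?thesis
  proof (rule antisym)
    show "opnorm (\<chi> i j. if i = j then c else 0 :: complex^'n^'n) \<le> norm c"
      unfolding opnorm_def eq by (rule onorm_bound) (simp_all add: nm)
    show "norm c \<le> opnorm (\<chi> i j. if i = j then c else 0 :: complex^'n^'n)"
      \<comment> \<open>Every diagonal entry is \<open>c\<close>; \<open>undefined\<close> merely
        names some index.\<close>
      using norm_entry_le_opnorm[of "\<chi> i j. if i = j then c else 0 :: complex^'n^'n" undefined undefined] by simp
  qed
qed

text \<open>Enlarging the sum over permutations to all self-maps of the index set makes it the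
  expansion of the product of row sums.\<close>

lemma norm_det_le_prod:
  fixes A :: "complex^'n^'n"
  shows "norm (det A) \<le> (\<Prod>i\<in>UNIV. \<Sum>j\<in>UNIV. norm (A $ i $ j))"
proof -
  have "norm (det A) \<le> (\<Sum>p | p permutes UNIV. norm (of_int (sign p) * (\<Prod>i\<in>UNIV. A $ i $ p i)))"
    unfolding det_def by (rule norm_sum)
  also have "\<dots> = (\<Sum>p | p permutes (UNIV :: 'n set). \<Prod>i\<in>UNIV. norm (A $ i $ p i))"
    by (intro sum.cong refl) (simp add: norm_mult prod_norm sign_def)
  also have "\<dots> \<le> (\<Sum>p\<in>UNIV. \<Prod>i\<in>UNIV. norm (A $ i $ p i))"
    by (intro sum_mono2) (auto intro: prod_nonneg)
  also have "\<dots> = (\<Prod>i\<in>UNIV. \<Sum>j\<in>UNIV. norm (A $ i $ j))"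
    by (subst prod_sum_PiE) (auto simp: PiE_UNIV_domain)
  finally show ?thesis .
qed

lemma norm_det_le_exp: "norm (det A) \<le> exp (entry_sum A)"
proof -
  have "norm (det A) \<le> (\<Prod>i\<in>UNIV. \<Sum>j\<in>UNIV. norm (A $ i $ j))" by (rule norm_det_le_prod)
  also have "\<dots> \<le> (\<Prod>i\<in>UNIV. exp (\<Sum>j\<in>UNIV. norm (A $ i $ j)))"
  proof (intro prod_mono conjI sum_nonneg)
    fix i
    show "(\<Sum>j\<in>UNIV. norm (A $ i $ j)) \<le> exp (\<Sum>j\<in>UNIV. norm (A $ i $ j))"
      using exp_ge_add_one_self[of "\<Sum>j\<in>UNIV. norm (A $ i $ j)"] by linarith
  qed simp
  also have "\<dots> = exp (entry_sum A)" by (simp add: entry_sum_alt exp_sum)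
  finally show ?thesis .
qed

text \<open>Each row sum of \<open>A\<close> is at most 1 plus that of \<open>A - mat 1\<close>, and
  \<open>1 + x \<le> exp x\<close>. Unlike in \<open>norm_det_le_exp\<close>, the bound tends to 1
  as \<open>A\<close> tends to the identity, which the sharp comparison at the origin depends
  on.\<close>

lemma norm_det_le_exp_diff: "norm (det A) \<le> exp (entry_sum (A - mat 1))"
proof -
  have "norm (det A) \<le> (\<Prod>i\<in>UNIV. \<Sum>j\<in>UNIV. norm (A $ i $ j))" by (rule norm_det_le_prod)
  also have "\<dots> \<le> (\<Prod>i\<in>UNIV. exp (\<Sum>j\<in>UNIV. norm ((A - mat 1) $ i $ j)))"
  proof (intro prod_mono conjI sum_nonneg)
    fix i
    have "(\<Sum>j\<in>UNIV. norm (A $ i $ j)) \<le> (\<Sum>j\<in>UNIV. (if j = i then 1 else 0) + norm ((A - mat 1) $ i $ j))"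
    proof (rule sum_mono)
      fix j
      show "norm (A $ i $ j) \<le> (if j = i then 1 else 0) + norm ((A - mat 1) $ i $ j)"
        using norm_triangle_ineq[of 1 "A $ i $ i - 1"] by (auto simp: mat_def)
    qed
    also have "\<dots> = 1 + (\<Sum>j\<in>UNIV. norm ((A - mat 1) $ i $ j))" by (simp add: sum.distrib)
    also have "\<dots> \<le> exp (\<Sum>j\<in>UNIV. norm ((A - mat 1) $ i $ j))" by (rule exp_ge_add_one_self)
    finally show "(\<Sum>j\<in>UNIV. norm (A $ i $ j)) \<le> exp (\<Sum>j\<in>UNIV. norm ((A - mat 1) $ i $ j))" .
  qed simp
  also have "\<dots> = exp (entry_sum (A - mat 1))" by (simp add: entry_sum_alt exp_sum)
  finally show ?thesis .
qed

text \<open>The numerators of Cramer's rule: column \<open>k\<close> is replaced by the unit vector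
  with index \<open>l\<close>, so the transposition of cofactors is built into the order of the
  indices.\<close>

definition adjugate :: "complex^'n^'n \<Rightarrow> complex^'n^'n" where
  "adjugate A = (\<chi> k l. det (\<chi> i j. if j = k then (if i = l then 1 else 0) else A $ i $ j))"

lemma matrix_mult_adjugate:
  fixes A :: "complex^'n^'n"
  assumes "det A \<noteq> 0"
  shows "A ** (\<chi> k l. adjugate A $ k $ l / det A) = mat 1"
    "(\<chi> k l. adjugate A $ k $ l / det A) ** A = mat 1"
proof -
  have *: "A *v (\<chi> k. adjugate A $ k $ l / det A) = axis l 1" for l
    unfolding cramer[OF assms] by (simp add: vec_eq_iff adjugate_def axis_def cong: if_cong)
  show "A ** (\<chi> k l. adjugate A $ k $ l / det A) = mat 1"
  proof (simp only: vec_eq_iff, intro allI)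
    fix i l
    show "(A ** (\<chi> k l. adjugate A $ k $ l / det A)) $ i $ l = mat 1 $ i $ l"
      using *[of l, unfolded vec_eq_iff, rule_format, of i]
      by (simp add: matrix_matrix_mult_def matrix_vector_mult_def axis_def mat_def eq_commute)
  qed
  then show "(\<chi> k l. adjugate A $ k $ l / det A) ** A = mat 1"
    by (rule matrix_left_right_inverse1)
qed

text \<open>The replaced column adds at most 1 to a row sum, and 1 plus a sum is at most the product
  of the \<open>1 + a j\<close>. The product form matters: its logarithm splits into one term per
  entry, each with its own Poisson majorant.\<close>

lemma norm_adjugate_le:
  fixes A :: "complex^'n^'n"
  shows "norm (adjugate A $ k $ l) \<le> (\<Prod>p\<in>UNIV. 1 + norm (A $ fst p $ snd p))"
proof -
  let ?B = "\<chi> i j. if j = k then (if i = l then 1 else 0) else A $ i $ j"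
  have sum_le_prod: "1 + (\<Sum>j\<in>S. a j) \<le> (\<Prod>j\<in>S. 1 + a j)" if "finite S" "\<And>j. 0 \<le> a j" for S and a :: "'n \<Rightarrow> real"
    using that(1)
  proof induction
    case (insert x S)
    have "1 + (a x + sum a S) \<le> (1 + a x) * (1 + sum a S)"
      using that(2) sum_nonneg[of S a] by (simp add: algebra_simps)
    also have "\<dots> \<le> (1 + a x) * (\<Prod>j\<in>S. 1 + a j)"
      using insert that(2)[of x] by (intro mult_left_mono) auto
    finally show ?case using insert by simp
  qed simp
  have "norm (adjugate A $ k $ l) \<le> (\<Prod>i\<in>UNIV. \<Sum>j\<in>UNIV. norm (?B $ i $ j))"
    using norm_det_le_prod[of ?B] by (simp add: adjugate_def)
  also have "\<dots> \<le> (\<Prod>i\<in>UNIV. \<Prod>j\<in>UNIV. 1 + norm (A $ i $ j))"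
  proof (intro prod_mono conjI sum_nonneg)
    fix i
    have "(\<Sum>j\<in>UNIV. norm (?B $ i $ j)) \<le> (\<Sum>j\<in>UNIV. (if j = k then 1 else 0) + norm (A $ i $ j))"
      by (intro sum_mono) auto
    also have "\<dots> = 1 + (\<Sum>j\<in>UNIV. norm (A $ i $ j))" by (simp add: sum.distrib)
    also have "\<dots> \<le> (\<Prod>j\<in>UNIV. 1 + norm (A $ i $ j))" by (rule sum_le_prod) auto
    finally show "(\<Sum>j\<in>UNIV. norm (?B $ i $ j)) \<le> (\<Prod>j\<in>UNIV. 1 + norm (A $ i $ j))" .
  qed simp
  also have "\<dots> = (\<Prod>p\<in>UNIV. 1 + norm (A $ fst p $ snd p))"
    by (simp add: prod.cartesian_product case_prod_beta UNIV_Times_UNIV)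
  finally show ?thesis .
qed

section \<open>Matrix Hardy classes entry by entry, boundary matrices\<close>

lemma hardy2I:
  assumes "f holomorphic_on ball 0 1"
    "\<And>r. r \<in> {0..<1} \<Longrightarrow> (LINT t|circle_measure. (norm (f (of_real r * t)))\<^sup>2) \<le> B"
  shows "hardy2 f"
  unfolding hardy2_def using assms by blast

lemma hardy2_bounded_mult:
  assumes g: "g holomorphic_on ball 0 1" "\<And>z. norm z < 1 \<Longrightarrow> norm (g z) \<le> B" and f: "hardy2 f"
  shows "hardy2 (\<lambda>z. g z * f z)"
proof -
  obtain C where C: "\<And>r. r \<in> {0..<1} \<Longrightarrow> (LINT t|circle_measure. (norm (f (of_real r * t)))\<^sup>2) \<le> C"
    using f unfolding hardy2_def by blast
  have fh: "f holomorphic_on ball 0 1" by (rule hardy2_holomorphic[OF f])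
  have "(LINT t|circle_measure. (norm (g (of_real r * t) * f (of_real r * t)))\<^sup>2) \<le> B\<^sup>2 * C" if r: "r \<in> {0..<1}" for r
  proof -
    have "(LINT t|circle_measure. (norm (g (of_real r * t) * f (of_real r * t)))\<^sup>2) \<le>
        (LINT t|circle_measure. B\<^sup>2 * (norm (f (of_real r * t)))\<^sup>2)"
    proof (intro integral_mono_AE continuous_circle_integrable continuous_intros dilation_continuous_sphere g fh)
      show "AE t in circle_measure. (norm (g (of_real r * t) * f (of_real r * t)))\<^sup>2 \<le> B\<^sup>2 * (norm (f (of_real r * t)))\<^sup>2"
        using AE_circle_sphere
      proof eventually_elim
        case (elim t)
        have "norm (g (of_real r * t)) \<le> B" using elim r by (intro g) (auto simp: norm_mult)
        then have "(norm (g (of_real r * t)))\<^sup>2 \<le> B\<^sup>2" by (intro power_mono) auto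
        then show ?case by (simp add: norm_mult power_mult_distrib mult_right_mono)
      qed
    qed (use r in auto)
    also have "\<dots> \<le> B\<^sup>2 * C" using C[OF r] by (simp add: mult_left_mono)
    finally show ?thesis .
  qed
  then show ?thesis by (intro hardy2I holomorphic_intros g fh)
qed

lemma hardy2_const: "hardy2 (\<lambda>_. c)"
  by (auto simp: hardy2_def space_circle_measure)

lemma hardy2_bounded:
  assumes "g holomorphic_on ball 0 1" "\<And>z. norm z < 1 \<Longrightarrow> norm (g z) \<le> B"
  shows "hardy2 g"
  using hardy2_bounded_mult[OF assms hardy2_const[of 1]] by simp

lemma hardy2_add:
  assumes f: "hardy2 f" and g: "hardy2 g"
  shows "hardy2 (\<lambda>z. f z + g z)"
proof -
  obtain B where B: "\<And>r. r \<in> {0..<1} \<Longrightarrow> (LINT t|circle_measure. (norm (f (of_real r * t)))\<^sup>2) \<le> B"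
    using f unfolding hardy2_def by blast
  obtain C where C: "\<And>r. r \<in> {0..<1} \<Longrightarrow> (LINT t|circle_measure. (norm (g (of_real r * t)))\<^sup>2) \<le> C"
    using g unfolding hardy2_def by blast
  note hol = hardy2_holomorphic[OF f] hardy2_holomorphic[OF g]
  have "(LINT t|circle_measure. (norm (f (of_real r * t) + g (of_real r * t)))\<^sup>2) \<le> 2 * B + 2 * C" if r: "r \<in> {0..<1}" for r
  proof -
    have int: "integrable circle_measure (\<lambda>t. (norm (f (of_real r * t)))\<^sup>2)" "integrable circle_measure (\<lambda>t. (norm (g (of_real r * t)))\<^sup>2)"
      "integrable circle_measure (\<lambda>t. (norm (f (of_real r * t) + g (of_real r * t)))\<^sup>2)"
      using r by (auto intro!: continuous_circle_integrable continuous_intros dilation_continuous_sphere hol)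
    have "(norm (a + b))\<^sup>2 \<le> 2 * (norm a)\<^sup>2 + 2 * (norm b)\<^sup>2" for a b :: complex
    proof -
      have "(norm (a + b))\<^sup>2 \<le> (norm a + norm b)\<^sup>2" by (intro power_mono norm_triangle_ineq) auto
      also have "\<dots> \<le> 2 * (norm a)\<^sup>2 + 2 * (norm b)\<^sup>2"
        using zero_le_power2[of "norm a - norm b"] by (simp add: power2_eq_square algebra_simps)
      finally show ?thesis .
    qed
    then have "(LINT t|circle_measure. (norm (f (of_real r * t) + g (of_real r * t)))\<^sup>2) \<le>
        (LINT t|circle_measure. 2 * (norm (f (of_real r * t)))\<^sup>2 + 2 * (norm (g (of_real r * t)))\<^sup>2)"
      using int by (intro integral_mono) auto
    also have "\<dots> \<le> 2 * B + 2 * C" using B[OF r] C[OF r] int by simp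
    finally show ?thesis .
  qed
  then show ?thesis by (intro hardy2I holomorphic_intros hol)
qed

lemma hardy2_sum:
  assumes "\<And>i. i \<in> S \<Longrightarrow> hardy2 (f i)"
  shows "hardy2 (\<lambda>z. \<Sum>i\<in>S. f i z)"
  using assms
proof (induction S rule: infinite_finite_induct)
  case (insert x S)
  then show ?case by (simp add: hardy2_add)
qed (simp_all add: hardy2_const)

text \<open>One real \<open>B\<close> for all entries and radii is what the uniform integrability in
  \<open>hardy_two_subset_smirnov\<close> requires.\<close>

lemma hardy_two_entry_bound:
  fixes F :: "complex \<Rightarrow> complex^'n^'n"
  assumes "F \<in> hardy_two"
  shows "\<exists>B\<ge>0. \<forall>i j. \<forall>r\<in>{0..<1}. (LINT t|circle_measure. (norm (F (of_real r * t) $ i $ j))\<^sup>2) \<le> B"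
proof -
  let ?N = "\<lambda>r. \<integral>\<^sup>+t. ennreal ((opnorm (F (of_real r * t)))\<^sup>2) \<partial>circle_measure"
  have hol: "(\<lambda>z. F z $ i $ j) holomorphic_on ball 0 1" for i j
    using assms by (auto simp: hardy_two_def matrix_holomorphic_def)
  define B where "B = enn2real (SUP r\<in>{0..<1}. ?N r)"
  have "(SUP r\<in>{0..<1}. ?N r) < \<infinity>" using assms by (simp only: hardy_two_def mem_Collect_eq)
  then have B: "0 \<le> B" "(SUP r\<in>{0..<1}. ?N r) = ennreal B"
    by (simp_all only: B_def ennreal_enn2real infinity_ennreal_def enn2real_nonneg)
  show ?thesis
  proof (intro exI[of _ B] conjI B(1) allI ballI)
    fix i j and r :: real assume "r \<in> {0..<1}"
    then have r: "0 \<le> r" "r < 1" by auto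
    have int: "integrable circle_measure (\<lambda>t. (norm (F (of_real r * t) $ i $ j))\<^sup>2)"
      by (intro continuous_circle_integrable continuous_on_power continuous_on_norm dilation_continuous_sphere[OF hol r])
    have "ennreal (LINT t|circle_measure. (norm (F (of_real r * t) $ i $ j))\<^sup>2) =
        (\<integral>\<^sup>+t. ennreal ((norm (F (of_real r * t) $ i $ j))\<^sup>2) \<partial>circle_measure)"
      by (rule nn_integral_eq_integral[symmetric, OF int]) simp
    also have "\<dots> \<le> ?N r"
      by (intro nn_integral_mono ennreal_leI power_mono norm_entry_le_opnorm) auto
    also have "\<dots> \<le> ennreal B" unfolding B(2)[symmetric] using r by (intro SUP_upper) auto
    finally show "(LINT t|circle_measure. (norm (F (of_real r * t) $ i $ j))\<^sup>2) \<le> B"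
      using B(1) by simp
  qed
qed

lemma hardy_two_entry:
  assumes "F \<in> hardy_two"
  shows "hardy2 (\<lambda>z. F z $ i $ j)"
proof -
  obtain B where B: "\<forall>i j. \<forall>r\<in>{0..<1}. (LINT t|circle_measure. (norm (F (of_real r * t) $ i $ j))\<^sup>2) \<le> B"
    using hardy_two_entry_bound[OF assms] by blast
  have "(\<lambda>z. F z $ i $ j) holomorphic_on ball 0 1"
    using assms by (auto simp: hardy_two_def matrix_holomorphic_def)
  then show ?thesis by (rule hardy2I[where B=B]) (use B in blast)
qed

lemma hardy_inf_entry:
  assumes "F \<in> hardy_inf"
  obtains B where "(\<lambda>z. F z $ i $ j) holomorphic_on ball 0 1" "\<And>z. norm z < 1 \<Longrightarrow> norm (F z $ i $ j) \<le> B"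
proof -
  obtain B where "matrix_holomorphic F" "\<forall>z\<in>ball 0 1. opnorm (F z) \<le> B"
    using assms unfolding hardy_inf_def by blast
  then have B: "matrix_holomorphic F" "\<And>z. norm z < 1 \<Longrightarrow> opnorm (F z) \<le> B" by auto
  show thesis
    by (rule that[of B]) (use B in \<open>auto simp: matrix_holomorphic_def intro: order_trans[OF norm_entry_le_opnorm]\<close>)
qed

lemma hardy_inf_entry_hardy2: "F \<in> hardy_inf \<Longrightarrow> hardy2 (\<lambda>z. F z $ i $ j)"
  by (erule hardy_inf_entry[of F i j]) (rule hardy2_bounded)

text \<open>Measurable for holomorphic entries, whereas \<open>radial_boundary\<close> is a limit
  over a continuous parameter, unspecified where it does not exist. The two agree almost everywhere
  when the entries are in \<open>H^2\<close>.\<close>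

definition bdry_matrix :: "(complex \<Rightarrow> complex^'n^'n) \<Rightarrow> complex \<Rightarrow> complex^'n^'n" where
  "bdry_matrix F t = (\<chi> i j. bdry (\<lambda>z. F z $ i $ j) t)"

lemma tendsto_matrix_iff:
  "((F :: 'a \<Rightarrow> complex^'n^'n) \<longlongrightarrow> A) net \<longleftrightarrow> (\<forall>i j. ((\<lambda>x. F x $ i $ j) \<longlongrightarrow> A $ i $ j) net)"
  by (intro iffI allI tendsto_vec_nth) (auto intro: vec_tendstoI)

lemma bdry_matrix_lim:
  assumes "\<And>i j. hardy2 (\<lambda>z. F z $ i $ j)"
  shows "AE t in circle_measure. ((\<lambda>r. F (of_real r * t)) \<longlongrightarrow> bdry_matrix F t) (at_left 1)"
proof -
  have "AE t in circle_measure. \<forall>i\<in>UNIV. \<forall>j\<in>UNIV. ((\<lambda>r. F (of_real r * t) $ i $ j) \<longlongrightarrow> bdry (\<lambda>z. F z $ i $ j) t) (at_left 1)"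
    by (intro AE_finite_allI finite hardy2_bdry_radial assms)
  then show ?thesis by eventually_elim (simp add: tendsto_matrix_iff bdry_matrix_def)
qed

lemma radial_boundary_eq:
  assumes "((\<lambda>r. F (of_real r * t)) \<longlongrightarrow> A) (at_left 1)"
  shows "radial_boundary F t = A"
  unfolding radial_boundary_def by (rule tendsto_Lim[OF trivial_limit_at_left_real assms])

lemma radial_boundary_AE:
  assumes "\<And>i j. hardy2 (\<lambda>z. F z $ i $ j)"
  shows "AE t in circle_measure. radial_boundary F t = bdry_matrix F t"
  using bdry_matrix_lim[OF assms] by eventually_elim (rule radial_boundary_eq)

lemma tendsto_det [tendsto_intros]:
  fixes F :: "'a \<Rightarrow> complex^'n^'n"
  assumes "(F \<longlongrightarrow> A) net"
  shows "((\<lambda>x. det (F x)) \<longlongrightarrow> det A) net"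
  unfolding det_def by (intro tendsto_intros assms)

lemma holomorphic_det:
  assumes "\<And>i j. (\<lambda>z. F z $ i $ j) holomorphic_on S"
  shows "(\<lambda>z. det (F z :: complex^'n^'n)) holomorphic_on S"
  unfolding det_def by (intro holomorphic_intros assms)

text \<open>Uniform integrability from an \<open>L^2\<close> bound:
  \<open>ln_plus x \<le> x \<le> K + x^2 / K\<close>, where a large \<open>K\<close> makes the
  second term small and then a small \<open>\<Delta>\<close> the first.\<close>

lemma hardy_two_subset_smirnov: "(hardy_two :: (complex \<Rightarrow> complex^'n^'n) set) \<subseteq> smirnov_class"
proof
  fix F :: "complex \<Rightarrow> complex^'n^'n" assume F: "F \<in> hardy_two"
  obtain B where B: "0 \<le> B" "\<forall>i j. \<forall>r\<in>{0..<1}. (LINT t|circle_measure. (norm (F (of_real r * t) $ i $ j))\<^sup>2) \<le> B"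
    using hardy_two_entry_bound[OF F] by blast
  have hol: "(\<lambda>z. F z $ i $ j) holomorphic_on ball 0 1" for i j
    using F by (auto simp: hardy_two_def matrix_holomorphic_def)
  let ?n = "real CARD('n \<times> 'n)"
  have "\<exists>\<delta>>0::real. \<forall>r\<in>{0..<1::real}. \<forall>\<Delta>\<in>sets circle_measure. emeasure circle_measure \<Delta> < ennreal \<delta> \<longrightarrow>
      (\<integral>\<^sup>+t\<in>\<Delta>. ennreal (ln_plus (opnorm (F (of_real r * t)))) \<partial>circle_measure) < ennreal \<epsilon>"
    if "\<epsilon> > 0" for \<epsilon> :: real
  proof -
    \<comment> \<open>\<open>?n * (?n * B)\<close> bounds the mean square of
      \<open>entry_sum\<close>: one factor comes from squaring a sum of \<open>?n\<close> terms, the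
      other from adding their integrals. The summand 1 keeps \<open>K\<close> positive when
      \<open>B = 0\<close>.\<close>
    define K where "K = 2 * (?n * (?n * B)) / \<epsilon> + 1"
    have K: "0 < K" using B \<open>\<epsilon> > 0\<close> by (simp add: K_def add_nonneg_pos)
    have KB: "?n * (?n * B) / K < \<epsilon> / 2"
      using K \<open>\<epsilon> > 0\<close> by (simp add: K_def field_simps)
    show ?thesis
    proof (intro exI[of _ "\<epsilon> / (2 * K)"] conjI ballI impI)
      fix r :: real and \<Delta> assume r: "r \<in> {0..<1}" and \<Delta>: "\<Delta> \<in> sets circle_measure"
        and small: "emeasure circle_measure \<Delta> < ennreal (\<epsilon> / (2 * K))"
      let ?S = "\<lambda>t. entry_sum (F (of_real r * t))"
      have mS: "measure circle_measure \<Delta> < \<epsilon> / (2 * K)"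
        using small K \<open>\<epsilon> > 0\<close> by (simp add: circle.emeasure_eq_measure ennreal_less_iff)
      have cS: "continuous_on (sphere 0 1) ?S"
        unfolding entry_sum_def using r by (intro continuous_on_sum continuous_on_norm dilation_continuous_sphere hol) auto
      have iS: "integrable circle_measure (\<lambda>t. (?S t)\<^sup>2)" by (intro continuous_circle_integrable continuous_on_power cS)
      have iE: "integrable circle_measure (\<lambda>t. (norm (F (of_real r * t) $ i $ j))\<^sup>2)" for i j
        using r by (intro continuous_circle_integrable continuous_on_power continuous_on_norm dilation_continuous_sphere hol) auto
      have S2: "(LINT t|circle_measure. (?S t)\<^sup>2) \<le> ?n * (?n * B)"
      proof -
        have "(LINT t|circle_measure. (?S t)\<^sup>2) \<le>
            (LINT t|circle_measure. (\<Sum>p\<in>UNIV. (norm (F (of_real r * t) $ fst p $ snd p))\<^sup>2) * ?n)"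
          unfolding entry_sum_def
          by (intro integral_mono integrable_mult_left Bochner_Integration.integrable_sum iE sum_squared_le_sum_of_squares
              iS[unfolded entry_sum_def])
        also have "\<dots> = (\<Sum>p\<in>UNIV. LINT t|circle_measure. (norm (F (of_real r * t) $ fst p $ snd p))\<^sup>2) * ?n"
          using iE by (simp add: Bochner_Integration.integral_sum)
        also have "\<dots> \<le> (\<Sum>p\<in>(UNIV :: ('n \<times> 'n) set). B) * ?n"
          using r B(2) by (intro mult_right_mono sum_mono) auto
        finally show ?thesis by (simp add: mult_ac)
      qed
      have iD: "integrable circle_measure (\<lambda>t. indicator \<Delta> t * K)"
        using \<Delta> by (intro integrable_mult_left) (auto simp: less_top[symmetric])
      have "(\<integral>\<^sup>+t\<in>\<Delta>. ennreal (ln_plus (opnorm (F (of_real r * t)))) \<partial>circle_measure) \<le>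
          (\<integral>\<^sup>+t. ennreal (indicator \<Delta> t * K + (?S t)\<^sup>2 / K) \<partial>circle_measure)"
      proof (rule nn_integral_mono)
        fix t
        have "ln_plus (opnorm (F (of_real r * t))) \<le> opnorm (F (of_real r * t))"
        proof (cases "opnorm (F (of_real r * t)) \<le> 1")
          case True then show ?thesis using opnorm_nonneg[of "F (of_real r * t)"] by (simp add: ln_plus_def)
        next
          case False
          then show ?thesis using ln_le_minus_one[of "opnorm (F (of_real r * t))"] by (simp add: ln_plus_def)
        qed
        also have "\<dots> \<le> ?S t" by (rule opnorm_le_entry_sum)
        also have "\<dots> \<le> K + (?S t)\<^sup>2 / K" by (rule le_add_square_divide[OF K])
        finally show "ennreal (ln_plus (opnorm (F (of_real r * t)))) * indicator \<Delta> t \<le> ennreal (indicator \<Delta> t * K + (?S t)\<^sup>2 / K)"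
          using K by (cases "t \<in> \<Delta>") (simp_all add: ennreal_leI del: ennreal_plus)
      qed
      also have "\<dots> = ennreal (LINT t|circle_measure. indicator \<Delta> t * K + (?S t)\<^sup>2 / K)"
        using iS iD K by (intro nn_integral_eq_integral) auto
      also have "(LINT t|circle_measure. indicator \<Delta> t * K + (?S t)\<^sup>2 / K) =
          measure circle_measure \<Delta> * K + (LINT t|circle_measure. (?S t)\<^sup>2) / K"
        using iS iD \<Delta> by (subst Bochner_Integration.integral_add) auto
      also have "ennreal \<dots> < ennreal \<epsilon>"
      proof -
        have "measure circle_measure \<Delta> * K < \<epsilon> / 2" using mS K by (simp add: field_simps)
        moreover have "(LINT t|circle_measure. (?S t)\<^sup>2) / K \<le> ?n * (?n * B) / K"
          using S2 K by (intro divide_right_mono) auto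
        ultimately show ?thesis using KB \<open>\<epsilon> > 0\<close> by (intro ennreal_lessI) linarith+
      qed
      finally show "(\<integral>\<^sup>+t\<in>\<Delta>. ennreal (ln_plus (opnorm (F (of_real r * t)))) \<partial>circle_measure) < ennreal \<epsilon>" .
    qed (use K \<open>\<epsilon> > 0\<close> in auto)
  qed
  then show "F \<in> smirnov_class"
    using F by (auto simp: smirnov_class_def hardy_two_def)
qed

lemma poisson_sum:
  assumes "\<And>i. i \<in> S \<Longrightarrow> integrable circle_measure (u i)" "norm z < 1"
  shows "poisson (\<lambda>t. \<Sum>i\<in>S. u i t) z = (\<Sum>i\<in>S. poisson (u i) z)"
  unfolding poisson_def sum_distrib_left
  by (rule Bochner_Integration.integral_sum) (rule poisson_integrable[OF assms])

lemma ln_one_plus_bdry_integrable: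
  assumes "hardy2 f"
  shows "integrable circle_measure (\<lambda>t. ln (1 + norm (bdry f t)))"
proof (rule Bochner_Integration.integrable_bound[OF hardy2_bdry_integrable(1)[OF assms]])
  show "(\<lambda>t. ln (1 + norm (bdry f t))) \<in> borel_measurable circle_measure"
    using bdry_measurable[OF hardy2_holomorphic[OF assms]] by measurable
  show "AE t in circle_measure. norm (ln (1 + norm (bdry f t))) \<le> norm (bdry f t)"
    by (intro AE_I2) (simp add: ln_add_one_self_le_self)
qed

text \<open>The case of one function and shift 1. The weight \<open>ln (1 + |f|)\<close> is
  nonnegative and integrable even for an entry that vanishes identically.\<close>

lemma hardy2_norm_le_exp_poisson:
  assumes f: "hardy2 f" and z: "norm z < 1"
  shows "norm (f z) \<le> exp (poisson (\<lambda>t. ln (1 + norm (bdry f t))) z)"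
proof (rule norm_le_exp_poisson_log[of "{()}" "\<lambda>_. f"])
  fix z :: complex
  have "norm (f z) \<le> exp (norm (f z))"
    using exp_ge_add_one_self[of "norm (f z)"] by linarith
  then show "norm (f z) \<le> exp (\<Sum>i\<in>{()}. norm (f z))" by simp
qed (use f z hardy2_bdry_lim[OF f] hardy2_holomorphic[OF f] bdry_measurable in auto)

section \<open>Outer functions are Beurling-outer\<close>

lemma outer_imp_bounded_quotients:
  fixes E :: "complex \<Rightarrow> complex^'n^'n"
  assumes E: "E \<in> hardy_two" and outer: "scalar_outer (\<lambda>z. det (E z))"
  shows "\<exists>F \<phi>. (\<forall>k. F k \<in> hardy_inf) \<and> (\<forall>k. \<phi> k holomorphic_on ball 0 1) \<and>
    (\<forall>k z. norm z < 1 \<longrightarrow> norm (\<phi> k z) \<le> 1) \<and> (\<lambda>k::nat. \<phi> k 0) \<longlonglongrightarrow> 1 \<and>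
    (\<forall>k z. norm z < 1 \<longrightarrow> F k z ** E z = (\<chi> i j. if i = j then \<phi> k z else 0) \<and>
      E z ** F k z = (\<chi> i j. if i = j then \<phi> k z else 0))"
proof -
  obtain C w where C: "norm C = 1" and w: "integrable circle_measure (\<lambda>t. ln (w t :: real))"
    and det_eq: "\<And>z. z \<in> ball 0 1 \<Longrightarrow> det (E z) = C * exp (LINT t|circle_measure. (t + z) / (t - z) * of_real (ln (w t)))"
    using outer unfolding scalar_outer_def by blast
  have hE: "hardy2 (\<lambda>z. E z $ i $ j)" for i j by (rule hardy_two_entry[OF E])
  let ?lw = "\<lambda>t. ln (w t)"
  define S where "S = (\<lambda>t. \<Sum>p\<in>UNIV. ln (1 + norm (bdry (\<lambda>z. E z $ fst p $ snd p) t)))"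
  have Si: "integrable circle_measure S"
    unfolding S_def by (intro Bochner_Integration.integrable_sum ln_one_plus_bdry_integrable hE)
  have S0: "0 \<le> S t" for t unfolding S_def by (intro sum_nonneg) auto
  \<comment> \<open>The logarithm of the prescribed boundary modulus, \<open>S\<close> being that of
    the product over the entries. Using \<open>k + 1\<close> makes the first term nonnegative for
    every \<open>k\<close>, so that \<open>|ln w| + S\<close> dominates.\<close>
  define \<psi> where "\<psi> = (\<lambda>(k::nat) t. min 0 (ln (real k + 1) + ?lw t - S t))"
  have \<psi>i: "integrable circle_measure (\<psi> k)" for k
    unfolding \<psi>_def using w Si by (intro integrable_min Bochner_Integration.integrable_diff Bochner_Integration.integrable_add) auto
  define \<phi> where "\<phi> = (\<lambda>k z. exp (herglotz (\<psi> k) z))"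
  define F where "F = (\<lambda>k z. (\<chi> i j. \<phi> k z * (adjugate (E z) $ i $ j / det (E z))) :: complex^'n^'n)"
  have detE: "det (E z) = C * exp (herglotz ?lw z)" if "norm z < 1" for z
    using det_eq[of z] that by (simp add: herglotz_def)
  have C0: "C \<noteq> 0" using C by auto
  have det0: "det (E z) \<noteq> 0" if "norm z < 1" for z using detE[OF that] C0 by simp
  have \<phi>hol: "\<phi> k holomorphic_on ball 0 1" for k
    unfolding \<phi>_def by (intro holomorphic_intros herglotz_holomorphic \<psi>i)
  have \<phi>1: "norm (\<phi> k z) \<le> 1" if z: "norm z < 1" for k z
  proof -
    have "poisson (\<psi> k) z \<le> poisson (\<lambda>_. 0) z"
      by (intro poisson_mono \<psi>i z) (auto simp: \<psi>_def)
    then show ?thesis by (simp add: \<phi>_def Re_herglotz[OF \<psi>i z] poisson_const[OF z])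
  qed
  have \<phi>0: "(\<lambda>k. \<phi> k 0) \<longlonglongrightarrow> 1"
  proof -
    have "(\<lambda>k. LINT t|circle_measure. \<psi> k t) \<longlonglongrightarrow> (LINT t|circle_measure. 0)"
    proof (rule integral_dominated_convergence[where w="\<lambda>t. \<bar>?lw t\<bar> + S t"])
      show "integrable circle_measure (\<lambda>t. \<bar>?lw t\<bar> + S t)" using w Si by auto
      show "\<psi> k \<in> borel_measurable circle_measure" for k using \<psi>i by auto
      show "AE t in circle_measure. norm (\<psi> k t) \<le> \<bar>?lw t\<bar> + S t" for k
      proof (intro AE_I2)
        fix t
        define a where "a = ln (real k + 1)"
        have "0 \<le> a" by (simp add: a_def)
        then show "norm (\<psi> k t) \<le> \<bar>?lw t\<bar> + S t"
          unfolding \<psi>_def a_def[symmetric] real_norm_def min_def using S0[of t] by (simp add: abs_if)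
      qed
      \<comment> \<open>Once \<open>ln (k + 1)\<close> exceeds \<open>S t - ln (w t)\<close>, the
        minimum is 0: the sequence is eventually constant at each point.\<close>
      show "AE t in circle_measure. (\<lambda>k. \<psi> k t) \<longlonglongrightarrow> 0"
      proof (intro AE_I2 tendsto_eventually)
        fix t
        have "filterlim (\<lambda>k. ln (real k + 1)) at_top sequentially" by real_asymp
        then have "\<forall>\<^sub>F k in sequentially. S t - ?lw t \<le> ln (real k + 1)"
          by (simp add: filterlim_at_top)
        then show "\<forall>\<^sub>F k in sequentially. \<psi> k t = 0"
          by eventually_elim (simp add: \<psi>_def)
      qed
    qed auto
    then have "(\<lambda>k. exp (of_real (LINT t|circle_measure. \<psi> k t) :: complex)) \<longlonglongrightarrow> exp (of_real (LINT t|circle_measure. 0))"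
      by (intro tendsto_intros)
    then show ?thesis by (simp add: \<phi>_def herglotz_zero)
  qed
  have FE: "F k z ** E z = (\<chi> i j. if i = j then \<phi> k z else 0)" "E z ** F k z = (\<chi> i j. if i = j then \<phi> k z else 0)"
    if z: "norm z < 1" for k z
  proof -
    let ?I = "\<chi> i j. adjugate (E z) $ i $ j / det (E z)"
    have "(F k z ** E z) $ i $ j = \<phi> k z * (?I ** E z) $ i $ j" for i j
      by (simp add: F_def matrix_matrix_mult_def sum_distrib_left mult.assoc)
    then show "F k z ** E z = (\<chi> i j. if i = j then \<phi> k z else 0)"
      unfolding matrix_mult_adjugate(2)[OF det0[OF z]] by (simp add: vec_eq_iff mat_def)
    have "(E z ** F k z) $ i $ j = \<phi> k z * (E z ** ?I) $ i $ j" for i j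
      by (simp add: F_def matrix_matrix_mult_def sum_distrib_left mult_ac)
    then show "E z ** F k z = (\<chi> i j. if i = j then \<phi> k z else 0)"
      unfolding matrix_mult_adjugate(1)[OF det0[OF z]] by (simp add: vec_eq_iff mat_def)
  qed
  let ?N = "CARD('n \<times> 'n)"
  \<comment> \<open>\<open>\<phi> k / det E\<close> carries the factor
    \<open>exp (- poisson S z)\<close>, the adjugate is at most
    \<open>2 ^ ?N * exp (poisson S z)\<close>, and the two exponentials cancel. Each entry costs a
    factor 2, since \<open>1 + x \<le> 2 * exp p\<close> whenever \<open>x \<le> exp p\<close> and
    \<open>p \<ge> 0\<close>.\<close>
  have entry: "norm (F k z $ i $ j) \<le> (real k + 1) * 2 ^ ?N" if z: "norm z < 1" for k z i j
  proof -
    have up: "poisson (\<psi> k) z \<le> ln (real k + 1) + poisson ?lw z - poisson S z"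
    proof -
      have "poisson (\<psi> k) z \<le> poisson (\<lambda>t. (ln (real k + 1) + ?lw t) - S t) z"
        using w Si by (intro poisson_mono \<psi>i z Bochner_Integration.integrable_diff Bochner_Integration.integrable_add) (auto simp: \<psi>_def)
      also have "\<dots> = poisson (\<lambda>t. ln (real k + 1) + ?lw t) z - poisson S z"
        using w Si by (intro poisson_diff z) auto
      also have "poisson (\<lambda>t. ln (real k + 1) + ?lw t) z = ln (real k + 1) + poisson ?lw z"
        using poisson_add[of "\<lambda>_. ln (real k + 1)" ?lw z] w z by (simp add: poisson_const)
      finally show ?thesis by simp
    qed
    have "norm (\<phi> k z / det (E z)) = exp (poisson (\<psi> k) z) / exp (poisson ?lw z)"
      using C by (simp add: \<phi>_def detE[OF z] norm_divide norm_mult Re_herglotz[OF \<psi>i z] Re_herglotz[OF w z])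
    also have "\<dots> = exp (poisson (\<psi> k) z - poisson ?lw z)" by (simp add: exp_diff)
    also have "\<dots> \<le> exp (ln (real k + 1) - poisson S z)" using up by simp
    also have "\<dots> = (real k + 1) / exp (poisson S z)" by (simp add: exp_diff)
    finally have 1: "norm (\<phi> k z / det (E z)) \<le> (real k + 1) / exp (poisson S z)" .
    have "norm (adjugate (E z) $ i $ j) \<le> (\<Prod>p\<in>UNIV. 1 + norm (E z $ fst p $ snd p))"
      by (rule norm_adjugate_le)
    also have "\<dots> \<le> (\<Prod>p\<in>(UNIV :: ('n \<times> 'n) set). 2 * exp (poisson (\<lambda>t. ln (1 + norm (bdry (\<lambda>z. E z $ fst p $ snd p) t))) z))"
    proof (intro prod_mono conjI)
      fix p :: "'n \<times> 'n"
      have "0 \<le> poisson (\<lambda>t. ln (1 + norm (bdry (\<lambda>z. E z $ fst p $ snd p) t))) z"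
        by (intro poisson_nonneg z ln_one_plus_bdry_integrable hE) auto
      then have "1 \<le> exp (poisson (\<lambda>t. ln (1 + norm (bdry (\<lambda>z. E z $ fst p $ snd p) t))) z)" by simp
      then show "1 + norm (E z $ fst p $ snd p) \<le> 2 * exp (poisson (\<lambda>t. ln (1 + norm (bdry (\<lambda>z. E z $ fst p $ snd p) t))) z)"
        using hardy2_norm_le_exp_poisson[OF hE z, of "fst p" "snd p"] by linarith
    qed simp
    also have "\<dots> = 2 ^ ?N * exp (poisson S z)"
      unfolding S_def by (subst poisson_sum) (simp_all add: ln_one_plus_bdry_integrable hE z prod.distrib exp_sum)
    finally have 2: "norm (adjugate (E z) $ i $ j) \<le> 2 ^ ?N * exp (poisson S z)" .
    have "F k z $ i $ j = \<phi> k z / det (E z) * adjugate (E z) $ i $ j" by (simp add: F_def)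
    then have "norm (F k z $ i $ j) = norm (\<phi> k z / det (E z)) * norm (adjugate (E z) $ i $ j)"
      by (simp only: norm_mult)
    also have "\<dots> \<le> (real k + 1) / exp (poisson S z) * (2 ^ ?N * exp (poisson S z))"
      by (intro mult_mono 1 2) auto
    finally show ?thesis by simp
  qed
  have Einf: "F k \<in> hardy_inf" for k
  proof -
    have Eh: "(\<lambda>z. E z $ i $ j) holomorphic_on ball 0 1" for i j
      by (rule hardy2_holomorphic[OF hE])
    have "(\<lambda>z. adjugate (E z) $ i $ j) holomorphic_on ball 0 1" for i j
      unfolding adjugate_def vec_lambda_beta
    proof (rule holomorphic_det)
      fix i' j'
      show "(\<lambda>z. (\<chi> i' j'. if j' = i then if i' = j then 1 else 0 else E z $ i' $ j') $ i' $ j') holomorphic_on ball 0 1"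
        by (cases "j' = i"; cases "i' = j") (simp_all add: Eh)
    qed
    then have "(\<lambda>z. F k z $ i $ j) holomorphic_on ball 0 1" for i j
      unfolding F_def vec_lambda_beta
      by (intro holomorphic_intros \<phi>hol holomorphic_det Eh) (auto simp: det0)
    moreover have "opnorm (F k z) \<le> (\<Sum>p\<in>(UNIV :: ('n \<times> 'n) set). (real k + 1) * 2 ^ ?N)" if "norm z < 1" for z
    proof -
      have "opnorm (F k z) \<le> entry_sum (F k z)" by (rule opnorm_le_entry_sum)
      also have "\<dots> \<le> (\<Sum>p\<in>(UNIV :: ('n \<times> 'n) set). (real k + 1) * 2 ^ ?N)"
        unfolding entry_sum_def by (intro sum_mono entry that)
      finally show ?thesis .
    qed
    ultimately show ?thesis unfolding hardy_inf_def matrix_holomorphic_def by (simp add: Ball_def) blast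
  qed
  show ?thesis
    by (intro exI[of _ F] exI[of _ \<phi>] conjI allI impI Einf \<phi>hol \<phi>1 \<phi>0 FE)
qed

text \<open>The mean over every smaller circle is \<open>f 0\<close>, and \<open>L^1\<close>
  convergence carries it to the boundary.\<close>

lemma hardy2_mean_value:
  assumes "hardy2 f"
  shows "(LINT t|circle_measure. bdry f t) = f 0"
proof -
  note f = hardy2_holomorphic[OF assms]
  let ?F = "\<lambda>n t. f (of_real (radius_seq n) * t)"
  have int: "integrable circle_measure (?F n)" for n
    by (intro continuous_circle_integrable dilation_continuous_sphere f) auto
  have mean: "(LINT t|circle_measure. ?F n t) = f 0" for n
    using circle_mean_value[OF dilation_holomorphic[OF f, of "radius_seq n"] dilation_continuous[OF f, of "radius_seq n"]] by simp
  have "norm (f 0 - (LINT t|circle_measure. bdry f t)) \<le> (LINT t|circle_measure. norm (?F n t - bdry f t))" for n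
  proof -
    have "f 0 - (LINT t|circle_measure. bdry f t) = (LINT t|circle_measure. ?F n t - bdry f t)"
      using int[of n] hardy2_bdry_integrable(1)[OF assms] by (simp add: mean)
    then show ?thesis by (simp only: integral_norm_bound)
  qed
  then have "norm (f 0 - (LINT t|circle_measure. bdry f t)) \<le> 0"
    by (intro LIMSEQ_le_const[OF hardy2_L1_limit[OF assms]]) auto
  then show ?thesis by simp
qed

text \<open>On smaller circles \<open>|\<phi> - 1|^2 \<le> 2 - 2 Re \<phi>\<close> because
  \<open>|\<phi>| \<le> 1\<close>, and the mean of \<open>Re \<phi>\<close> is its value at 0.
  Fatou's lemma transfers the bound to the boundary.\<close>

lemma bounded_bdry_distance_one:
  assumes \<phi>: "\<phi> holomorphic_on ball 0 1" "\<And>z. norm z < 1 \<Longrightarrow> norm (\<phi> z) \<le> 1"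
  shows "integrable circle_measure (\<lambda>t. (norm (bdry \<phi> t - 1))\<^sup>2)"
    "(LINT t|circle_measure. (norm (bdry \<phi> t - 1))\<^sup>2) \<le> 2 - 2 * Re (\<phi> 0)"
proof -
  have h: "hardy2 \<phi>" by (rule hardy2_bounded[OF \<phi>])
  let ?F = "\<lambda>n t. \<phi> (of_real (radius_seq n) * t)"
  have c: "continuous_on (sphere 0 1) (?F n)" for n by (intro dilation_continuous_sphere \<phi>) auto
  have 1: "integrable circle_measure (\<lambda>t. (norm (?F n t - 1))\<^sup>2)" for n
    by (intro continuous_circle_integrable continuous_intros c)
  have 2: "(\<lambda>t. (norm (bdry \<phi> t - 1))\<^sup>2) \<in> borel_measurable circle_measure"
    using bdry_measurable[OF \<phi>(1)] by measurable
  have 3: "AE t in circle_measure. (\<lambda>n. (norm (?F n t - 1))\<^sup>2) \<longlonglongrightarrow> (norm (bdry \<phi> t - 1))\<^sup>2"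
    using hardy2_bdry_lim[OF h] by eventually_elim (intro tendsto_intros)
  have "(LINT t|circle_measure. (norm (?F n t - 1))\<^sup>2) \<le> 2 - 2 * Re (\<phi> 0)" for n
  proof -
    have Fi: "integrable circle_measure (?F n)" by (rule continuous_circle_integrable[OF c])
    have "(LINT t|circle_measure. (norm (?F n t - 1))\<^sup>2) \<le> (LINT t|circle_measure. 2 - 2 * Re (?F n t))"
    proof (intro integral_mono_AE 1 continuous_circle_integrable continuous_intros c)
      show "AE t in circle_measure. (norm (?F n t - 1))\<^sup>2 \<le> 2 - 2 * Re (?F n t)"
        using AE_circle_sphere
      proof eventually_elim
        case (elim t)
        have "(norm (?F n t))\<^sup>2 \<le> 1" using elim by (intro power_le_one \<phi>) (auto simp: norm_mult)
        then show ?case unfolding cmod_power2 by (simp add: power2_eq_square algebra_simps)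
      qed
    qed
    also have "\<dots> = 2 - 2 * Re (LINT t|circle_measure. ?F n t)"
      using Fi by (simp add: space_circle_measure)
    also have "(LINT t|circle_measure. ?F n t) = \<phi> 0"
      using circle_mean_value[OF dilation_holomorphic[OF \<phi>(1), of "radius_seq n"] dilation_continuous[OF \<phi>(1), of "radius_seq n"]] by simp
    finally show ?thesis .
  qed
  then have 4: "\<forall>\<^sub>F n in sequentially. (LINT t|circle_measure. (norm (?F n t - 1))\<^sup>2) \<le> 2 - 2 * Re (\<phi> 0)"
    by simp
  show "integrable circle_measure (\<lambda>t. (norm (bdry \<phi> t - 1))\<^sup>2)"
    "(LINT t|circle_measure. (norm (bdry \<phi> t - 1))\<^sup>2) \<le> 2 - 2 * Re (\<phi> 0)"
    using circle_fatou[OF 1 2 _ 3 4] by auto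
qed

lemma tendsto_matrix_mult:
  fixes F G :: "'a \<Rightarrow> complex^'n^'n"
  assumes "(F \<longlongrightarrow> A) net" "(G \<longlongrightarrow> B) net"
  shows "((\<lambda>x. F x ** G x) \<longlongrightarrow> A ** B) net"
  unfolding tendsto_matrix_iff matrix_matrix_mult_def vec_lambda_beta
  by (intro allI tendsto_intros assms)

lemma radial_eventually_ball:
  fixes t :: complex
  assumes "norm t = 1"
  shows "\<forall>\<^sub>F r in at_left 1. norm (of_real r * t) < 1"
  using eventually_at_left_real[of 0 1, OF zero_less_one]
  by eventually_elim (use assms in \<open>auto simp: norm_mult\<close>)

text \<open>Both factors may depend on \<open>k\<close>, so that either one can be the constant
  sequence \<open>E\<close>; exchanging them yields the left and the right statement from one
  proof.\<close>

lemma quotient_approximation: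
  fixes F G :: "nat \<Rightarrow> complex \<Rightarrow> complex^'n^'n"
  assumes F: "\<And>k i j. hardy2 (\<lambda>z. F k z $ i $ j)" and G: "\<And>k i j. hardy2 (\<lambda>z. G k z $ i $ j)"
    and \<phi>: "\<And>k. \<phi> k holomorphic_on ball 0 1" "\<And>k z. norm z < 1 \<Longrightarrow> norm (\<phi> k z) \<le> 1"
    and \<phi>0: "(\<lambda>k. \<phi> k 0) \<longlonglongrightarrow> 1"
    and FG: "\<And>k z. norm z < 1 \<Longrightarrow> F k z ** G k z = (\<chi> i j. if i = j then \<phi> k z else 0)"
  shows "(\<lambda>k. \<integral>\<^sup>+t. ennreal ((opnorm (radial_boundary (F k) t ** radial_boundary (G k) t - mat 1))\<^sup>2) \<partial>circle_measure)
    \<longlonglongrightarrow> 0"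
proof (rule tendsto_sandwich[OF _ _ tendsto_const])
  have h\<phi>: "hardy2 (\<phi> k)" for k by (rule hardy2_bounded[OF \<phi>])
  \<comment> \<open>Inside the disc the product is a scalar matrix; uniqueness of radial limits
    carries this to the boundary, where the operator norm becomes the modulus of a scalar.\<close>
  have eq: "AE t in circle_measure. opnorm (radial_boundary (F k) t ** radial_boundary (G k) t - mat 1) = norm (bdry (\<phi> k) t - 1)" for k
    using bdry_matrix_lim[OF F[of k]] bdry_matrix_lim[OF G[of k]] hardy2_bdry_radial[OF h\<phi>[of k]] AE_circle_sphere
  proof eventually_elim
    case (elim t)
    have l1: "((\<lambda>r. F k (of_real r * t) ** G k (of_real r * t)) \<longlongrightarrow> radial_boundary (F k) t ** radial_boundary (G k) t) (at_left 1)"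
      unfolding radial_boundary_eq[OF elim(1)] radial_boundary_eq[OF elim(2)] by (rule tendsto_matrix_mult[OF elim(1,2)])
    have "((\<lambda>r. \<chi> i j. if i = j then \<phi> k (of_real r * t) else 0) \<longlongrightarrow> (\<chi> i j. if i = j then bdry (\<phi> k) t else 0 :: complex^'n^'n)) (at_left 1)"
      unfolding tendsto_matrix_iff using elim(3) by simp
    moreover have "\<forall>\<^sub>F r in at_left 1. (\<chi> i j. if i = j then \<phi> k (of_real r * t) else 0) = F k (of_real r * t) ** G k (of_real r * t)"
      using radial_eventually_ball[OF elim(4)] by eventually_elim (simp add: FG)
    ultimately have l2: "((\<lambda>r. F k (of_real r * t) ** G k (of_real r * t)) \<longlongrightarrow> (\<chi> i j. if i = j then bdry (\<phi> k) t else 0)) (at_left 1)"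
      by (rule Lim_transform_eventually)
    have "radial_boundary (F k) t ** radial_boundary (G k) t = (\<chi> i j. if i = j then bdry (\<phi> k) t else 0)"
      by (rule tendsto_unique[OF trivial_limit_at_left_real l1 l2])
    then have "radial_boundary (F k) t ** radial_boundary (G k) t - mat 1 = (\<chi> i j. if i = j then bdry (\<phi> k) t - 1 else 0)"
      by (simp add: vec_eq_iff mat_def)
    then show ?case by (simp only: opnorm_scaled_identity)
  qed
  have le: "(\<integral>\<^sup>+t. ennreal ((opnorm (radial_boundary (F k) t ** radial_boundary (G k) t - mat 1))\<^sup>2) \<partial>circle_measure) \<le>
      ennreal (2 - 2 * Re (\<phi> k 0))" for k
  proof -
    have "(\<integral>\<^sup>+t. ennreal ((opnorm (radial_boundary (F k) t ** radial_boundary (G k) t - mat 1))\<^sup>2) \<partial>circle_measure) =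
        (\<integral>\<^sup>+t. ennreal ((norm (bdry (\<phi> k) t - 1))\<^sup>2) \<partial>circle_measure)"
      by (rule nn_integral_cong_AE) (use eq[of k] in eventually_elim, simp)
    also have "\<dots> = ennreal (LINT t|circle_measure. (norm (bdry (\<phi> k) t - 1))\<^sup>2)"
      by (rule nn_integral_eq_integral[OF bounded_bdry_distance_one(1)[OF \<phi>]]) auto
    also have "\<dots> \<le> ennreal (2 - 2 * Re (\<phi> k 0))"
      by (intro ennreal_leI bounded_bdry_distance_one(2)[OF \<phi>])
    finally show ?thesis .
  qed
  then show "\<forall>\<^sub>F k in sequentially. (\<integral>\<^sup>+t. ennreal ((opnorm (radial_boundary (F k) t ** radial_boundary (G k) t - mat 1))\<^sup>2) \<partial>circle_measure) \<le>
      ennreal (2 - 2 * Re (\<phi> k 0))" by simp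
  have "(\<lambda>k. 2 - 2 * Re (\<phi> k 0)) \<longlonglongrightarrow> 2 - 2 * Re 1" by (intro tendsto_intros \<phi>0)
  then have "(\<lambda>k. ennreal (2 - 2 * Re (\<phi> k 0))) \<longlonglongrightarrow> ennreal (2 - 2 * Re 1)" by (rule tendsto_ennrealI)
  then show "(\<lambda>k. ennreal (2 - 2 * Re (\<phi> k 0))) \<longlonglongrightarrow> 0" by simp
qed simp

section \<open>Beurling-outer functions are outer\<close>

text \<open>Collects what the boundary Jensen inequality asks of \<open>h = det F\<close>: the
  boundary limit, its measurability, holomorphy and the exponential majorant.\<close>

lemma hardy2_bdry_det:
  fixes F :: "complex \<Rightarrow> complex^'n^'n"
  assumes F: "\<And>i j. hardy2 (\<lambda>z. F z $ i $ j)"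
  shows "AE t in circle_measure. (\<lambda>n. det (F (of_real (radius_seq n) * t))) \<longlonglongrightarrow> det (bdry_matrix F t)"
    "(\<lambda>t. det (bdry_matrix F t)) \<in> borel_measurable circle_measure"
    "(\<lambda>z. det (F z)) holomorphic_on ball 0 1"
    "norm z < 1 \<Longrightarrow> norm (det (F z)) \<le> exp (\<Sum>p\<in>(UNIV :: ('n \<times> 'n) set). norm (F z $ fst p $ snd p))"
proof -
  show "AE t in circle_measure. (\<lambda>n. det (F (of_real (radius_seq n) * t))) \<longlonglongrightarrow> det (bdry_matrix F t)"
    using bdry_matrix_lim[OF F]
    by eventually_elim (rule filterlim_compose[OF tendsto_det radius_seq_at_left])
  show "(\<lambda>t. det (bdry_matrix F t)) \<in> borel_measurable circle_measure"
    unfolding det_def bdry_matrix_def vec_lambda_beta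
    by (intro borel_measurable_sum borel_measurable_times borel_measurable_const borel_measurable_prod
        bdry_measurable hardy2_holomorphic F)
  show "(\<lambda>z. det (F z)) holomorphic_on ball 0 1"
    by (intro holomorphic_det hardy2_holomorphic F)
  show "norm (det (F z)) \<le> exp (\<Sum>p\<in>(UNIV :: ('n \<times> 'n) set). norm (F z $ fst p $ snd p))"
    using norm_det_le_exp[of "F z"] by (simp add: entry_sum_def)
qed

lemma det_jensen:
  fixes F :: "complex \<Rightarrow> complex^'n^'n"
  assumes F: "\<And>i j. hardy2 (\<lambda>z. F z $ i $ j)" and 0: "det (F 0) \<noteq> 0"
  shows "AE t in circle_measure. det (bdry_matrix F t) \<noteq> 0"
    "integrable circle_measure (\<lambda>t. ln (norm (det (bdry_matrix F t))))"
    "norm z < 1 \<Longrightarrow> norm (det (F z)) \<le> exp (poisson (\<lambda>t. ln (norm (det (bdry_matrix F t)))) z)"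
proof -
  have F': "\<And>p. p \<in> (UNIV :: ('n \<times> 'n) set) \<Longrightarrow> hardy2 (\<lambda>z. F z $ fst p $ snd p)" by (rule F)
  note J = jensen_boundary[where I="UNIV :: ('n \<times> 'n) set" and f="\<lambda>p z. F z $ fst p $ snd p" and h="\<lambda>z. det (F z)"
      and H="\<lambda>t. det (bdry_matrix F t)", OF finite F' hardy2_bdry_det(3)[OF F] hardy2_bdry_det(4)[OF F]
      hardy2_bdry_det(1)[OF F] hardy2_bdry_det(2)[OF F] 0]
  show "AE t in circle_measure. det (bdry_matrix F t) \<noteq> 0"
    by (rule J(1)) auto
  show "integrable circle_measure (\<lambda>t. ln (norm (det (bdry_matrix F t))))"
    by (rule J(2)) auto
  show "norm (det (F z)) \<le> exp (poisson (\<lambda>t. ln (norm (det (bdry_matrix F t)))) z)" if "norm z < 1"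
    by (rule J(3)) (use that in auto)
qed

lemma outer_of_extremal:
  assumes h: "h holomorphic_on ball 0 1" and W: "integrable circle_measure (\<lambda>t. ln (W t))"
    and W0: "\<And>t. 0 \<le> W t" "AE t in circle_measure. 0 < W t"
    and le: "\<And>z. norm z < 1 \<Longrightarrow> norm (h z) \<le> exp (poisson (\<lambda>t. ln (W t)) z)"
    and ge: "exp (LINT t|circle_measure. ln (W t)) \<le> norm (h 0)"
  shows "scalar_outer h"
proof -
  \<comment> \<open>The quotient of \<open>h\<close> by the outer function with weight
    \<open>W\<close>. It is bounded by 1 and has modulus 1 at the centre, hence is constant;
    \<open>q 0\<close> becomes the unimodular factor in \<open>scalar_outer\<close>.\<close>
  define q where "q = (\<lambda>z. h z * exp (- herglotz (\<lambda>t. ln (W t)) z))"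
  have q: "q holomorphic_on ball 0 1"
    unfolding q_def by (intro holomorphic_intros h herglotz_holomorphic W)
  have qn: "norm (q z) = norm (h z) * exp (- poisson (\<lambda>t. ln (W t)) z)" if "norm z < 1" for z
    by (simp add: q_def norm_mult Re_herglotz[OF W that])
  have q1: "norm (q z) \<le> 1" if "norm z < 1" for z
  proof -
    have "norm (q z) \<le> exp (poisson (\<lambda>t. ln (W t)) z) * exp (- poisson (\<lambda>t. ln (W t)) z)"
      unfolding qn[OF that] by (intro mult_right_mono le that) auto
    then show ?thesis by (simp flip: exp_add)
  qed
  have "1 \<le> norm (q 0)"
  proof -
    have "exp (LINT t|circle_measure. ln (W t)) * exp (- (LINT t|circle_measure. ln (W t))) \<le> norm (q 0)"
      using ge by (simp add: qn poisson_zero)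
    then show ?thesis by (simp flip: exp_add)
  qed
  with q1[of 0] have q0: "norm (q 0) = 1" by simp
  have "q constant_on ball 0 1"
    by (rule maximum_modulus_principle[OF q open_ball connected_ball open_ball order_refl, of 0]) (use q0 q1 in auto)
  then have const: "q z = q 0" if "norm z < 1" for z
    using that unfolding constant_on_def by (metis dist_0_norm mem_ball norm_zero zero_less_one)
  show ?thesis
    unfolding scalar_outer_def
  proof (intro exI[of _ "q 0"] exI[of _ W] conjI ballI q0 W W0)
    fix z :: complex assume "z \<in> ball 0 1"
    then have "h z * exp (- herglotz (\<lambda>t. ln (W t)) z) = q 0"
      using const[of z] by (simp add: q_def)
    then have "h z = q 0 * exp (herglotz (\<lambda>t. ln (W t)) z)"
      by (simp add: exp_minus field_simps)
    then show "h z = q 0 * exp (LINT t|circle_measure. (t + z) / (t - z) * of_real (ln (W t)))"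
      by (simp add: herglotz_def)
  qed
qed

lemma approximation_entries:
  fixes G :: "nat \<Rightarrow> complex \<Rightarrow> complex^'n^'n"
  assumes G: "\<And>k i j. hardy2 (\<lambda>z. G k z $ i $ j)"
    and lim: "(\<lambda>k. \<integral>\<^sup>+t. ennreal ((opnorm (bdry_matrix (G k) t - mat 1))\<^sup>2) \<partial>circle_measure) \<longlonglongrightarrow> 0"
  shows "(\<lambda>k. LINT t|circle_measure. norm ((bdry_matrix (G k) t - mat 1) $ i $ j)) \<longlonglongrightarrow> 0"
    "integrable circle_measure (\<lambda>t. (bdry_matrix (G k) t - mat 1) $ i $ j)"
proof -
  have int: "integrable circle_measure (\<lambda>t. (bdry_matrix (G k) t - mat 1) $ i $ j)" for k
    unfolding vector_minus_component bdry_matrix_def vec_lambda_beta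
    by (intro Bochner_Integration.integrable_diff hardy2_bdry_integrable G) simp
  then show "integrable circle_measure (\<lambda>t. (bdry_matrix (G k) t - mat 1) $ i $ j)" .
  let ?x = "\<lambda>k t. (bdry_matrix (G k) t - mat 1) $ i $ j"
  show "(\<lambda>k. LINT t|circle_measure. norm (?x k t)) \<longlonglongrightarrow> 0"
  proof (rule LIMSEQ_I)
    fix e :: real assume "e > 0"
    \<comment> \<open>With \<open>e / 3\<close> the resulting \<open>L^1\<close> bound
      \<open>2 * (e / 3)\<close> stays strictly below \<open>e\<close>.\<close>
    then have "0 < ennreal ((e / 3)\<^sup>2)" by simp
    from order_tendstoD(2)[OF lim this]
    have "\<forall>\<^sub>F k in sequentially. (LINT t|circle_measure. norm (?x k t)) < e"
    proof eventually_elim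
      case (elim k)
      have meas: "?x k \<in> borel_measurable circle_measure" using int[of k] by simp
      have "(\<integral>\<^sup>+t. ennreal ((norm (?x k t))\<^sup>2) \<partial>circle_measure) \<le>
          (\<integral>\<^sup>+t. ennreal ((opnorm (bdry_matrix (G k) t - mat 1))\<^sup>2) \<partial>circle_measure)"
        by (intro nn_integral_mono ennreal_leI power_mono norm_entry_le_opnorm norm_ge_zero)
      then have le: "(\<integral>\<^sup>+t. ennreal ((norm (?x k t))\<^sup>2) \<partial>circle_measure) \<le> ennreal ((e / 3)\<^sup>2)"
        using elim by (meson le_less_trans less_imp_le)
      have sq: "integrable circle_measure (\<lambda>t. (norm (?x k t))\<^sup>2)"
        by (rule integrableI_nonneg) (use meas le in \<open>auto intro: le_less_trans\<close>)
      have "(LINT t|circle_measure. (norm (?x k t))\<^sup>2) \<le> (e / 3)\<^sup>2"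
        using le nn_integral_eq_integral[OF sq] by simp
      then have "(LINT t|circle_measure. norm (?x k t)) \<le> 2 * (e / 3)"
        using \<open>e > 0\<close> by (intro integral_norm_le_of_square meas sq) auto
      then show ?case using \<open>e > 0\<close> by linarith
    qed
    then show "\<exists>N. \<forall>k\<ge>N. norm ((LINT t|circle_measure. norm (?x k t)) - 0) < e"
      by (simp add: eventually_sequentially)
  qed
qed

text \<open>The order of the factors is hidden behind the determinant identities inside the disc and
  on the boundary, so \<open>G k\<close> can be either product of \<open>F k\<close> and
  \<open>E\<close>.\<close>

lemma approximation_imp_outer:
  fixes E :: "complex \<Rightarrow> complex^'n^'n" and F G :: "nat \<Rightarrow> complex \<Rightarrow> complex^'n^'n"
  assumes E: "\<And>i j. hardy2 (\<lambda>z. E z $ i $ j)" and F: "\<And>k i j. hardy2 (\<lambda>z. F k z $ i $ j)"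
    and G: "\<And>k i j. hardy2 (\<lambda>z. G k z $ i $ j)"
    and detG: "\<And>k z. det (G k z) = det (F k z) * det (E z)"
    and detGb: "\<And>k. AE t in circle_measure. det (bdry_matrix (G k) t) = det (bdry_matrix (F k) t) * det (bdry_matrix E t)"
    and lim: "(\<lambda>k. \<integral>\<^sup>+t. ennreal ((opnorm (bdry_matrix (G k) t - mat 1))\<^sup>2) \<partial>circle_measure) \<longlonglongrightarrow> 0"
  shows "scalar_outer (\<lambda>z. det (E z))"
proof -
  let ?D = "\<lambda>k t. bdry_matrix (G k) t - mat 1"
  define b where "b = (\<lambda>k. LINT t|circle_measure. entry_sum (?D k t))"
  have Di: "integrable circle_measure (\<lambda>t. entry_sum (?D k t))" for k
    unfolding entry_sum_def by (intro Bochner_Integration.integrable_sum integrable_norm approximation_entries[OF G lim])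
  have b0: "b \<longlonglongrightarrow> 0"
  proof -
    have "b = (\<lambda>k. \<Sum>p\<in>UNIV. LINT t|circle_measure. norm (?D k t $ fst p $ snd p))"
      unfolding b_def entry_sum_def
      by (intro ext Bochner_Integration.integral_sum integrable_norm approximation_entries[OF G lim])
    moreover have "\<dots> \<longlonglongrightarrow> 0"
      by (intro tendsto_null_sum approximation_entries[OF G lim])
    ultimately show ?thesis by simp
  qed
  \<comment> \<open>Values at 0 are means of boundary values, so \<open>L^1\<close> convergence on
    the boundary suffices.\<close>
  have G0: "(\<lambda>k. G k 0) \<longlonglongrightarrow> mat 1"
    unfolding tendsto_matrix_iff
  proof (intro allI)
    fix i j
    have "norm (G k 0 $ i $ j - mat 1 $ i $ j) \<le> (LINT t|circle_measure. norm (?D k t $ i $ j))" for k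
    proof -
      have "G k 0 $ i $ j - mat 1 $ i $ j = (LINT t|circle_measure. bdry (\<lambda>z. G k z $ i $ j) t - mat 1 $ i $ j)"
        using hardy2_bdry_integrable(1)[OF G] hardy2_mean_value[OF G]
        by (subst Bochner_Integration.integral_diff) (auto simp: space_circle_measure)
      also have "\<dots> = (LINT t|circle_measure. ?D k t $ i $ j)" by (simp add: bdry_matrix_def)
      finally show ?thesis by (simp only: integral_norm_bound)
    qed
    then have "(\<lambda>k. G k 0 $ i $ j - mat 1 $ i $ j) \<longlonglongrightarrow> 0"
      by (intro Lim_null_comparison[OF _ approximation_entries(1)[OF G lim]] always_eventually allI)
    then show "(\<lambda>k. G k 0 $ i $ j) \<longlonglongrightarrow> mat 1 $ i $ j" by (rule LIM_zero_cancel)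
  qed
  have det1: "(\<lambda>k. det (G k 0)) \<longlonglongrightarrow> 1" using tendsto_det[OF G0] by simp
  then have nz: "\<forall>\<^sub>F k in sequentially. det (G k 0) \<noteq> 0"
    by (rule tendsto_imp_eventually_ne) simp
  \<comment> \<open>A single index with nonzero determinant excludes \<open>det (E 0) = 0\<close>,
    which makes Jensen's inequality available for \<open>E\<close> itself.\<close>
  then obtain k0 where "det (G k0 0) \<noteq> 0" using eventually_happens'[OF sequentially_bot] by blast
  then have E0: "det (E 0) \<noteq> 0" by (simp add: detG)
  note JE = det_jensen[OF E E0]
  let ?L = "LINT t|circle_measure. ln (norm (det (bdry_matrix E t)))"
  \<comment> \<open>\<open>b k - ?L\<close> bounds the integral of \<open>ln |det (F k)|\<close> on
    the boundary. Passing to \<open>det (G k 0)\<close> on the left eliminates \<open>F k\<close>,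
    for which no bound uniform in \<open>k\<close> is at hand.\<close>
  have "\<forall>\<^sub>F k in sequentially. norm (det (G k 0)) \<le> exp (b k - ?L) * norm (det (E 0))"
    using nz
  proof eventually_elim
    case (elim k)
    then have F0: "det (F k 0) \<noteq> 0" by (simp add: detG)
    note JF = det_jensen[OF F F0]
    have "(LINT t|circle_measure. ln (norm (det (bdry_matrix (F k) t)))) \<le>
        (LINT t|circle_measure. entry_sum (?D k t) - ln (norm (det (bdry_matrix E t))))"
    proof (intro integral_mono_AE JF(2) Bochner_Integration.integrable_diff Di JE(2))
      show "AE t in circle_measure. ln (norm (det (bdry_matrix (F k) t))) \<le> entry_sum (?D k t) - ln (norm (det (bdry_matrix E t)))"
        using JF(1) JE(1) detGb[of k]
      proof eventually_elim
        case (elim t)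
        have "norm (det (bdry_matrix (F k) t)) * norm (det (bdry_matrix E t)) \<le> exp (entry_sum (?D k t))"
          using norm_det_le_exp_diff[of "bdry_matrix (G k) t"] elim by (simp add: norm_mult)
        then have "ln (norm (det (bdry_matrix (F k) t)) * norm (det (bdry_matrix E t))) \<le> ln (exp (entry_sum (?D k t)))"
          using elim by (subst ln_le_cancel_iff) auto
        then show ?case using elim by (simp add: ln_mult)
      qed
    qed
    also have "\<dots> = b k - ?L" unfolding b_def by (rule Bochner_Integration.integral_diff[OF Di JE(2)])
    finally have "exp (poisson (\<lambda>t. ln (norm (det (bdry_matrix (F k) t)))) 0) \<le> exp (b k - ?L)"
      by (simp add: poisson_zero)
    then have "norm (det (F k 0)) \<le> exp (b k - ?L)"
      by (rule order_trans[OF JF(3)[of 0], rotated]) simp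
    then show ?case by (simp add: detG norm_mult mult_right_mono)
  qed
  moreover have "(\<lambda>k. exp (b k - ?L) * norm (det (E 0))) \<longlonglongrightarrow> exp (0 - ?L) * norm (det (E 0))"
    by (intro tendsto_intros b0)
  moreover have "(\<lambda>k. norm (det (G k 0))) \<longlonglongrightarrow> norm (1 :: complex)" by (intro tendsto_norm det1)
  ultimately have "norm (1 :: complex) \<le> exp (0 - ?L) * norm (det (E 0))"
    by (intro tendsto_le[OF sequentially_bot])
  then have ge: "exp ?L \<le> norm (det (E 0))" by (simp add: exp_minus field_simps)
  show ?thesis
  proof (rule outer_of_extremal[OF hardy2_bdry_det(3)[OF E] JE(2) _ _ JE(3) ge])
    show "AE t in circle_measure. 0 < norm (det (bdry_matrix E t))" using JE(1) by simp
  qed auto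
qed

text \<open>Products of two \<open>H^2\<close> functions can leave \<open>H^2\<close>; boundedness
  of the entries of \<open>F\<close> keeps each summand inside.\<close>

lemma matrix_product_hardy2:
  fixes F G :: "complex \<Rightarrow> complex^'n^'n"
  assumes "F \<in> hardy_inf" "G \<in> hardy_two"
  shows "hardy2 (\<lambda>z. (F z ** G z) $ i $ j)" "hardy2 (\<lambda>z. (G z ** F z) $ i $ j)"
proof -
  have *: "hardy2 (\<lambda>z. F z $ i $ j * G z $ k $ l)" for i j k l
    by (rule hardy_inf_entry[OF assms(1), of i j]) (rule hardy2_bounded_mult[OF _ _ hardy_two_entry[OF assms(2)]])
  show "hardy2 (\<lambda>z. (F z ** G z) $ i $ j)"
    unfolding matrix_matrix_mult_def vec_lambda_beta by (intro hardy2_sum *)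
  show "hardy2 (\<lambda>z. (G z ** F z) $ i $ j)"
    unfolding matrix_matrix_mult_def vec_lambda_beta mult.commute[of "G _ $ _ $ _"] by (intro hardy2_sum *)
qed

lemma bdry_matrix_mult:
  fixes F G :: "complex \<Rightarrow> complex^'n^'n"
  assumes "\<And>i j. hardy2 (\<lambda>z. F z $ i $ j)" "\<And>i j. hardy2 (\<lambda>z. G z $ i $ j)" "\<And>i j. hardy2 (\<lambda>z. (F z ** G z) $ i $ j)"
  shows "AE t in circle_measure. bdry_matrix (\<lambda>z. F z ** G z) t = bdry_matrix F t ** bdry_matrix G t"
  using bdry_matrix_lim[OF assms(1)] bdry_matrix_lim[OF assms(2)] bdry_matrix_lim[of "\<lambda>z. F z ** G z", OF assms(3)]
  by eventually_elim (rule tendsto_unique[OF trivial_limit_at_left_real _ tendsto_matrix_mult])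

text \<open>Almost everywhere the product of the radial boundary values is the boundary matrix of
  the product, which brings both integrals into the form of
  \<open>approximation_imp_outer\<close>.\<close>

lemma beurling_approximation_imp_outer:
  fixes E :: "complex \<Rightarrow> complex^'n^'n" and F :: "nat \<Rightarrow> complex \<Rightarrow> complex^'n^'n"
  assumes E: "E \<in> hardy_two" and F: "\<And>k. F k \<in> hardy_inf"
  shows "(\<lambda>k. \<integral>\<^sup>+t. ennreal ((opnorm (radial_boundary (F k) t ** radial_boundary E t - mat 1))\<^sup>2) \<partial>circle_measure) \<longlonglongrightarrow> 0
      \<Longrightarrow> scalar_outer (\<lambda>z. det (E z))"
    and "(\<lambda>k. \<integral>\<^sup>+t. ennreal ((opnorm (radial_boundary E t ** radial_boundary (F k) t - mat 1))\<^sup>2) \<partial>circle_measure) \<longlonglongrightarrow> 0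
      \<Longrightarrow> scalar_outer (\<lambda>z. det (E z))"
proof -
  note hE = hardy_two_entry[OF E] and hF = hardy_inf_entry_hardy2[OF F]
  note rE = radial_boundary_AE[of E, OF hE] and rF = radial_boundary_AE[of "F _", OF hF]
  have hFE: "hardy2 (\<lambda>z. (F k z ** E z) $ i $ j)" and hEF: "hardy2 (\<lambda>z. (E z ** F k z) $ i $ j)" for k i j
    using matrix_product_hardy2[OF F E] by auto
  note bFE = bdry_matrix_mult[of "F _" E, OF hF hE hFE] and bEF = bdry_matrix_mult[of E "F _", OF hE hF hEF]
  show "scalar_outer (\<lambda>z. det (E z))"
    if lim: "(\<lambda>k. \<integral>\<^sup>+t. ennreal ((opnorm (radial_boundary (F k) t ** radial_boundary E t - mat 1))\<^sup>2) \<partial>circle_measure) \<longlonglongrightarrow> 0"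
  proof (rule approximation_imp_outer[OF hE hF hFE])
    show "AE t in circle_measure. det (bdry_matrix (\<lambda>z. F k z ** E z) t) = det (bdry_matrix (F k) t) * det (bdry_matrix E t)" for k
      using bFE[of k] by eventually_elim (simp add: det_mul)
    have "(\<integral>\<^sup>+t. ennreal ((opnorm (radial_boundary (F k) t ** radial_boundary E t - mat 1))\<^sup>2) \<partial>circle_measure) =
        (\<integral>\<^sup>+t. ennreal ((opnorm (bdry_matrix (\<lambda>z. F k z ** E z) t - mat 1))\<^sup>2) \<partial>circle_measure)" for k
    proof (rule nn_integral_cong_AE)
      show "AE t in circle_measure. ennreal ((opnorm (radial_boundary (F k) t ** radial_boundary E t - mat 1))\<^sup>2) =
          ennreal ((opnorm (bdry_matrix (\<lambda>z. F k z ** E z) t - mat 1))\<^sup>2)"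
        using bFE[of k] rE rF[of k] by eventually_elim simp
    qed
    then show "(\<lambda>k. \<integral>\<^sup>+t. ennreal ((opnorm (bdry_matrix (\<lambda>z. F k z ** E z) t - mat 1))\<^sup>2) \<partial>circle_measure) \<longlonglongrightarrow> 0"
      using lim by simp
  qed (simp add: det_mul)
  show "scalar_outer (\<lambda>z. det (E z))"
    if lim: "(\<lambda>k. \<integral>\<^sup>+t. ennreal ((opnorm (radial_boundary E t ** radial_boundary (F k) t - mat 1))\<^sup>2) \<partial>circle_measure) \<longlonglongrightarrow> 0"
  proof (rule approximation_imp_outer[OF hE hF hEF])
    show "AE t in circle_measure. det (bdry_matrix (\<lambda>z. E z ** F k z) t) = det (bdry_matrix (F k) t) * det (bdry_matrix E t)" for k
      using bEF[of k] by eventually_elim (simp add: det_mul)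
    have "(\<integral>\<^sup>+t. ennreal ((opnorm (radial_boundary E t ** radial_boundary (F k) t - mat 1))\<^sup>2) \<partial>circle_measure) =
        (\<integral>\<^sup>+t. ennreal ((opnorm (bdry_matrix (\<lambda>z. E z ** F k z) t - mat 1))\<^sup>2) \<partial>circle_measure)" for k
    proof (rule nn_integral_cong_AE)
      show "AE t in circle_measure. ennreal ((opnorm (radial_boundary E t ** radial_boundary (F k) t - mat 1))\<^sup>2) =
          ennreal ((opnorm (bdry_matrix (\<lambda>z. E z ** F k z) t - mat 1))\<^sup>2)"
        using bEF[of k] rE rF[of k] by eventually_elim simp
    qed
    then show "(\<lambda>k. \<integral>\<^sup>+t. ennreal ((opnorm (bdry_matrix (\<lambda>z. E z ** F k z) t - mat 1))\<^sup>2) \<partial>circle_measure) \<longlonglongrightarrow> 0"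
      using lim by simp
  qed (simp add: det_mul)
qed

lemma outer_hardy_two_subset_beurling:
  fixes E :: "complex \<Rightarrow> complex^'n^'n"
  assumes E: "E \<in> hardy_two" and outer: "scalar_outer (\<lambda>z. det (E z))"
  shows "E \<in> beurling_outer_left" "E \<in> beurling_outer_right"
proof -
  obtain F :: "nat \<Rightarrow> complex \<Rightarrow> complex^'n^'n" and \<phi> where F: "\<And>k. F k \<in> hardy_inf"
    and \<phi>: "\<And>k. \<phi> k holomorphic_on ball 0 1" "\<And>k z. norm z < 1 \<Longrightarrow> norm (\<phi> k z) \<le> 1" "(\<lambda>k. \<phi> k 0) \<longlonglongrightarrow> 1"
    and FE: "\<And>k z. norm z < 1 \<Longrightarrow> F k z ** E z = (\<chi> i j. if i = j then \<phi> k z else 0)"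
      "\<And>k z. norm z < 1 \<Longrightarrow> E z ** F k z = (\<chi> i j. if i = j then \<phi> k z else 0)"
    using outer_imp_bounded_quotients[OF assms] by blast
  note hE = hardy_two_entry[OF E] and hF = hardy_inf_entry_hardy2[OF F]
  show "E \<in> beurling_outer_left"
    unfolding beurling_outer_left_def using E F quotient_approximation[OF hF hE \<phi> FE(1)] by blast
  show "E \<in> beurling_outer_right"
    unfolding beurling_outer_right_def using E F quotient_approximation[OF hE hF \<phi> FE(2)] by blast
qed

theorem theorem5p3:
  shows "(beurling_outer_left :: (complex \<Rightarrow> complex^'n^'n) set) = beurling_outer_right \<and>
         (beurling_outer_right :: (complex \<Rightarrow> complex^'n^'n) set) = outer_class \<inter> hardy_two"
proof -
  have "(beurling_outer_left :: (complex \<Rightarrow> complex^'n^'n) set) = outer_class \<inter> hardy_two"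
  proof (intro equalityI subsetI)
    fix E :: "complex \<Rightarrow> complex^'n^'n" assume "E \<in> beurling_outer_left"
    then show "E \<in> outer_class \<inter> hardy_two"
      unfolding beurling_outer_left_def outer_class_def
      using hardy_two_subset_smirnov beurling_approximation_imp_outer(1)[of E] by blast
  next
    fix E :: "complex \<Rightarrow> complex^'n^'n" assume "E \<in> outer_class \<inter> hardy_two"
    then show "E \<in> beurling_outer_left"
      by (intro outer_hardy_two_subset_beurling) (auto simp: outer_class_def)
  qed
  moreover have "(beurling_outer_right :: (complex \<Rightarrow> complex^'n^'n) set) = outer_class \<inter> hardy_two"
  proof (intro equalityI subsetI)
    fix E :: "complex \<Rightarrow> complex^'n^'n" assume "E \<in> beurling_outer_right"
    then show "E \<in> outer_class \<inter> hardy_two"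
      unfolding beurling_outer_right_def outer_class_def
      using hardy_two_subset_smirnov beurling_approximation_imp_outer(2)[of E] by blast
  next
    fix E :: "complex \<Rightarrow> complex^'n^'n" assume "E \<in> outer_class \<inter> hardy_two"
    then show "E \<in> beurling_outer_right"
      by (intro outer_hardy_two_subset_beurling) (auto simp: outer_class_def)
  qed
  ultimately show ?thesis by simp
qed

end
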